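(* Let $\mathbb{K}$ be a field, $R=\mathbb{K}[x_1,\dots,x_n]$, and let $I=\operatorname{Borel}(M,N)\subset R$ be a two-Borel ideal, where $M$ and $N$ are its two Borel generators, both of degree $d$, with $M$ the lex-earlier one. Then the toric ideal $T(I)$ has a Gröbner basis consisting of quadrics (homogeneous polynomials of degree $2$ in the variables $Y_w$) with respect to the fiber sink order on $S_I$. In particular, the toric ring $\mathbb{K}[I]=S_I/T(I)$ is Koszul.
   Context: Borel ideals: a monomial ideal $I\subset R=\mathbb{K}[x_1,\dots,x_n]$ is Borel if, whenever $f$ is a monomial with $x_jf\in I$ and $i<j$, also $x_if\in I$. For a set $\mathcal{B}$ of monomials of the same degree $d$, $\operatorname{Borel}(\mathcal{B})$ is the smallest Borel ideal containing $\mathcal{B}$; it is minimally generated in degree $d$. It has a unique minimal set of monomials $\mathcal{B}'$ with $\operatorname{Borel}(\mathcal{B}')=\operatorname{Borel}(\mathcal{B})$, whose elements are called its Borel generators. A two-Borel ideal is an ideal $I=\operatorname{Borel}(M,N)$ (with $M,N$ monomials of the same degree $d$) having exactly two Borel generators, namely $M$ and $N$. For monomials $u,v$ of degree $d$, "$u$ precedes $v$ in the lex order" (or "$u$ is lex-earlier than $v$") means that at the first index $i$ where the exponents of $x_i$ differ, $u$ has the larger exponent. Toric ideal: $\operatorname{gens}(I)$ is the set of minimal monomial generators of $I$; $S_I=\mathbb{K}[Y_w: w\in\operatorname{gens}(I)]$; $\phi:S_I\to R$ is the $\mathbb{K}$-algebra map with $\phi(Y_w)=w$; $T(I)=\ker\phi$;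 and $\mathbb{K}[I]=S_I/T(I)$, graded with each $Y_w$ in degree $1$. Fiber sink order: let $G_M=\operatorname{gens}(\operatorname{Borel}(M))$ and $G_N=\operatorname{gens}(I)\smallsetminus G_M$. The fiber sink variable order lists the variables $Y_w$ as follows: (i) if $u,v\in G_N$ and $u$ precedes $v$ in the lex order, then $Y_v$ precedes $Y_u$; (ii) if $u\in G_M$ and $v\in G_N$, then $Y_v$ precedes $Y_u$; (iii) if $u,v\in G_M$ and $u$ precedes $v$ in the lex order, then $Y_u$ precedes $Y_v$. Thus $Y_N$ is first and $Y_M$ is last. The fiber sink order $\succ$ on $S_I$ is the (graded) reverse lexicographic monomial order induced by this variable order, with first variables largest: $Z\succ Z'$ if $\deg Z>\deg Z'$, or $\deg Z=\deg Z'$ and, for the last variable (in the fiber sink variable order) whose exponents in $Z$ and $Z'$ differ, $Z$ has the smaller exponent. Koszul: a standard graded algebra $A$ over a field $A_0=\mathbb{K}$ is Koszul if the residue field $A/A_+\cong\mathbb{K}$ has a linear graded free resolution over $A$. *)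

theory Defs
  imports
    "HOL-Library.Poly_Mapping"
    "HOL-Algebra.QuotRing"
    "HOL-Algebra.Module"
    "HOL-Algebra.Generated_Rings"
    "HOL-Algebra.Embedded_Algebras"
begin

section \<open>Polynomial rings\<close>

text \<open>
  A monomial in variables of type \<open>'a\<close> is its exponent vector \<open>'a \<Rightarrow>\<^sub>0 nat\<close>, written additively,
  so that multiplication of monomials is \<open>+\<close>. A polynomial maps monomials to coefficients.
  The order relation \<open>\<le>\<close> that the library puts on \<open>'a \<Rightarrow>\<^sub>0 nat\<close> is not divisibility.
\<close>

type_synonym 'a monom = "'a \<Rightarrow>\<^sub>0 nat"
type_synonym ('a, 'k) mpoly = "'a monom \<Rightarrow>\<^sub>0 'k"

abbreviation "keys \<equiv> Poly_Mapping.keys"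
abbreviation "lookup \<equiv> Poly_Mapping.lookup"

definition mon :: "'a monom \<Rightarrow> ('a, 'k::field) mpoly" where
  "mon m = Poly_Mapping.single m 1"

definition mon_deg :: "'a monom \<Rightarrow> nat" where
  "mon_deg m = (\<Sum>x\<in>keys m. lookup m x)"

definition mon_dvd :: "'a monom \<Rightarrow> 'a monom \<Rightarrow> bool" where
  "mon_dvd u m \<longleftrightarrow> (\<exists>v. m = u + v)"

definition mons :: "'a set \<Rightarrow> 'a monom set" where
  "mons X = {m. keys m \<subseteq> X}"

definition poly_ring :: "'a set \<Rightarrow> ('a, 'k::field) mpoly ring" where
  "poly_ring X =
    \<lparr>carrier = {f. keys f \<subseteq> mons X}, mult = (*), one = 1, zero = 0, add = (+)\<rparr>"

definition homogeneous :: "nat \<Rightarrow> ('a, 'k::field) mpoly \<Rightarrow> bool" where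
  "homogeneous i f \<longleftrightarrow> (\<forall>m\<in>keys f. mon_deg m = i)"


section \<open>Borel ideals\<close>

text \<open>The ring \<open>R = K[x\<^sub>1,\<dots>,x\<^sub>n]\<close> is \<open>poly_ring {1..n}\<close>.\<close>

definition monomial_ideal :: "nat \<Rightarrow> (nat, 'k::field) mpoly set \<Rightarrow> bool" where
  "monomial_ideal n I \<longleftrightarrow> (\<exists>B \<subseteq> mons {1..n}. I = Idl\<^bsub>poly_ring {1..n}\<^esub> (mon ` B))"

definition borel_ideal :: "nat \<Rightarrow> (nat, 'k::field) mpoly set \<Rightarrow> bool" where
  "borel_ideal n I \<longleftrightarrow> monomial_ideal n I \<and>
    (\<forall>f \<in> mons {1..n}. \<forall>i\<in>{1..n}. \<forall>j\<in>{1..n}.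
       i < j \<longrightarrow> mon (f + Poly_Mapping.single j 1) \<in> I \<longrightarrow> mon (f + Poly_Mapping.single i 1) \<in> I)"

definition Borel :: "nat \<Rightarrow> nat monom set \<Rightarrow> (nat, 'k::field) mpoly set" where
  "Borel n B = \<Inter>{J. borel_ideal n J \<and> mon ` B \<subseteq> J}"

definition borel_generators :: "nat \<Rightarrow> (nat, 'k::field) mpoly set \<Rightarrow> nat monom set \<Rightarrow> bool" where
  "borel_generators n I B \<longleftrightarrow>
    B \<subseteq> mons {1..n} \<and> Borel n B = I \<and> (\<forall>B'. B' \<subset> B \<longrightarrow> (Borel n B' :: (nat, 'k) mpoly set) \<noteq> I)"

definition two_borel ::
  "nat \<Rightarrow> nat \<Rightarrow> nat monom \<Rightarrow> nat monom \<Rightarrow> (nat, 'k::field) mpoly set \<Rightarrow> bool" where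
  "two_borel n d M N I \<longleftrightarrow>
    M \<noteq> N \<and> mon_deg M = d \<and> mon_deg N = d \<and> borel_generators n I {M, N}"

definition lex_earlier :: "nat monom \<Rightarrow> nat monom \<Rightarrow> bool" where
  "lex_earlier u v \<longleftrightarrow> (\<exists>i. lookup v i < lookup u i \<and> (\<forall>j<i. lookup u j = lookup v j))"

definition gens :: "('a, 'k::field) mpoly set \<Rightarrow> 'a monom set" where
  "gens I = {m. mon m \<in> I \<and> (\<forall>u. mon u \<in> I \<longrightarrow> mon_dvd u m \<longrightarrow> u = m)}"


section \<open>Toric ideals\<close>

text \<open>
  The variable \<open>Y\<^sub>w\<close> is indexed by the exponent vector \<open>w\<close> itself, so \<open>S\<^sub>I\<close> is a polynomial
  ring over index type \<open>nat monom\<close>.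
\<close>

definition toric_poly_ring :: "(nat, 'k::field) mpoly set \<Rightarrow> (nat monom, 'k) mpoly ring" where
  "toric_poly_ring I = poly_ring (gens I)"

definition toric_map :: "(nat monom, 'k::field) mpoly \<Rightarrow> (nat, 'k) mpoly" where
  "toric_map f =
    (\<Sum>m\<in>keys f. Poly_Mapping.single 0 (lookup f m) * (\<Prod>w\<in>keys m. mon w ^ lookup m w))"

definition toric_ideal ::
  "nat \<Rightarrow> (nat, 'k::field) mpoly set \<Rightarrow> (nat monom, 'k) mpoly set" where
  "toric_ideal n I = a_kernel (toric_poly_ring I) (poly_ring {1..n}) toric_map"

definition toric_ring ::
  "nat \<Rightarrow> (nat, 'k::field) mpoly set \<Rightarrow> (nat monom, 'k) mpoly set ring" where
  "toric_ring n I = toric_poly_ring I Quot toric_ideal n I"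

definition toric_grading ::
  "nat \<Rightarrow> (nat, 'k::field) mpoly set \<Rightarrow> nat \<Rightarrow> (nat monom, 'k) mpoly set set" where
  "toric_grading n I i =
    (\<lambda>f. toric_ideal n I +>\<^bsub>toric_poly_ring I\<^esub> f) `
      {f \<in> carrier (toric_poly_ring I). homogeneous i f}"


section \<open>Groebner bases and the fiber sink order\<close>

text \<open>
  Monomial orders are given by their strict relation: \<open>gt Z Z'\<close> means that \<open>Z\<close> is larger.
  The leading monomial is only meaningful for nonzero polynomials.
\<close>

definition lead_mon :: "('a monom \<Rightarrow> 'a monom \<Rightarrow> bool) \<Rightarrow> ('a, 'k::field) mpoly \<Rightarrow> 'a monom" where
  "lead_mon gt f = (THE m. m \<in> keys f \<and> (\<forall>m'\<in>keys f. m' \<noteq> m \<longrightarrow> gt m m'))"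

definition groebner_basis ::
  "('a, 'k::field) mpoly ring \<Rightarrow> ('a monom \<Rightarrow> 'a monom \<Rightarrow> bool) \<Rightarrow>
    ('a, 'k) mpoly set \<Rightarrow> ('a, 'k) mpoly set \<Rightarrow> bool" where
  "groebner_basis S gt J G \<longleftrightarrow>
    finite G \<and> G \<subseteq> J - {0} \<and>
    Idl\<^bsub>S\<^esub> ((\<lambda>f. mon (lead_mon gt f)) ` G) = Idl\<^bsub>S\<^esub> ((\<lambda>f. mon (lead_mon gt f)) ` (J - {0}))"

text \<open>Here \<open>before v w\<close> means that the variable \<open>v\<close> precedes the variable \<open>w\<close>.\<close>

definition grevlex ::
  "'a set \<Rightarrow> ('a \<Rightarrow> 'a \<Rightarrow> bool) \<Rightarrow> 'a monom \<Rightarrow> 'a monom \<Rightarrow> bool" where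
  "grevlex X before Z Z' \<longleftrightarrow>
    mon_deg Z > mon_deg Z' \<or>
    (mon_deg Z = mon_deg Z' \<and>
     (\<exists>w\<in>X. lookup Z w < lookup Z' w \<and> (\<forall>v\<in>X. before w v \<longrightarrow> lookup Z v = lookup Z' v)))"

definition fiber_sink_before ::
  "nat \<Rightarrow> nat monom \<Rightarrow> (nat, 'k::field) mpoly set \<Rightarrow> nat monom \<Rightarrow> nat monom \<Rightarrow> bool" where
  "fiber_sink_before n M I v w \<longleftrightarrow>
    (let GM = gens (Borel n {M} :: (nat, 'k) mpoly set); GN = gens I - GM
     in (v \<in> GN \<and> w \<in> GN \<and> lex_earlier w v) \<or>
        (v \<in> GN \<and> w \<in> GM) \<or>
        (v \<in> GM \<and> w \<in> GM \<and> lex_earlier v w))"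

definition fiber_sink_order ::
  "nat \<Rightarrow> nat monom \<Rightarrow> (nat, 'k::field) mpoly set \<Rightarrow>
    nat monom monom \<Rightarrow> nat monom monom \<Rightarrow> bool" where
  "fiber_sink_order n M I = grevlex (gens I) (fiber_sink_before n M I)"


section \<open>Koszul algebras\<close>

locale standard_graded_algebra = cring A for A (structure) +
  fixes gr :: "nat \<Rightarrow> 'a set"
  assumes gr_subgroup: "additive_subgroup (gr i) A"
    and gr_mult: "a \<in> gr i \<Longrightarrow> b \<in> gr j \<Longrightarrow> a \<otimes> b \<in> gr (i + j)"
    and gr_direct_sum: "a \<in> carrier A \<Longrightarrow>
      \<exists>!c. (\<forall>i. c i \<in> gr i) \<and> finite {i. c i \<noteq> \<zero>} \<and> a = (\<Oplus>i\<in>{i. c i \<noteq> \<zero>}. c i)"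
    and gr_0_field: "subfield (gr 0) A"
    and gr_1_finite: "finite_dimension (gr 0) (gr 1)"
    and gr_1_generates: "generate_ring A (gr 0 \<union> gr 1) = carrier A"

definition irrelevant_ideal :: "('a, 'b) ring_scheme \<Rightarrow> (nat \<Rightarrow> 'a set) \<Rightarrow> 'a set" where
  "irrelevant_ideal A gr = Idl\<^bsub>A\<^esub> (\<Union>i\<in>{1..}. gr i)"

definition quotient_module :: "('a, 'b) ring_scheme \<Rightarrow> 'a set \<Rightarrow> ('a, 'a set) module" where
  "quotient_module A J =
    \<lparr>carrier = carrier (A Quot J), mult = mult (A Quot J), one = one (A Quot J),
     zero = zero (A Quot J), add = add (A Quot J),
     smult = (\<lambda>a X. (J +>\<^bsub>A\<^esub> a) \<otimes>\<^bsub>A Quot J\<^esub> X)\<rparr>"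

definition free_module :: "('a, 'b) ring_scheme \<Rightarrow> nat \<Rightarrow> (nat \<Rightarrow> 'a) set" where
  "free_module A b = ({..<b} \<rightarrow>\<^sub>E carrier A)"

definition zero_vec :: "('a, 'b) ring_scheme \<Rightarrow> nat \<Rightarrow> nat \<Rightarrow> 'a" where
  "zero_vec A b = (\<lambda>p\<in>{..<b}. \<zero>\<^bsub>A\<^esub>)"

text \<open>The map from \<open>A\<^sup>c\<close> to \<open>A\<^sup>r\<close> given by the matrix \<open>D\<close> with \<open>r\<close> rows and \<open>c\<close> columns.\<close>

definition mat_map ::
  "('a, 'b) ring_scheme \<Rightarrow> nat \<Rightarrow> nat \<Rightarrow> (nat \<Rightarrow> nat \<Rightarrow> 'a) \<Rightarrow> (nat \<Rightarrow> 'a) \<Rightarrow> nat \<Rightarrow> 'a" where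
  "mat_map A r c D v = (\<lambda>p\<in>{..<r}. \<Oplus>\<^bsub>A\<^esub>q\<in>{..<c}. D p q \<otimes>\<^bsub>A\<^esub> v q)"

text \<open>The map from \<open>A\<^sup>c\<close> to the module \<open>M\<close> sending the \<open>q\<close>-th basis element to \<open>e q\<close>.\<close>

definition aug_map ::
  "('a, 'm) module \<Rightarrow> nat \<Rightarrow> (nat \<Rightarrow> 'm) \<Rightarrow> (nat \<Rightarrow> 'a) \<Rightarrow> 'm" where
  "aug_map M c e v = (\<Oplus>\<^bsub>M\<^esub>q\<in>{..<c}. v q \<odot>\<^bsub>M\<^esub> e q)"

text \<open>
  A graded free resolution
  \<open>\<cdots> \<rightarrow> F\<^sub>2 \<rightarrow> F\<^sub>1 \<rightarrow> F\<^sub>0 \<rightarrow> M \<rightarrow> 0\<close> of the graded \<open>A\<close>-module \<open>M\<close> (with graded pieces \<open>grM\<close>).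
  Here \<open>F\<^sub>i\<close> is free of rank \<open>b i\<close>, its \<open>p\<close>-th basis element has degree \<open>s i p\<close>, and the map
  from \<open>F\<^bsub>i+1\<^esub>\<close> to \<open>F\<^sub>i\<close> has matrix \<open>D i\<close>. The first two conditions say that all maps
  preserve degrees.
\<close>

definition graded_free_resolution ::
  "('a, 'b) ring_scheme \<Rightarrow> (nat \<Rightarrow> 'a set) \<Rightarrow> ('a, 'm) module \<Rightarrow> (nat \<Rightarrow> 'm set) \<Rightarrow>
    (nat \<Rightarrow> nat) \<Rightarrow> (nat \<Rightarrow> nat \<Rightarrow> nat) \<Rightarrow> (nat \<Rightarrow> nat \<Rightarrow> nat \<Rightarrow> 'a) \<Rightarrow> (nat \<Rightarrow> 'm) \<Rightarrow> bool" where
  "graded_free_resolution A gr M grM b s D e \<longleftrightarrow>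
    (\<forall>q<b 0. e q \<in> grM (s 0 q)) \<and>
    (\<forall>i. \<forall>p<b i. \<forall>q<b (Suc i).
       D i p q \<in> (if s i p \<le> s (Suc i) q then gr (s (Suc i) q - s i p) else {\<zero>\<^bsub>A\<^esub>})) \<and>
    aug_map M (b 0) e ` free_module A (b 0) = carrier M \<and>
    {v \<in> free_module A (b 0). aug_map M (b 0) e v = \<zero>\<^bsub>M\<^esub>} =
      mat_map A (b 0) (b 1) (D 0) ` free_module A (b 1) \<and>
    (\<forall>i. {v \<in> free_module A (b (Suc i)). mat_map A (b i) (b (Suc i)) (D i) v = zero_vec A (b i)} =
      mat_map A (b (Suc i)) (b (Suc (Suc i))) (D (Suc i)) ` free_module A (b (Suc (Suc i))))"

text \<open>
  The residue field is the module \<open>A/A\<^sub>+\<close> with the induced grading; linearity of the resolution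
  means that all basis elements of \<open>F\<^sub>i\<close> have degree \<open>i\<close>.
\<close>

definition koszul :: "('a, 'b) ring_scheme \<Rightarrow> (nat \<Rightarrow> 'a set) \<Rightarrow> bool" where
  "koszul A gr \<longleftrightarrow>
    standard_graded_algebra A gr \<and>
    (let J = irrelevant_ideal A gr in
     \<exists>b s D e.
       graded_free_resolution A gr
         (quotient_module A J) (\<lambda>i. (\<lambda>a. J +>\<^bsub>A\<^esub> a) ` gr i) b s D e \<and>
       (\<forall>i. \<forall>p<b i. s i p = i))"

end

theory Submission
  imports Defs "HOL-Library.Infinite_Set"
begin

text \<open>
  The principal Borel ideal of \<open>L\<close> consists, in the degree of \<open>L\<close>, of the monomials whose prefix sums
  of exponents dominate those of \<open>L\<close>. If a pair \<open>a, b\<close> of generators is minimal in its fibre, \<open>a\<close> being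
  the lex-later one (or the one in \<open>G\<^sub>M\<close>), then \<open>a\<close> has the same prefix sum as \<open>M\<close> (or \<open>N\<close>) just before
  each variable of \<open>b\<close>; otherwise exchanging two variables gives a smaller pair. Consequently the
  lex-latest factor of a product all of whose pairs are minimal has the pointwise smallest prefix
  sums among the divisors in the respective principal Borel ideal, so it is determined by the product.
  Hence a product is minimal in its fibre as soon as all of its pairs are, which is a quadratic
  Groebner basis.

  For Koszulness, a resolution of the residue field is built in the manner of Schreyer: the leading
  terms of each syzygy module are the terms \<open>(p, h)\<close> for which the standard monomial of \<open>h\<close> involves
  a letter from a set \<open>C p\<close>, and because standardness is a condition on pairs this shape is inherited
  by the next syzygy module. All minimal leading terms are letters, so the resolution is linear.
\<close>

section \<open>Monomials and polynomials\<close>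

text \<open>Schreyer's argument wants a term order compatible with products, and the semigroup
  algebra has none: \<open>nf (h + k)\<close> may have smaller rank than \<open>nf h + nf k\<close>,
  so a product can lose its leading term. Because standardness is tested on pairs, the terms that
  spoil multiplication by a generator with leading letter \<open>e\<close> are detected by single
  letters: those nonstandard with \<open>e\<close>, and those listed before \<open>e\<close>, which
  would reach a leading term already accounted for. Together they are the letter set of the new
  basis vector.

  In the fiber sink order an exchange yields a smaller pair because one new generator comes after
  both old ones. If a factor lies in \<open>GM\<close>, this is the replacement of the lex-latest
  such factor; otherwise it is the replacement of the lex-earlier factor, which may even move into
  \<open>GM\<close>, the last block. Prefix sums of lex-latest factors of two factorizations are
  compared within one block, so the product has to determine whether a factor in \<open>GM\<close>
  occurs at all; this is settled by counting prefix sums at a single index, not by an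
  exchange.\<close>

lemma keys_add_monom: "keys (u + v :: 'a monom) = keys u \<union> keys v"
  by (auto simp: in_keys_iff lookup_add)

lemma mons_add_iff: "u + v \<in> mons X \<longleftrightarrow> u \<in> mons X \<and> v \<in> mons X"
  by (auto simp: mons_def keys_add_monom)

lemma zero_in_mons [simp]: "0 \<in> mons X"
  by (simp add: mons_def)

lemma single_in_mons [simp]: "Poly_Mapping.single x (Suc 0) \<in> mons X \<longleftrightarrow> x \<in> X"
  by (simp add: mons_def)

lemma mon_deg_superset: "finite A \<Longrightarrow> keys u \<subseteq> A \<Longrightarrow> mon_deg u = (\<Sum>x\<in>A. lookup u x)"
  unfolding mon_deg_def by (rule sum.mono_neutral_left) (auto simp: in_keys_iff)

lemma mon_deg_add: "mon_deg (u + v) = mon_deg u + mon_deg v"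
proof -
  have "mon_deg (u + v) = (\<Sum>x\<in>keys u \<union> keys v. lookup (u + v) x)"
    by (rule mon_deg_superset) (auto simp: keys_add_monom)
  then show ?thesis
    by (simp add: lookup_add sum.distrib mon_deg_superset[of "keys u \<union> keys v"])
qed

lemma mon_deg_single [simp]: "mon_deg (Poly_Mapping.single x c) = c"
  by (cases "c = 0") (simp_all add: mon_deg_def)

lemma mon_deg_zero [simp]: "mon_deg 0 = 0"
  by (simp add: mon_deg_def)

lemma mon_deg_0_iff [simp]: "mon_deg u = 0 \<longleftrightarrow> u = 0"
  by (auto simp: mon_deg_def in_keys_iff intro!: poly_mapping_eqI)

lemma monom_split:
  assumes "x \<in> keys (u :: 'a monom)"
  obtains v where "u = v + Poly_Mapping.single x (Suc 0)"
proof
  show "u = (u - Poly_Mapping.single x (Suc 0)) + Poly_Mapping.single x (Suc 0)"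
    using assms by (intro poly_mapping_eqI)
      (auto simp: lookup_add lookup_minus in_keys_iff lookup_single when_def)
qed

lemma monom_nonzero_split:
  assumes "(u :: 'a monom) \<noteq> 0"
  obtains x v where "x \<in> keys u" "u = v + Poly_Mapping.single x (Suc 0)"
proof -
  from assms obtain x where x: "x \<in> keys u"
    by (metis all_not_in_conv keys_eq_empty)
  with that show thesis by (meson monom_split)
qed

lemma mon_deg_1E:
  assumes "mon_deg u = 1" obtains x where "u = Poly_Mapping.single x (Suc 0)"
proof -
  from assms have "u \<noteq> 0" by auto
  then obtain x v where "x \<in> keys u" and v: "u = v + Poly_Mapping.single x (Suc 0)"
    by (rule monom_nonzero_split)
  with assms have "v = 0" by (simp add: mon_deg_add)
  with v that show thesis by simp
qed

lemma finite_mons_deg: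
  assumes "finite X"
  shows "finite {u \<in> mons X. mon_deg u = d}"
proof (induction d)
  case 0
  have "{u \<in> mons X. mon_deg u = 0} = {0}" by auto
  then show ?case by simp
next
  case (Suc d)
  have "{u \<in> mons X. mon_deg u = Suc d} \<subseteq>
      (\<lambda>(u, x). u + Poly_Mapping.single x (Suc 0)) ` ({u \<in> mons X. mon_deg u = d} \<times> X)"
  proof
    fix u assume u: "u \<in> {u \<in> mons X. mon_deg u = Suc d}"
    then have "u \<noteq> 0" by auto
    then obtain x v where x: "x \<in> keys u" and v: "u = v + Poly_Mapping.single x (Suc 0)"
      by (rule monom_nonzero_split)
    with u show "u \<in> (\<lambda>(u, x). u + Poly_Mapping.single x (Suc 0)) ` ({u \<in> mons X. mon_deg u = d} \<times> X)"
      by (intro image_eqI[of _ _ "(v, x)"]) (auto simp: mons_add_iff mon_deg_add mons_def keys_add_monom)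
  qed
  moreover have "finite ({u \<in> mons X. mon_deg u = d} \<times> X)"
    using Suc assms by simp
  ultimately show ?case by (rule finite_subset[OF _ finite_imageI])
qed

lemma poly_sum_singles: "(\<Sum>h\<in>keys f. Poly_Mapping.single h (lookup f h)) = f"
proof (rule poly_mapping_eqI)
  fix k show "lookup (\<Sum>h\<in>keys f. Poly_Mapping.single h (lookup f h)) k = lookup f k"
    by (auto simp: lookup_sum lookup_single when_def in_keys_iff)
qed

text \<open>Cancellation in the exponent monoid: only the term \<open>k\<close> of \<open>g\<close>
  can land on \<open>h + k\<close>.\<close>

lemma lookup_single_times:
  fixes h :: "'a :: cancel_comm_monoid_add" and g :: "'a \<Rightarrow>\<^sub>0 'k :: comm_ring_1"
  shows "lookup (Poly_Mapping.single h c * g) (h + k) = c * lookup g k"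
proof -
  have "Poly_Mapping.single h c * g =
      (\<Sum>l\<in>keys g. Poly_Mapping.single (h + l) (c * lookup g l))"
    by (subst (1) poly_sum_singles[of g, symmetric]) (simp add: sum_distrib_left mult_single)
  then show ?thesis
    by (auto simp: lookup_sum lookup_single when_def in_keys_iff)
qed

lemma keys_single_times:
  fixes h :: "'a :: cancel_comm_monoid_add" and g :: "'a \<Rightarrow>\<^sub>0 'k :: comm_ring_1"
  shows "keys (Poly_Mapping.single h c * g) \<subseteq> (+) h ` keys g"
  using keys_mult[of "Poly_Mapping.single h c" g] by (auto split: if_splits)

lemma lookup_times_sum:
  fixes f g :: "'a :: cancel_comm_monoid_add \<Rightarrow>\<^sub>0 'k :: comm_ring_1"
  shows "lookup (f * g) k = (\<Sum>h\<in>keys f. lookup (Poly_Mapping.single h (lookup f h) * g) k)"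
proof -
  have "f * g = (\<Sum>h\<in>keys f. Poly_Mapping.single h (lookup f h) * g)"
    by (subst (1) poly_sum_singles[of f, symmetric]) (simp add: sum_distrib_right)
  then show ?thesis by (simp add: lookup_sum)
qed

lemma keys_mult_E:
  assumes "k \<in> keys (f * g)" obtains u v where "k = u + v" "u \<in> keys f" "v \<in> keys g"
  using keys_mult[of f g] assms by blast

section \<open>Quadratic standard monomials\<close>

text \<open>In the application \<open>val\<close> multiplies generators out, so a fibre is the set
  of factorizations of one monomial, and its minimal element is the standard monomial modulo the
  toric ideal.\<close>

definition min_fiber :: "'b set \<Rightarrow> ('b monom \<Rightarrow> 'a) \<Rightarrow> ('b monom \<Rightarrow> nat) \<Rightarrow> 'b monom \<Rightarrow> bool" where
  "min_fiber G val rk Z \<longleftrightarrow> Z \<in> mons G \<and> (\<forall>Z'\<in>mons G. val Z' = val Z \<longrightarrow> rk Z \<le> rk Z')"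

abbreviation (input) Y :: "'b \<Rightarrow> 'b monom" where
  "Y e \<equiv> Poly_Mapping.single e (Suc 0)"

text \<open>\<open>val_deg\<close> makes every fibre homogeneous, so values inherit a degree. The
  order enters as a rank in \<open>nat\<close>, which provides minimal elements and numerical bounds
  for induction.\<close>

locale toric_order =
  fixes G :: "'b set" and val :: "'b monom \<Rightarrow> 'a :: cancel_comm_monoid_add"
    and rk :: "'b monom \<Rightarrow> nat"
  assumes finite_G: "finite G"
    and val_add: "val (Z + Z') = val Z + val Z'"
    and val_deg: "Z \<in> mons G \<Longrightarrow> Z' \<in> mons G \<Longrightarrow> val Z = val Z' \<Longrightarrow> mon_deg Z = mon_deg Z'"
    and rk_inj: "inj_on rk (mons G)"
    and rk_add: "Z \<in> mons G \<Longrightarrow> Z' \<in> mons G \<Longrightarrow> W \<in> mons G \<Longrightarrow> rk Z < rk Z' \<Longrightarrow> rk (Z + W) < rk (Z' + W)"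
begin

abbreviation "std \<equiv> min_fiber G val rk"

definition nf :: "'a \<Rightarrow> 'b monom" where
  "nf h = (THE Z. std Z \<and> val Z = h)"

definition H :: "'a set" where
  "H = val ` mons G"

definition dg :: "'a \<Rightarrow> nat" where
  "dg h = mon_deg (nf h)"

lemma val_0 [simp]: "val 0 = 0"
proof -
  have "val 0 + val 0 = val 0 + 0" using val_add[of 0 0] by simp
  then show ?thesis by (simp only: add_left_cancel)
qed

lemma std_mons: "std Z \<Longrightarrow> Z \<in> mons G"
  by (simp add: min_fiber_def)

lemma std_unique: "std Z \<Longrightarrow> std Z' \<Longrightarrow> val Z = val Z' \<Longrightarrow> Z = Z'"
  by (rule inj_onD[OF rk_inj]) (auto simp: min_fiber_def intro: antisym)

lemma std_exists:
  assumes "h \<in> H" obtains Z where "std Z" "val Z = h"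
proof -
  let ?P = "\<lambda>Z. Z \<in> mons G \<and> val Z = h"
  from assms obtain Z where "?P Z" by (auto simp: H_def)
  then have "?P (arg_min rk ?P)" by (rule arg_min_natI)
  moreover have "\<And>Z. ?P Z \<Longrightarrow> rk (arg_min rk ?P) \<le> rk Z" by (rule arg_min_nat_le)
  ultimately have "std (arg_min rk ?P)" "val (arg_min rk ?P) = h"
    by (auto simp: min_fiber_def)
  with that show thesis by blast
qed

lemma nf_std: "h \<in> H \<Longrightarrow> std (nf h)" and val_nf: "h \<in> H \<Longrightarrow> val (nf h) = h"
proof -
  assume "h \<in> H"
  then obtain Z where "std Z" "val Z = h" by (rule std_exists)
  then have "std (nf h) \<and> val (nf h) = h"
    unfolding nf_def by (intro theI[of "\<lambda>Z. std Z \<and> val Z = h" Z] conjI) (blast dest: std_unique)+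
  then show "std (nf h)" "val (nf h) = h" by auto
qed

lemma nf_mons: "h \<in> H \<Longrightarrow> nf h \<in> mons G"
  by (simp add: nf_std std_mons)

lemma val_H: "Z \<in> mons G \<Longrightarrow> val Z \<in> H"
  by (auto simp: H_def)

lemma nf_val: "std Z \<Longrightarrow> nf (val Z) = Z"
  by (meson nf_std std_mons std_unique val_H val_nf)

lemma H_0 [simp]: "0 \<in> H"
  by (metis val_0 val_H zero_in_mons)

lemma H_add: "h \<in> H \<Longrightarrow> h' \<in> H \<Longrightarrow> h + h' \<in> H"
  by (metis mons_add_iff nf_mons val_H val_add val_nf)

lemma rk_nf_le: "Z \<in> mons G \<Longrightarrow> rk (nf (val Z)) \<le> rk Z"
  by (metis min_fiber_def nf_std val_H val_nf)

lemma rk_eqD: "Z \<in> mons G \<Longrightarrow> Z' \<in> mons G \<Longrightarrow> rk Z = rk Z' \<Longrightarrow> Z = Z'"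
  using rk_inj by (auto simp: inj_on_def)

lemma rk_add_le:
  "Z \<in> mons G \<Longrightarrow> Z' \<in> mons G \<Longrightarrow> W \<in> mons G \<Longrightarrow> rk Z \<le> rk Z' \<Longrightarrow> rk (Z + W) \<le> rk (Z' + W)"
  by (metis le_less rk_add rk_eqD)

text \<open>A smaller representative of the factor, multiplied by the cofactor, would undercut the
  whole product.\<close>

lemma std_factor:
  assumes "std (Z + W)" shows "std Z"
  unfolding min_fiber_def
proof (intro conjI ballI impI)
  have m: "Z \<in> mons G" "W \<in> mons G" using std_mons[OF assms] by (auto simp: mons_add_iff)
  then show "Z \<in> mons G" by simp
  fix Z' assume Z': "Z' \<in> mons G" "val Z' = val Z"
  show "rk Z \<le> rk Z'"
  proof (rule ccontr)
    assume "\<not> rk Z \<le> rk Z'"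
    then have "rk (Z' + W) < rk (Z + W)" using rk_add Z' m by simp
    moreover have "rk (Z + W) \<le> rk (Z' + W)"
      using assms Z' m by (auto simp: min_fiber_def mons_add_iff val_add)
    ultimately show False by simp
  qed
qed

lemma dg_val: "Z \<in> mons G \<Longrightarrow> dg (val Z) = mon_deg Z"
  unfolding dg_def by (rule val_deg) (simp_all add: nf_mons val_nf val_H)

lemma dg_add: "h \<in> H \<Longrightarrow> h' \<in> H \<Longrightarrow> dg (h + h') = dg h + dg h'"
  using dg_val[of "nf h + nf h'"]
  by (simp add: val_add val_nf mons_add_iff nf_mons mon_deg_add) (simp add: dg_def)

lemma nf_add_rk_le: "h \<in> H \<Longrightarrow> h' \<in> H \<Longrightarrow> rk (nf (h + h')) \<le> rk (nf h + nf h')"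
  using rk_nf_le[of "nf h + nf h'"] by (simp add: val_add val_nf mons_add_iff nf_mons)

lemma nf_add: "h \<in> H \<Longrightarrow> h' \<in> H \<Longrightarrow> std (nf h + nf h') \<Longrightarrow> nf (h + h') = nf h + nf h'"
  using nf_val[of "nf h + nf h'"] by (simp add: val_add val_nf)

lemma nf_0_iff: "h \<in> H \<Longrightarrow> nf h = 0 \<longleftrightarrow> h = 0"
  using val_nf[of h] dg_val[of 0] by (auto simp: dg_def)

lemma dg_0_iff: "h \<in> H \<Longrightarrow> dg h = 0 \<longleftrightarrow> h = 0"
  by (simp add: dg_def nf_0_iff)

lemma dg_0 [simp]: "dg 0 = 0"
  by (simp add: dg_0_iff)

end

text \<open>\<open>quad\<close> says that the nonstandard monomials, which form the initial ideal of
  the toric ideal, are generated in degree two.\<close>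

locale toric_quadratic = toric_order G val rk
  for G :: "'b set" and val :: "'b monom \<Rightarrow> 'a :: cancel_comm_monoid_add" and rk +
  assumes quad: "Z \<in> mons G \<Longrightarrow> (\<And>a b W. Z = W + (Y a + Y b) \<Longrightarrow> std (Y a + Y b)) \<Longrightarrow> std Z"
begin

lemma std_letter: "e \<in> G \<Longrightarrow> std (Y e)"
proof (rule quad)
  fix a b W assume "Y e = W + (Y a + Y b)"
  then have "mon_deg (Y e) = mon_deg (W + (Y a + Y b))" by simp
  then show "std (Y a + Y b)" by (simp add: mon_deg_add)
qed simp

text \<open>A nonstandard pair that avoids the new letter \<open>e\<close> would already divide
  \<open>Z\<close>, against \<open>std_factor\<close>; so the pair consists of \<open>e\<close> and
  a letter of \<open>Z\<close>.\<close>

lemma nonstd_letter: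
  assumes "std Z" "e \<in> G" "\<not> std (Z + Y e)"
  obtains y where "y \<in> keys Z" "\<not> std (Y y + Y e)"
proof -
  from assms have "Z + Y e \<in> mons G" by (simp add: mons_add_iff std_mons)
  with assms(3) obtain a b W where eq: "Z + Y e = W + (Y a + Y b)" and ns: "\<not> std (Y a + Y b)"
    using quad by blast
  consider "a = e" | "b = e" | "a \<noteq> e" "b \<noteq> e" by blast
  then show thesis
  proof cases
    case 1
    with eq have "Z + Y e = (W + Y b) + Y e" by (simp add: ac_simps)
    then have "Z = W + Y b" by (simp only: add_right_cancel)
    with 1 ns that[of b] show thesis by (simp add: keys_add_monom add.commute)
  next
    case 2
    with eq have "Z + Y e = (W + Y a) + Y e" by (simp add: ac_simps)
    then have "Z = W + Y a" by (simp only: add_right_cancel)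
    with 2 ns that[of a] show thesis by (simp add: keys_add_monom)
  next
    case 3
    have "lookup (Z + Y e) e = lookup (W + (Y a + Y b)) e" using eq by simp
    with 3 have "e \<in> keys W" by (simp add: lookup_add lookup_single in_keys_iff)
    then obtain W' where "W = W' + Y e" by (rule monom_split)
    with eq have "Z + Y e = ((Y a + Y b) + W') + Y e" by (simp add: ac_simps)
    then have "Z = (Y a + Y b) + W'" by (simp only: add_right_cancel)
    with assms(1) ns std_factor show thesis by blast
  qed
qed

lemma nf_letter: "e \<in> G \<Longrightarrow> nf (val (Y e)) = Y e"
  by (simp add: nf_val std_letter)

end

section \<open>The linear resolution\<close>

text \<open>With \<open>p < b\<close>, the number \<open>r * b + p\<close> codes the pair
  \<open>(r, p)\<close> lexicographically; this is how a term order on a free module becomes a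
  single natural number.\<close>

lemma lex_less_iff:
  fixes r r' b p p' :: nat
  assumes "p < b" "p' < b"
  shows "r * b + p < r' * b + p' \<longleftrightarrow> r < r' \<or> r = r' \<and> p < p'"
proof -
  have "r * b + p < r' * b + p'" if "r < r'" "p < b" for r r' p p' :: nat
  proof -
    from that have "r * b + b \<le> r' * b" by (metis Suc_leI add.commute mult_Suc mult_le_mono1)
    with that show ?thesis by linarith
  qed
  from this[of r r' p p'] this[of r' r p' p] assms show ?thesis
    by (metis add_less_cancel_left linorder_neqE_nat less_asym)
qed

lemma lex_eq_iff:
  fixes r r' b p p' :: nat
  assumes "p < b" "p' < b"
  shows "r * b + p = r' * b + p' \<longleftrightarrow> r = r' \<and> p = p'"
  using lex_less_iff[OF assms, of r r'] lex_less_iff[OF assms(2,1), of r' r]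
  by (metis linorder_neqE_nat less_irrefl)

lemma lex_le_iff:
  fixes r r' b p p' :: nat
  assumes "p < b" "p' < b"
  shows "r * b + p \<le> r' * b + p' \<longleftrightarrow> r < r' \<or> r = r' \<and> p \<le> p'"
  using lex_less_iff[OF assms, of r r'] lex_eq_iff[OF assms, of r r'] by (auto simp: le_less)

context toric_quadratic
begin

section \<open>Free modules over the semigroup algebra and their term orders\<close>

abbreviation lt :: "'b \<Rightarrow> 'a" where "lt e \<equiv> val (Y e)"

text \<open>The semigroup algebra of \<open>H\<close>, a model of the toric ring: its basis consists
  of the values of monomials, not of the monomials in the letters.\<close>

definition A :: "('a \<Rightarrow>\<^sub>0 'k::field) set" where
  "A = {f. keys f \<subseteq> H}"

definition freemod :: "nat \<Rightarrow> (nat \<Rightarrow> 'a \<Rightarrow>\<^sub>0 'k::field) set" where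
  "freemod b = {f. (\<forall>p<b. f p \<in> A) \<and> (\<forall>p\<ge>b. f p = 0)}"

text \<open>A Schreyer order: the term \<open>h\<close> in position \<open>p\<close> is judged by
  its normal form multiplied by the weight \<open>W p\<close>, and ties are broken by the
  position.\<close>

definition key :: "nat \<Rightarrow> (nat \<Rightarrow> 'b monom) \<Rightarrow> nat \<Rightarrow> 'a \<Rightarrow> nat" where
  "key b W p h = rk (W p + nf h) * b + p"

definition dmap :: "nat \<Rightarrow> (nat \<Rightarrow> nat \<Rightarrow> 'a \<Rightarrow>\<^sub>0 'k::field) \<Rightarrow> (nat \<Rightarrow> 'a \<Rightarrow>\<^sub>0 'k) \<Rightarrow> nat \<Rightarrow> 'a \<Rightarrow>\<^sub>0 'k" where
  "dmap b n f = (\<lambda>p. \<Sum>q<b. f q * n q p)"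

text \<open>
  \<open>N\<close> is a submodule of the free module of rank \<open>b\<close>; \<open>W p\<close> is the weight of the \<open>p\<close>-th basis vector
  in the term order and \<open>C p\<close> the set of letters generating its leading terms.
\<close>

definition stage :: "nat \<Rightarrow> (nat \<Rightarrow> 'b monom) \<Rightarrow> (nat \<Rightarrow> 'b set) \<Rightarrow> (nat \<Rightarrow> 'a \<Rightarrow>\<^sub>0 'k::field) set \<Rightarrow> bool" where
  "stage b W C N \<longleftrightarrow>
    (\<forall>p<b. W p \<in> mons G \<and> C p \<subseteq> G) \<and>
    N \<subseteq> freemod b \<and> (\<lambda>_. 0) \<in> N \<and> (\<forall>x\<in>N. \<forall>y\<in>N. (\<lambda>p. x p - y p) \<in> N) \<and>
    (\<forall>a\<in>A. \<forall>x\<in>N. (\<lambda>p. a * x p) \<in> N) \<and>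
    (\<forall>x\<in>N. \<forall>p<b. \<forall>h. lookup (x p) h \<noteq> 0 \<longrightarrow>
      (\<forall>p' h'. lookup (x p') h' \<noteq> 0 \<longrightarrow> key b W p' h' \<le> key b W p h) \<longrightarrow> keys (nf h) \<inter> C p \<noteq> {}) \<and>
    (\<forall>p<b. \<forall>e\<in>C p. \<exists>x\<in>N. lookup (x p) (lt e) = 1 \<and>
      (\<forall>p' h'. lookup (x p') h' \<noteq> 0 \<longrightarrow> key b W p' h' \<le> key b W p (lt e) \<and> dg h' = 1))"

lemma A_0 [simp]: "0 \<in> A" and A_1 [simp]: "1 \<in> A"
  by (auto simp: A_def)

lemma A_single [simp]: "h \<in> H \<Longrightarrow> Poly_Mapping.single h c \<in> A"
  by (auto simp: A_def)

lemma A_add: "f \<in> A \<Longrightarrow> g \<in> A \<Longrightarrow> f + g \<in> A"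
  unfolding A_def using Poly_Mapping.keys_add[of f g] by blast

lemma A_uminus: "f \<in> A \<Longrightarrow> - f \<in> A"
  by (auto simp: A_def in_keys_iff subset_iff)

lemma A_diff: "f \<in> A \<Longrightarrow> g \<in> A \<Longrightarrow> f - g \<in> A"
  using A_add[OF _ A_uminus, of f g] by simp

lemma A_mult: "f \<in> A \<Longrightarrow> g \<in> A \<Longrightarrow> f * g \<in> A"
  unfolding A_def using keys_mult[of f g] H_add by fastforce

lemma A_sum: "(\<And>i. i \<in> I \<Longrightarrow> f i \<in> A) \<Longrightarrow> (\<Sum>i\<in>I. f i) \<in> A"
  by (induction I rule: infinite_finite_induct) (auto intro: A_add)

lemma freemodD: "f \<in> freemod b \<Longrightarrow> lookup (f p) h \<noteq> 0 \<Longrightarrow> p < b \<and> h \<in> H"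
  unfolding freemod_def A_def by (cases "p < b") (auto simp: in_keys_iff subset_iff)

lemma freemod_A: "f \<in> freemod b \<Longrightarrow> f p \<in> A"
  by (cases "p < b") (auto simp: freemod_def)

lemma key_inj:
  assumes "p < b" "p' < b" "W p \<in> mons G" "W p' \<in> mons G" "h \<in> H" "h' \<in> H"
    "key b W p h = key b W p' h'"
  shows "p = p' \<and> h = h'"
proof -
  have "rk (W p + nf h) = rk (W p' + nf h')" and [simp]: "p = p'"
    using assms by (auto simp: key_def lex_eq_iff)
  then have "W p + nf h = W p' + nf h'"
    using assms by (intro rk_eqD) (auto simp: mons_add_iff nf_mons)
  then have "nf h = nf h'" by simp
  then have "h = h'" using assms val_nf by metis
  then show ?thesis by simp
qed

end

text \<open>\<open>n q\<close> is the chosen element of \<open>N\<close> whose leading term is the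
  letter \<open>E q\<close> in position \<open>P q\<close>. By \<open>mono\<close> the generators
  are listed position by position, and within a position by \<open>ix\<close>, so that an earlier
  letter means a smaller index.\<close>

locale syzygy_step = toric_quadratic G val rk
  for G :: "'b set" and val :: "'b monom \<Rightarrow> 'a :: cancel_comm_monoid_add" and rk +
  fixes b :: nat and W :: "nat \<Rightarrow> 'b monom" and C :: "nat \<Rightarrow> 'b set"
    and N :: "(nat \<Rightarrow> 'a \<Rightarrow>\<^sub>0 'k::field) set"
    and ix :: "'b \<Rightarrow> nat" and b' :: nat and P :: "nat \<Rightarrow> nat" and E :: "nat \<Rightarrow> 'b"
    and n :: "nat \<Rightarrow> nat \<Rightarrow> 'a \<Rightarrow>\<^sub>0 'k"
  assumes stage: "stage b W C N"
    and bij: "bij_betw (\<lambda>q. (P q, E q)) {..<b'} (SIGMA p:{..<b}. C p)"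
    and mono: "q < q' \<Longrightarrow> q' < b' \<Longrightarrow> P q < P q' \<or> P q = P q' \<and> ix (E q) < ix (E q')"
    and n_N: "q < b' \<Longrightarrow> n q \<in> N"
    and n_lead: "q < b' \<Longrightarrow> lookup (n q (P q)) (lt (E q)) = 1"
    and n_key: "q < b' \<Longrightarrow> lookup (n q p) h \<noteq> 0 \<Longrightarrow> key b W p h \<le> key b W (P q) (lt (E q))"
    and n_dg: "q < b' \<Longrightarrow> lookup (n q p) h \<noteq> 0 \<Longrightarrow> dg h = 1"
begin

text \<open>The weighted leading monomial of \<open>n q\<close>, as in Schreyer's induced order on
  syzygies.\<close>

definition "W' q = W (P q) + Y (E q)"
text \<open>In the monomial algebra where nonstandard products are zero, these letters generate the
  colon ideal of the earlier letters of \<open>C (P q)\<close> by \<open>E q\<close>. That it is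
  again generated by letters keeps the resolution linear.\<close>

definition "C' q = {y \<in> G. \<not> std (Y y + Y (E q))} \<union> {y \<in> C (P q). ix y < ix (E q)}"
definition "N' = {f \<in> freemod b'. dmap b' n f = (\<lambda>_. 0)}"

lemma W_mons: "p < b \<Longrightarrow> W p \<in> mons G" and C_G: "p < b \<Longrightarrow> C p \<subseteq> G"
  and N_freemod: "x \<in> N \<Longrightarrow> x \<in> freemod b" and N_0: "(\<lambda>_. 0) \<in> N"
  and N_diff: "x \<in> N \<Longrightarrow> y \<in> N \<Longrightarrow> (\<lambda>p. x p - y p) \<in> N"
  and N_mult: "a \<in> A \<Longrightarrow> x \<in> N \<Longrightarrow> (\<lambda>p. a * x p) \<in> N"
  and N_lead: "x \<in> N \<Longrightarrow> p < b \<Longrightarrow> lookup (x p) h \<noteq> 0 \<Longrightarrow>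
    (\<And>p' h'. lookup (x p') h' \<noteq> 0 \<Longrightarrow> key b W p' h' \<le> key b W p h) \<Longrightarrow> keys (nf h) \<inter> C p \<noteq> {}"
  using stage unfolding stage_def by blast+

lemma PE: "q < b' \<Longrightarrow> P q < b" "q < b' \<Longrightarrow> E q \<in> C (P q)" "q < b' \<Longrightarrow> E q \<in> G"
  using bij_betw_apply[OF bij, of q] C_G by auto

lemma W'_mons: "q < b' \<Longrightarrow> W' q \<in> mons G"
  by (simp add: W'_def mons_add_iff W_mons PE)

lemma C'_G: "q < b' \<Longrightarrow> C' q \<subseteq> G"
  using C_G[of "P q"] PE by (auto simp: C'_def)

lemma n_H: "q < b' \<Longrightarrow> lookup (n q p) h \<noteq> 0 \<Longrightarrow> p < b \<and> h \<in> H"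
  using freemodD[OF N_freemod[OF n_N]] .

lemma good_std:
  assumes "q < b'" "h \<in> H" "keys (nf h) \<inter> C' q = {}"
  shows "std (nf h + Y (E q))"
proof (rule ccontr)
  assume "\<not> std (nf h + Y (E q))"
  then obtain y where y: "y \<in> keys (nf h)" "\<not> std (Y y + Y (E q))"
    using nonstd_letter nf_std PE assms by metis
  then have "y \<in> G" using nf_mons[OF assms(2)] by (auto simp: mons_def)
  with y assms show False by (auto simp: C'_def)
qed

text \<open>Passing from \<open>nf h + nf k\<close> to \<open>nf (h + k)\<close> can only lower the
  rank. Hence the bound given by \<open>W' q + nf h\<close> is attained only by the leading term of
  \<open>n q\<close>, and only if its product with \<open>h\<close> stays standard.\<close>

lemma times_n_key:
  assumes q: "q < b'" and h: "h \<in> H" and k: "lookup (n q p) k \<noteq> 0"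
  shows "key b W p (h + k) < rk (W' q + nf h) * b + P q \<or>
    p = P q \<and> k = lt (E q) \<and> std (nf h + Y (E q)) \<and> key b W p (h + k) = rk (W' q + nf h) * b + P q"
proof -
  have pb: "p < b" and kH: "k \<in> H" using n_H[OF q k] by auto
  have Pb: "P q < b" and nfE: "nf (lt (E q)) = Y (E q)" using q PE nf_letter by auto
  have m: "W p \<in> mons G" "W (P q) \<in> mons G" "nf h \<in> mons G" "nf k \<in> mons G" "nf (h + k) \<in> mons G"
    "Y (E q) \<in> mons G"
    using pb Pb kH h q by (auto simp: W_mons nf_mons H_add PE)
  have le: "rk (W p + nf (h + k)) \<le> rk (W p + nf k + nf h)"
    using rk_add_le[OF m(5) _ m(1), of "nf h + nf k"] nf_add_rk_le[OF h kH] m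
    by (simp add: mons_add_iff ac_simps)
  have "rk (W p + nf k) < rk (W (P q) + Y (E q)) \<or> rk (W p + nf k) = rk (W (P q) + Y (E q)) \<and> p \<le> P q"
    using n_key[OF q k] by (simp add: key_def nfE lex_le_iff pb Pb)
  then consider "rk (W p + nf k) < rk (W (P q) + Y (E q))"
    | "W p + nf k = W (P q) + Y (E q)" "p < P q" | "W p + nf k = W (P q) + Y (E q)" "p = P q"
    using rk_eqD[of "W p + nf k" "W (P q) + Y (E q)"] m by (fastforce simp: mons_add_iff)
  then show ?thesis
  proof cases
    case 1
    then have "rk (W p + nf k + nf h) < rk (W' q + nf h)"
      unfolding W'_def using m by (intro rk_add) (auto simp: mons_add_iff)
    with le show ?thesis by (simp add: key_def lex_less_iff pb Pb)
  next
    case 2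
    with le show ?thesis by (auto simp add: key_def W'_def lex_less_iff pb Pb)
  next
    case 3
    then have "nf k = Y (E q)" by simp
    then have k_eq: "k = lt (E q)" using kH val_nf by force
    have "W' q + nf h = W p + nf k + nf h" using 3 by (simp add: W'_def)
    show ?thesis
    proof (cases "rk (W p + nf (h + k)) = rk (W p + nf k + nf h)")
      case True
      then have "W p + nf (h + k) = W p + nf k + nf h"
        by (rule rk_eqD[rotated 2]) (simp_all add: mons_add_iff m)
      then have "nf (h + k) = nf h + Y (E q)" by (simp add: ac_simps \<open>nf k = _\<close>)
      moreover have "std (nf (h + k))" using h kH by (simp add: nf_std H_add)
      ultimately show ?thesis using 3 k_eq by (simp add: key_def W'_def ac_simps)
    next
      case False
      with le \<open>W' q + nf h = _\<close> have "rk (W p + nf (h + k)) < rk (W' q + nf h)" by simp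
      then show ?thesis unfolding key_def lex_less_iff[OF pb Pb] by simp
    qed
  qed
qed

text \<open>Reduction by the \<open>n q\<close>, by induction on a strict bound
  \<open>\<kappa>\<close> for the occurring keys. Quotient terms are kept free of
  \<open>C' q\<close>, so their products with \<open>n q\<close> have distinct leading terms. The
  degree clause is what later makes the syzygies linear.\<close>

lemma division:
  assumes "x \<in> N" "\<And>p h. lookup (x p) h \<noteq> 0 \<Longrightarrow> key b W p h < \<kappa>"
  shows "\<exists>f\<in>freemod b'. dmap b' n f = x \<and>
    (\<forall>q h. lookup (f q) h \<noteq> 0 \<longrightarrow> keys (nf h) \<inter> C' q = {} \<and> rk (W' q + nf h) * b + P q < \<kappa>) \<and>
    (\<forall>j. (\<forall>p h. lookup (x p) h \<noteq> 0 \<longrightarrow> dg h = Suc j) \<longrightarrow> (\<forall>q h. lookup (f q) h \<noteq> 0 \<longrightarrow> dg h = j))"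
  using assms
proof (induction \<kappa> arbitrary: x)
  case 0
  then have "x = (\<lambda>_. 0)" by (intro ext poly_mapping_eqI) auto
  then show ?case by (intro bexI[of _ "\<lambda>_. 0"]) (auto simp: dmap_def freemod_def)
next
  case (Suc \<kappa>)
  show ?case
  proof (cases "\<exists>p h. lookup (x p) h \<noteq> 0 \<and> key b W p h = \<kappa>")
    case False
    then have "key b W p h < \<kappa>" if "lookup (x p) h \<noteq> 0" for p h
      using Suc.prems(2)[OF that] that by (auto simp: less_Suc_eq)
    from Suc.IH[OF Suc.prems(1) this] show ?thesis using less_SucI by meson
  next
    case True
    then obtain p h where ph: "lookup (x p) h \<noteq> 0" "key b W p h = \<kappa>" by blast
    then have pb: "p < b" and hH: "h \<in> H" using freemodD N_freemod Suc.prems by blast+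
    have "keys (nf h) \<inter> C p \<noteq> {}"
      using Suc.prems pb ph by (intro N_lead[of x]) (auto simp: less_Suc_eq_le)
    \<comment> \<open>Dividing out the letter of least \<open>ix\<close> leaves a cofactor without
      earlier letters of \<open>C p\<close>; standardness of \<open>nf h\<close> excludes the other
      letters of \<open>C' q\<close>.\<close>
    then obtain e where e: "e \<in> keys (nf h)" "e \<in> C p"
      and e_min: "\<And>y. y \<in> keys (nf h) \<Longrightarrow> y \<in> C p \<Longrightarrow> ix e \<le> ix y"
      using ex_has_least_nat[of "\<lambda>y. y \<in> keys (nf h) \<inter> C p" _ ix] by blast
    from e(1) obtain Z where Z: "nf h = Z + Y e" by (rule monom_split)
    have stdZe: "std (Z + Y e)" using nf_std[OF hH] by (simp add: Z)
    then have stdZ: "std Z" by (rule std_factor)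
    define h' where "h' = val Z"
    have nfh': "nf h' = Z" and h'H: "h' \<in> H"
      using stdZ by (auto simp: h'_def nf_val val_H std_mons)
    have h_eq: "h = h' + lt e" using val_nf[OF hH] by (simp add: Z h'_def val_add)
    have "(p, e) \<in> (\<lambda>q. (P q, E q)) ` {..<b'}"
      using pb e by (simp add: bij_betw_imp_surj_on[OF bij])
    then obtain q where q: "q < b'" "P q = p" "E q = e" by auto
    have good: "keys (nf h') \<inter> C' q = {}"
    proof -
      have "y \<notin> C' q" if y: "y \<in> keys Z" for y
      proof -
        from y obtain Z' where "Z = Z' + Y y" by (rule monom_split)
        then have "Z + Y e = (Y y + Y e) + Z'" by (simp add: ac_simps)
        with stdZe have "std (Y y + Y e)" using std_factor by metis
        moreover have "\<not> (y \<in> C p \<and> ix y < ix e)"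
          using e_min[of y] y by (auto simp: Z keys_add_monom)
        ultimately show ?thesis by (auto simp: C'_def q)
      qed
      then show ?thesis by (auto simp: nfh')
    qed
    have keyq: "rk (W' q + nf h') * b + P q = \<kappa>"
      using ph(2) by (simp add: key_def W'_def q nfh' Z ac_simps)
    define c where "c = lookup (x p) h"
    define x' where "x' = (\<lambda>p. x p - Poly_Mapping.single h' c * n q p)"
    have x'N: "x' \<in> N"
      unfolding x'_def by (intro N_diff Suc.prems N_mult n_N q A_single h'H)
    have ph0: "lookup (x' p) h = 0"
      using n_lead[of q] q by (simp add: x'_def lookup_minus h_eq lookup_single_times c_def)
    have terms: "lookup (x p2) h2 \<noteq> 0 \<or> (\<exists>k. h2 = h' + k \<and> lookup (n q p2) k \<noteq> 0)"
      if "lookup (x' p2) h2 \<noteq> 0" for p2 h2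
    proof (cases "lookup (Poly_Mapping.single h' c * n q p2) h2 = 0")
      case True
      with that show ?thesis by (simp add: x'_def lookup_minus)
    next
      case False
      then have "h2 \<in> keys (Poly_Mapping.single h' c * n q p2)" by (simp add: in_keys_iff)
      with keys_single_times[of h' c "n q p2"] show ?thesis by (auto simp: in_keys_iff)
    qed
    have key': "key b W p2 h2 < \<kappa>" if nz: "lookup (x' p2) h2 \<noteq> 0" for p2 h2
    proof -
      have ne: "(p2, h2) \<noteq> (p, h)" using nz ph0 by auto
      from terms[OF nz] show ?thesis
      proof
        assume t: "lookup (x p2) h2 \<noteq> 0"
        then have "p2 < b" "h2 \<in> H" using freemodD N_freemod Suc.prems by blast+
        then have "key b W p2 h2 \<noteq> key b W p h"
          using ne key_inj[of p2 b p W h2 h] pb hH W_mons by auto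
        with Suc.prems(2)[OF t] ph(2) show ?thesis by simp
      next
        assume "\<exists>k. h2 = h' + k \<and> lookup (n q p2) k \<noteq> 0"
        then obtain k where k: "h2 = h' + k" "lookup (n q p2) k \<noteq> 0" by blast
        from times_n_key[OF q(1) h'H k(2)] ne show ?thesis
          unfolding keyq k(1) by (auto simp: q h_eq)
      qed
    qed
    from Suc.IH[OF x'N key'] obtain f where f: "f \<in> freemod b'" "dmap b' n f = x'"
      and f_good: "\<And>q h. lookup (f q) h \<noteq> 0 \<Longrightarrow> keys (nf h) \<inter> C' q = {} \<and> rk (W' q + nf h) * b + P q < \<kappa>"
      and f_dg: "\<And>j. \<forall>p h. lookup (x' p) h \<noteq> 0 \<longrightarrow> dg h = Suc j \<Longrightarrow> \<forall>q h. lookup (f q) h \<noteq> 0 \<longrightarrow> dg h = j"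
      by blast
    define f' where "f' = f(q := f q + Poly_Mapping.single h' c)"
    have f'_terms: "lookup (f q2) h2 \<noteq> 0 \<or> q2 = q \<and> h2 = h'" if "lookup (f' q2) h2 \<noteq> 0" for q2 h2
      using that by (auto simp: f'_def lookup_add lookup_single when_def split: if_splits)
    have "f' \<in> freemod b'"
      using f(1) q h'H by (auto simp: freemod_def f'_def intro: A_add)
    moreover have "dmap b' n f' = x"
    proof
      fix p2
      have "dmap b' n f' p2 = (\<Sum>i<b'. f i * n i p2 + (if i = q then Poly_Mapping.single h' c * n q p2 else 0))"
        unfolding dmap_def f'_def by (intro sum.cong) (auto simp: distrib_right)
      also have "\<dots> = dmap b' n f p2 + Poly_Mapping.single h' c * n q p2"
        using q by (simp add: sum.distrib dmap_def)
      finally show "dmap b' n f' p2 = x p2" by (simp add: f x'_def)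
    qed
    moreover have "keys (nf h2) \<inter> C' q2 = {} \<and> rk (W' q2 + nf h2) * b + P q2 < Suc \<kappa>"
      if "lookup (f' q2) h2 \<noteq> 0" for q2 h2
      using f'_terms[OF that] f_good good keyq by (auto simp: less_Suc_eq)
    moreover have "\<forall>q h. lookup (f' q) h \<noteq> 0 \<longrightarrow> dg h = j"
      if j: "\<forall>p h. lookup (x p) h \<noteq> 0 \<longrightarrow> dg h = Suc j" for j
    proof -
      have "dg h = Suc j" using j ph by blast
      then have h'j: "dg h' = j"
        using dg_add[of h' "lt e"] h'H PE(3)[OF q(1)] by (simp add: h_eq q val_H dg_val)
      have "dg h2 = Suc j" if nz: "lookup (x' p2) h2 \<noteq> 0" for p2 h2
        using terms[OF nz] j n_dg[OF q(1)] n_H[OF q(1)] dg_add[of h'] h'H h'j by auto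
      then show ?thesis using f_dg[of j] f'_terms h'j by blast
    qed
    ultimately show ?thesis by blast
  qed
qed

lemma N_sum:
  assumes "\<And>i. i \<in> I \<Longrightarrow> f i \<in> N"
  shows "(\<lambda>p. \<Sum>i\<in>I. f i p) \<in> N"
  using assms
proof (induction I rule: infinite_finite_induct)
  case (insert i I)
  then have "f i \<in> N" "(\<lambda>p. \<Sum>i\<in>I. f i p) \<in> N" by auto
  from N_diff[OF this(1) N_diff[OF N_0 this(2)]] insert show ?case by simp
qed (auto simp: N_0)

lemma dmap_N: "f \<in> freemod b' \<Longrightarrow> dmap b' n f \<in> N"
  unfolding dmap_def by (rule N_sum) (auto intro: N_mult n_N freemod_A)

lemma image: "dmap b' n ` freemod b' = N"
proof (intro equalityI subsetI)
  fix x assume x: "x \<in> N"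
  have "finite {key b W p h | p h. lookup (x p) h \<noteq> 0}"
  proof (rule finite_subset)
    show "{key b W p h | p h. lookup (x p) h \<noteq> 0} \<subseteq> (\<Union>p<b. key b W p ` keys (x p))"
      using freemodD[OF N_freemod[OF x]] by (fastforce simp: in_keys_iff)
  qed simp
  then obtain \<kappa> where "\<And>p h. lookup (x p) h \<noteq> 0 \<Longrightarrow> key b W p h < \<kappa>"
    unfolding finite_nat_set_iff_bounded by blast
  from division[OF x this] show "x \<in> dmap b' n ` freemod b'" by auto
qed (auto simp: dmap_N)

section \<open>Leading terms and generators of the next syzygy module\<close>

lemma q_eqI: "q < b' \<Longrightarrow> q2 < b' \<Longrightarrow> P q = P q2 \<Longrightarrow> E q = E q2 \<Longrightarrow> q = q2"
  using bij by (auto simp: bij_betw_def inj_on_def)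

text \<open>If \<open>nf h\<close> avoided \<open>C' q\<close>, the product of \<open>h\<close> with
  the leading term of \<open>n q\<close> could not cancel: a competing term \<open>(q2, h2)\<close>
  would have \<open>q2 < q\<close>, the same position and a standard product, so that
  \<open>E q2\<close> divides \<open>nf h\<close> although it belongs to
  \<open>C' q\<close>.\<close>

lemma next_lead:
  assumes x: "x \<in> N'" and q: "q < b'" and h: "lookup (x q) h \<noteq> 0"
    and lead: "\<And>q' h'. lookup (x q') h' \<noteq> 0 \<Longrightarrow> key b' W' q' h' \<le> key b' W' q h"
  shows "keys (nf h) \<inter> C' q \<noteq> {}"
proof
  assume good: "keys (nf h) \<inter> C' q = {}"
  have xf: "x \<in> freemod b'" using x by (simp add: N'_def)
  have hH: "h \<in> H" using freemodD[OF xf h] by simp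
  have s: "std (nf h + Y (E q))" using good_std[OF q hH good] .
  have nfE: "nf (lt (E q)) = Y (E q)" and EH: "lt (E q) \<in> H" using q PE nf_letter val_H by auto
  have nfs: "nf (h + lt (E q)) = nf h + Y (E q)"
    using nf_add[OF hH EH] s by (simp add: nfE)
  have zero: "lookup (Poly_Mapping.single h2 c * n q2 (P q)) (h + lt (E q)) = 0"
    if q2: "q2 < b'" and t: "lookup (x q2) h2 \<noteq> 0" and ne: "(q2, h2) \<noteq> (q, h)" for q2 h2 c
  proof (rule ccontr)
    assume "lookup (Poly_Mapping.single h2 c * n q2 (P q)) (h + lt (E q)) \<noteq> 0"
    then have "h + lt (E q) \<in> keys (Poly_Mapping.single h2 c * n q2 (P q))" by (simp add: in_keys_iff)
    then obtain k where k: "h + lt (E q) = h2 + k" "lookup (n q2 (P q)) k \<noteq> 0"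
      using keys_single_times[of h2 c "n q2 (P q)"] by (auto simp: in_keys_iff)
    have h2: "h2 \<in> H" using freemodD[OF xf t] by simp
    have "key b W (P q) (h2 + k) = rk (W' q + nf h) * b + P q"
      unfolding k(1)[symmetric] by (simp add: key_def nfs W'_def ac_simps)
    with times_n_key[OF q2 h2 k(2)] have le: "rk (W' q + nf h) * b + P q < rk (W' q2 + nf h2) * b + P q2
      \<or> rk (W' q + nf h) = rk (W' q2 + nf h2) \<and> P q = P q2 \<and> k = lt (E q2) \<and> std (nf h2 + Y (E q2))"
      by (auto simp: lex_eq_iff PE q q2)
    have "key b' W' q2 h2 \<noteq> key b' W' q h"
      using ne key_inj[of q2 b' q W' h2 h] q q2 hH h2 W'_mons by auto
    with lead[OF t] have "key b' W' q2 h2 < key b' W' q h" by simp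
    then have lt': "rk (W' q2 + nf h2) < rk (W' q + nf h) \<or> rk (W' q2 + nf h2) = rk (W' q + nf h) \<and> q2 < q"
      by (simp add: key_def lex_less_iff q q2)
    \<comment> \<open>\<open>le\<close> bounds the key of the target by that of the competitor, and
      \<open>lt'\<close> says that the competitor is not the leading term. Since positions increase
      weakly with the index, only a tie in rank and position with \<open>q2 < q\<close> survives
      both.\<close>
    have q2q: "q2 < q" and PP: "P q = P q2" and kk: "k = lt (E q2)" and s2: "std (nf h2 + Y (E q2))"
      using le lt' mono[of q2 q] q PE[OF q] PE[OF q2] by (auto simp: lex_less_iff)
    have ix: "ix (E q2) < ix (E q)" using mono[OF q2q q] PP by simp
    have E2H: "lt (E q2) \<in> H" and nfE2: "nf (lt (E q2)) = Y (E q2)" using q2 PE nf_letter val_H by auto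
    have "nf h + Y (E q) = nf h2 + Y (E q2)"
      using nf_add[OF h2 E2H] s2 nfs by (simp add: k(1) kk nfE2)
    then have "E q2 \<in> keys (nf h + Y (E q))" by (simp add: keys_add_monom)
    with ix have "E q2 \<in> keys (nf h)" by (auto simp: keys_add_monom)
    moreover have "E q2 \<in> C' q" using PE(2)[OF q2] PP ix by (simp add: C'_def)
    ultimately show False using good by blast
  qed
  have "lookup (x q2 * n q2 (P q)) (h + lt (E q)) = (if q2 = q then lookup (x q) h else 0)"
    if q2: "q2 < b'" for q2
  proof -
    have "lookup (x q2 * n q2 (P q)) (h + lt (E q)) =
        (\<Sum>h2\<in>keys (x q2). if q2 = q \<and> h2 = h then lookup (x q) h else 0)"
      unfolding lookup_times_sum[of "x q2"]
    proof (rule sum.cong[OF refl])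
      fix h2 assume "h2 \<in> keys (x q2)"
      then show "lookup (Poly_Mapping.single h2 (lookup (x q2) h2) * n q2 (P q)) (h + lt (E q)) =
          (if q2 = q \<and> h2 = h then lookup (x q) h else 0)"
        using zero[OF q2, of h2] n_lead[OF q] by (auto simp: in_keys_iff lookup_single_times)
    qed
    also have "\<dots> = (if q2 = q then lookup (x q) h else 0)"
      using h by (cases "q2 = q") (auto simp: in_keys_iff)
    finally show ?thesis .
  qed
  then have "lookup (dmap b' n x (P q)) (h + lt (E q)) = (\<Sum>q2<b'. if q2 = q then lookup (x q) h else 0)"
    unfolding dmap_def lookup_sum by (intro sum.cong) auto
  then have "lookup (dmap b' n x (P q)) (h + lt (E q)) = lookup (x q) h" using q by simp
  moreover have "dmap b' n x = (\<lambda>_. 0)" using x by (simp add: N'_def)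
  ultimately show False using h by simp
qed

text \<open>Multiply \<open>n q\<close> by the bad letter \<open>e\<close> and reduce with
  \<open>division\<close>: the term \<open>e\<close> in position \<open>q\<close> minus the quotient
  is a syzygy. The quotient cannot contain that term itself, because quotient terms in position
  \<open>q\<close> avoid \<open>C' q\<close>.\<close>

lemma next_gen:
  assumes q: "q < b'" and e: "e \<in> C' q"
  shows "\<exists>x\<in>N'. lookup (x q) (lt e) = 1 \<and>
    (\<forall>q' h'. lookup (x q') h' \<noteq> 0 \<longrightarrow> key b' W' q' h' \<le> key b' W' q (lt e) \<and> dg h' = 1)"
proof -
  have eG: "e \<in> G" using C'_G q e by blast
  have eH: "lt e \<in> H" and nfe: "nf (lt e) = Y e" using eG nf_letter val_H by auto
  define g where "g = (\<lambda>i. if i = q then Poly_Mapping.single (lt e) (1::'k) else 0)"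
  define x where "x = (\<lambda>p. Poly_Mapping.single (lt e) (1::'k) * n q p)"
  define B where "B = rk (W' q + Y e) * b + P q"
  have gf: "g \<in> freemod b'" using eH q by (auto simp: g_def freemod_def)
  have dg_x: "dmap b' n g = x"
  proof
    fix p
    have "dmap b' n g p = (\<Sum>i<b'. if i = q then x p else 0)"
      unfolding dmap_def g_def x_def by (intro sum.cong) auto
    then show "dmap b' n g p = x p" using q by simp
  qed
  have xN: "x \<in> N" unfolding x_def by (intro N_mult n_N q A_single eH)
  have x_terms: "\<exists>k. h = lt e + k \<and> lookup (n q p) k \<noteq> 0" if "lookup (x p) h \<noteq> 0" for p h
    using that keys_single_times[of "lt e" 1 "n q p"] by (auto simp: x_def in_keys_iff)
  have x_key: "key b W p h < Suc B" if "lookup (x p) h \<noteq> 0" for p h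
    using x_terms[OF that] times_n_key[OF q eH] by (auto simp: B_def nfe less_Suc_eq)
  \<comment> \<open>The product has degree two, so the degree clause of \<open>division\<close>
    makes the quotient linear.\<close>
  have x_dg: "dg h = Suc 1" if "lookup (x p) h \<noteq> 0" for p h
    using x_terms[OF that] n_dg[OF q] n_H[OF q] eG by (auto simp: dg_add eH dg_val)
  from division[OF xN x_key] obtain f where f: "f \<in> freemod b'" "dmap b' n f = x"
    and f_good: "\<And>q h. lookup (f q) h \<noteq> 0 \<Longrightarrow> keys (nf h) \<inter> C' q = {} \<and> rk (W' q + nf h) * b + P q < Suc B"
    and f_dg: "\<And>q h. lookup (f q) h \<noteq> 0 \<Longrightarrow> dg h = 1"
    using x_dg by blast
  have f_key: "key b' W' q2 h2 < key b' W' q (lt e)" if t: "lookup (f q2) h2 \<noteq> 0" for q2 h2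
  proof -
    have q2: "q2 < b'" and h2: "h2 \<in> H" using freemodD[OF f(1) t] by auto
    have good: "keys (nf h2) \<inter> C' q2 = {}" using f_good[OF t] by simp
    have "rk (W' q2 + nf h2) * b + P q2 \<le> rk (W' q + Y e) * b + P q"
      using f_good[OF t] by (simp add: B_def)
    then have "rk (W' q2 + nf h2) < rk (W' q + Y e) \<or> rk (W' q2 + nf h2) = rk (W' q + Y e) \<and> P q2 \<le> P q"
      by (simp add: lex_le_iff PE q q2)
    then show ?thesis
    proof
      assume "rk (W' q2 + nf h2) < rk (W' q + Y e)"
      then show ?thesis by (simp add: key_def lex_less_iff q q2 nfe)
    next
      assume *: "rk (W' q2 + nf h2) = rk (W' q + Y e) \<and> P q2 \<le> P q"
      then have eq: "W' q2 + nf h2 = W' q + Y e"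
        by (intro rk_eqD) (auto simp: mons_add_iff W'_mons q q2 nf_mons h2 eG)
      \<comment> \<open>A tie in rank. In equal positions two products of two letters agree. If
        \<open>E q2 = E q\<close>, then \<open>nf h2 = Y e\<close>, which is excluded since
        \<open>e\<close> is in \<open>C' q\<close>. Otherwise the letters change roles; then
        \<open>e\<close> and \<open>E q\<close> form a standard pair, so \<open>e\<close> is in
        \<open>C' q\<close> only because it is listed earlier.\<close>
      have "q2 < q"
      proof (cases "P q2 = P q")
        case False
        with * mono[of q q2] q2 show ?thesis by (metis linorder_neqE_nat not_less nat_less_le)
      next
        case True
        with eq have eq: "Y (E q2) + nf h2 = Y (E q) + Y e" by (simp add: W'_def add.assoc)
        show ?thesis
        proof (cases "E q2 = E q")
          case True
          with eq have "nf h2 = Y e" by simp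
          moreover have "q2 = q" using q_eqI[OF q2 q] True \<open>P q2 = P q\<close> by simp
          ultimately show ?thesis using good e by auto
        next
          case False
          have "E q2 \<in> keys (Y (E q) + Y e)" by (simp flip: eq add: keys_add_monom)
          with False have Ee: "E q2 = e" by (simp add: keys_add_monom)
          with eq have "nf h2 = Y (E q)" by (metis add.commute add_left_cancel)
          with good have "E q \<notin> C' q2" by auto
          then have "std (Y e + Y (E q))" using PE(3)[OF q] by (simp add: C'_def Ee add.commute)
          with e have "ix e < ix (E q)" by (simp add: C'_def)
          then show ?thesis using mono[of q q2] q2 Ee \<open>P q2 = P q\<close>
            by (metis less_asym less_irrefl linorder_neqE_nat)
        qed
      qed
      with eq show ?thesis by (simp add: key_def lex_less_iff q q2 nfe)
    qed
  qed
  define z where "z = (\<lambda>i. g i - f i)"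
  have "z \<in> N'"
    using gf f dg_x unfolding N'_def z_def
    by (auto simp: freemod_def dmap_def left_diff_distrib sum_subtractf fun_eq_iff intro: A_diff)
  moreover have z_terms: "lookup (z q2) h2 \<noteq> 0 \<Longrightarrow> lookup (f q2) h2 \<noteq> 0 \<or> q2 = q \<and> h2 = lt e" for q2 h2
    by (auto simp: z_def g_def lookup_minus lookup_single when_def split: if_splits)
  moreover have "lookup (f q) (lt e) = 0" using f_key[of q "lt e"] by auto
  then have "lookup (z q) (lt e) = 1" by (simp add: z_def g_def lookup_minus)
  moreover have "dg (lt e) = 1" using eG by (simp add: dg_val)
  ultimately show ?thesis using f_key f_dg by (metis less_imp_le order_refl)
qed

lemma next_stage: "stage b' W' C' N'"
  unfolding stage_def
proof (intro conjI allI impI ballI)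
  show "N' \<subseteq> freemod b'" by (auto simp: N'_def)
  show "(\<lambda>_. 0) \<in> N'" by (auto simp: N'_def freemod_def dmap_def)
  show "(\<lambda>p. x p - y p) \<in> N'" if "x \<in> N'" "y \<in> N'" for x y
    using that by (auto simp: N'_def freemod_def dmap_def left_diff_distrib sum_subtractf fun_eq_iff intro: A_diff)
  show "(\<lambda>p. a * x p) \<in> N'" if "a \<in> A" "x \<in> N'" for a x
    using that by (auto simp: N'_def freemod_def dmap_def mult.assoc sum_distrib_left[symmetric] fun_eq_iff intro: A_mult)
  show "keys (nf h) \<inter> C' p \<noteq> {}"
    if "x \<in> N'" "p < b'" "lookup (x p) h \<noteq> 0"
      "\<forall>p' h'. lookup (x p') h' \<noteq> 0 \<longrightarrow> key b' W' p' h' \<le> key b' W' p h" for x p h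
    using next_lead that by blast
qed (use next_gen W'_mons C'_G in auto)

end

context toric_quadratic
begin

lemma stage_step:
  fixes N :: "(nat \<Rightarrow> 'a \<Rightarrow>\<^sub>0 'k::field) set"
  assumes st: "stage b W C N"
  shows "\<exists>b' W' C' n. stage b' W' C' {f \<in> freemod b'. dmap b' n f = (\<lambda>_. 0)} \<and> dmap b' n ` freemod b' = N \<and>
    (\<forall>q<b'. n q \<in> freemod b \<and> (\<forall>p h. lookup (n q p) h \<noteq> 0 \<longrightarrow> dg h = 1))"
proof -
  obtain ix :: "'b \<Rightarrow> nat" where ix: "inj_on ix G"
    using finite_imp_inj_to_nat_seg[OF finite_G] by metis
  obtain K where K: "\<And>e. e \<in> G \<Longrightarrow> ix e < K"
    using finite_nat_set_iff_bounded[of "ix ` G"] finite_G by blast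
  let ?X = "SIGMA p:{..<b}. C p"
  \<comment> \<open>\<open>K\<close> exceeds every letter index, so this code sorts by position
    first and by \<open>ix\<close> second, the order that \<open>mono\<close> demands.\<close>
  let ?c = "\<lambda>(p, e). p * K + ix e"
  have CG: "p < b \<Longrightarrow> C p \<subseteq> G" for p using st by (auto simp: stage_def)
  have "finite ?X" using CG finite_G by (auto intro!: finite_SigmaI intro: finite_subset)
  then have "finite (?c ` ?X)" by simp
  then obtain s where s: "bij_betw s {..<card (?c ` ?X)} (?c ` ?X)" "strict_mono_on {..<card (?c ` ?X)} s"
    by (rule ex_bij_betw_strict_mono_card)
  define b' where "b' = card (?c ` ?X)"
  have c_inj: "inj_on ?c ?X"
    using K CG ix by (auto simp: inj_on_def lex_eq_iff subset_iff)
  define g where "g q = inv_into ?X ?c (s q)" for q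
  have g: "bij_betw g {..<b'} ?X"
    unfolding g_def b'_def
    using bij_betw_trans[OF s(1) bij_betw_inv_into[OF inj_on_imp_bij_betw[OF c_inj]]] by (simp add: comp_def)
  have cg: "?c (g q) = s q" if "q < b'" for q
    unfolding g_def using that bij_betw_apply[OF s(1)] by (intro f_inv_into_f) (auto simp: b'_def)
  define P E where "P q = fst (g q)" and "E q = snd (g q)" for q
  have PE: "P q < b" "E q \<in> C (P q)" "E q \<in> G" if "q < b'" for q
    using bij_betw_apply[OF g, of q] that CG[THEN subsetD, of "P q" "E q"] by (auto simp: P_def E_def)
  have mono: "P q < P q' \<or> P q = P q' \<and> ix (E q) < ix (E q')" if "q < q'" "q' < b'" for q q'
  proof -
    have "s q < s q'" using s(2) that by (auto simp: strict_mono_on_def b'_def)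
    then have "P q * K + ix (E q) < P q' * K + ix (E q')"
      using cg[of q] cg[of q'] that by (simp add: P_def E_def case_prod_beta)
    then show ?thesis using K PE(3) that by (simp add: lex_less_iff)
  qed
  have gen: "\<exists>x. x \<in> N \<and> lookup (x p) (lt e) = 1 \<and>
      (\<forall>p' h'. lookup (x p') h' \<noteq> 0 \<longrightarrow> key b W p' h' \<le> key b W p (lt e) \<and> dg h' = 1)"
    if "p < b" "e \<in> C p" for p e
    using st that unfolding stage_def Bex_def by simp
  have "\<forall>q\<in>{..<b'}. \<exists>x. x \<in> N \<and> lookup (x (P q)) (lt (E q)) = 1 \<and>
      (\<forall>p' h'. lookup (x p') h' \<noteq> 0 \<longrightarrow> key b W p' h' \<le> key b W (P q) (lt (E q)) \<and> dg h' = 1)"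
    using PE by (intro ballI gen) auto
  from bchoice[OF this] obtain n where n: "\<And>q. q < b' \<Longrightarrow> n q \<in> N \<and> lookup (n q (P q)) (lt (E q)) = 1 \<and>
      (\<forall>p' h'. lookup (n q p') h' \<noteq> 0 \<longrightarrow> key b W p' h' \<le> key b W (P q) (lt (E q)) \<and> dg h' = 1)"
    by auto
  interpret syzygy_step G val rk b W C N ix b' P E n
    by unfold_locales (use st g mono n in \<open>auto simp: P_def E_def\<close>)
  have "n q \<in> freemod b" if "q < b'" for q using n[OF that] N_freemod by blast
  then show ?thesis using next_stage image n unfolding N'_def by blast
qed

text \<open>The augmentation ideal as a submodule of rank one: the normal form of a nonzero value
  contains some letter, and each letter lies in the ideal. It is closed under multiplication because
  degrees add and only 0 has degree 0.\<close>

lemma stage_zero: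
  "stage 1 (\<lambda>_. 0) (\<lambda>_. G) {f \<in> freemod 1. lookup (f 0 :: 'a \<Rightarrow>\<^sub>0 'k::field) 0 = 0}"
  unfolding stage_def
proof (intro conjI allI impI ballI)
  fix a :: "'a \<Rightarrow>\<^sub>0 'k" and x :: "nat \<Rightarrow> 'a \<Rightarrow>\<^sub>0 'k"
  assume a: "a \<in> A" and x: "x \<in> {f \<in> freemod 1. lookup (f 0) 0 = 0}"
  have "lookup (a * x 0) 0 = 0"
  proof (rule ccontr)
    assume "lookup (a * x 0) 0 \<noteq> 0"
    then obtain u v where uv: "0 = u + v" "u \<in> keys a" "v \<in> keys (x 0)"
      using keys_mult[of a "x 0"] by (auto simp: in_keys_iff subset_iff)
    then have "u \<in> H" "v \<in> H" using a x by (auto simp: A_def freemod_def)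
    then have "dg u + dg v = 0" using dg_add[of u v] uv(1) by simp
    then have "v = 0" using \<open>v \<in> H\<close> by (simp add: dg_0_iff)
    with uv x show False by (auto simp: in_keys_iff)
  qed
  then show "(\<lambda>p. a * x p) \<in> {f \<in> freemod 1. lookup (f 0) 0 = 0}"
    using a x by (auto simp: freemod_def intro: A_mult)
next
  fix x :: "nat \<Rightarrow> 'a \<Rightarrow>\<^sub>0 'k" and p h
  assume x: "x \<in> {f \<in> freemod 1. lookup (f 0) 0 = 0}" and p: "p < 1" and h: "lookup (x p) h \<noteq> 0"
  have "h \<in> H" using x h freemodD by blast
  moreover have "h \<noteq> 0" using x p h by auto
  ultimately have "keys (nf h) \<noteq> {}" "keys (nf h) \<subseteq> G"
    using nf_0_iff nf_mons by (auto simp: mons_def)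
  then show "keys (nf h) \<inter> G \<noteq> {}" by blast
next
  fix p :: nat and e assume p: "p < 1" and e: "e \<in> G"
  then have lt: "lt e \<in> H" "dg (lt e) = 1" by (auto simp: val_H dg_val)
  then have "lt e \<noteq> 0" by auto
  define x where "x = (\<lambda>i::nat. if i = 0 then Poly_Mapping.single (lt e) (1::'k) else 0)"
  show "\<exists>x\<in>{f \<in> freemod 1. lookup (f 0 :: 'a \<Rightarrow>\<^sub>0 'k) 0 = 0}. lookup (x p) (lt e) = 1 \<and>
      (\<forall>p' h'. lookup (x p') h' \<noteq> 0 \<longrightarrow>
        key 1 (\<lambda>_. 0) p' h' \<le> key 1 (\<lambda>_. 0) p (lt e) \<and> dg h' = 1)"
    using p lt \<open>lt e \<noteq> 0\<close>
    by (intro bexI[of _ x]) (auto simp: x_def freemod_def lookup_single when_def split: if_splits)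
qed (auto simp: freemod_def lookup_minus intro: A_diff)

lemma linear_resolution:
  obtains b :: "nat \<Rightarrow> nat" and n :: "nat \<Rightarrow> nat \<Rightarrow> nat \<Rightarrow> 'a \<Rightarrow>\<^sub>0 'k::field"
  where "b 0 = 1"
    and "\<And>i q. q < b (Suc i) \<Longrightarrow> n i q \<in> freemod (b i)"
    and "\<And>i q p h. q < b (Suc i) \<Longrightarrow> lookup (n i q p) h \<noteq> 0 \<Longrightarrow> dg h = 1"
    and "dmap (b 1) (n 0) ` freemod (b 1) = {f \<in> freemod 1. lookup (f 0) 0 = 0}"
    and "\<And>i. dmap (b (Suc (Suc i))) (n (Suc i)) ` freemod (b (Suc (Suc i))) =
      {f \<in> freemod (b (Suc i)). dmap (b (Suc i)) (n i) f = (\<lambda>_. 0)}"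
proof -
  \<comment> \<open>A state of the recursion is a whole stage, since weights and letter sets
    determine how the next step is made; only the ranks and the maps survive in the
    conclusion.\<close>
  define R :: "(nat \<times> (nat \<Rightarrow> 'b monom) \<times> (nat \<Rightarrow> 'b set) \<times> (nat \<Rightarrow> 'a \<Rightarrow>\<^sub>0 'k) set) \<Rightarrow>
      (nat \<Rightarrow> nat \<Rightarrow> 'a \<Rightarrow>\<^sub>0 'k) \<Rightarrow> (nat \<times> (nat \<Rightarrow> 'b monom) \<times> (nat \<Rightarrow> 'b set) \<times> (nat \<Rightarrow> 'a \<Rightarrow>\<^sub>0 'k) set) \<Rightarrow> bool"
    where "R = (\<lambda>(b, W, C, N) n (b', W', C', N'). N' = {f \<in> freemod b'. dmap b' n f = (\<lambda>_. 0)} \<and>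
      dmap b' n ` freemod b' = N \<and> (\<forall>q<b'. n q \<in> freemod b \<and> (\<forall>p h. lookup (n q p) h \<noteq> 0 \<longrightarrow> dg h = 1)))"
  let ?S = "\<lambda>(b, W, C, N). stage b W C N"
  have "\<exists>S. \<forall>i. (?S (S i) \<and> (i = 0 \<longrightarrow> S i = (1, \<lambda>_. 0, \<lambda>_. G, {f \<in> freemod 1. lookup (f 0 :: 'a \<Rightarrow>\<^sub>0 'k) 0 = 0}))) \<and>
      (\<exists>n. R (S i) n (S (Suc i)))"
  proof (rule dependent_nat_choice)
    show "\<exists>x. ?S x \<and> (0 = (0::nat) \<longrightarrow> x = (1, \<lambda>_. 0, \<lambda>_. G, {f \<in> freemod 1. lookup (f 0 :: 'a \<Rightarrow>\<^sub>0 'k) 0 = 0}))"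
      using stage_zero by auto
  next
    fix x and i :: nat
    assume x: "?S x \<and> (i = 0 \<longrightarrow> x = (1, \<lambda>_. 0, \<lambda>_. G, {f \<in> freemod 1. lookup (f 0 :: 'a \<Rightarrow>\<^sub>0 'k) 0 = 0}))"
    obtain b W C N where x_eq: "x = (b, W, C, N)" by (cases x)
    from x have "stage b W C N" by (simp add: x_eq)
    from stage_step[OF this] obtain b' W' C' n where
      s: "stage b' W' C' {f \<in> freemod b'. dmap b' n f = (\<lambda>_. 0)}" "dmap b' n ` freemod b' = N"
      "\<forall>q<b'. n q \<in> freemod b \<and> (\<forall>p h. lookup (n q p) h \<noteq> 0 \<longrightarrow> dg h = 1)" by blast
    show "\<exists>y. (?S y \<and> (Suc i = 0 \<longrightarrow> y = (1, \<lambda>_. 0, \<lambda>_. G, {f \<in> freemod 1. lookup (f 0 :: 'a \<Rightarrow>\<^sub>0 'k) 0 = 0}))) \<and>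
        (\<exists>n. R x n y)"
      using s by (intro exI[of _ "(b', W', C', {f \<in> freemod b'. dmap b' n f = (\<lambda>_. 0)})"] conjI exI[of _ n])
        (auto simp: R_def x_eq)
  qed
  then obtain S where S0: "S 0 = (1, \<lambda>_. 0, \<lambda>_. G, {f \<in> freemod 1. lookup (f 0 :: 'a \<Rightarrow>\<^sub>0 'k) 0 = 0})"
    and "\<forall>i. \<exists>n. R (S i) n (S (Suc i))" by blast
  then obtain n where n: "\<And>i. R (S i) (n i) (S (Suc i))" by metis
  define b where "b i = fst (S i)" for i
  define N where "N i = snd (snd (snd (S i)))" for i
  have "N (Suc i) = {f \<in> freemod (b (Suc i)). dmap (b (Suc i)) (n i) f = (\<lambda>_. 0)} \<and>
      dmap (b (Suc i)) (n i) ` freemod (b (Suc i)) = N i \<and>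
      (\<forall>q<b (Suc i). n i q \<in> freemod (b i) \<and> (\<forall>p h. lookup (n i q p) h \<noteq> 0 \<longrightarrow> dg h = 1))" for i
    using n[of i] by (auto simp: R_def b_def N_def case_prod_beta)
  moreover have "b 0 = 1" "N 0 = {f \<in> freemod 1. lookup (f 0) 0 = 0}" by (auto simp: b_def N_def S0)
  ultimately show thesis by (intro that[of b n]) auto
qed

end

section \<open>Koszul graded rings\<close>

text \<open>\<open>Q\<close> stands for the toric quotient ring, seen only through the isomorphism
  \<open>ev\<close> onto the semigroup algebra; this keeps cosets of the toric ideal out of the
  argument.\<close>

locale toric_model = toric_quadratic G val rk + Q?: cring Q
  for G :: "'b set" and val :: "'b monom \<Rightarrow> 'a :: cancel_comm_monoid_add" and rk
    and Q :: "('q, 'z) ring_scheme" (structure) +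
  fixes ev :: "'q \<Rightarrow> 'a \<Rightarrow>\<^sub>0 'k::field" and gr :: "nat \<Rightarrow> 'q set"
  assumes ev_inj: "inj_on ev (carrier Q)"
    and ev_image: "ev ` carrier Q = A"
    and ev_add: "x \<in> carrier Q \<Longrightarrow> y \<in> carrier Q \<Longrightarrow> ev (x \<oplus> y) = ev x + ev y"
    and ev_mult: "x \<in> carrier Q \<Longrightarrow> y \<in> carrier Q \<Longrightarrow> ev (x \<otimes> y) = ev x * ev y"
    and ev_one: "ev \<one> = 1"
    and gr_eq: "gr i = {x \<in> carrier Q. \<forall>h\<in>keys (ev x). dg h = i}"
begin

definition iv :: "('a \<Rightarrow>\<^sub>0 'k) \<Rightarrow> 'q" where
  "iv = inv_into (carrier Q) ev"

lemma iv_closed [simp]: "f \<in> A \<Longrightarrow> iv f \<in> carrier Q" and ev_iv [simp]: "f \<in> A \<Longrightarrow> ev (iv f) = f"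
  unfolding iv_def ev_image[symmetric] by (rule inv_into_into, simp) (rule f_inv_into_f, simp)

lemma ev_A: "x \<in> carrier Q \<Longrightarrow> ev x \<in> A"
  using ev_image by blast

lemma ev_eqD: "x \<in> carrier Q \<Longrightarrow> y \<in> carrier Q \<Longrightarrow> ev x = ev y \<Longrightarrow> x = y"
  by (rule inj_onD[OF ev_inj])

lemma iv_eqI: "x \<in> carrier Q \<Longrightarrow> ev x = f \<Longrightarrow> iv f = x"
  unfolding iv_def using ev_inj by (auto simp: inv_into_f_f)

lemma ev_zero [simp]: "ev \<zero> = 0"
  using ev_add[of \<zero> \<zero>] by simp

lemma ev_minus [simp]: "x \<in> carrier Q \<Longrightarrow> ev (\<ominus> x) = - ev x"
  using ev_add[of x "\<ominus> x"] by (simp add: r_neg eq_neg_iff_add_eq_0 Groups.add.commute[of "ev (\<ominus> x)"])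

lemma ev_finsum: "f \<in> I \<rightarrow> carrier Q \<Longrightarrow> ev (finsum Q f I) = (\<Sum>i\<in>I. ev (f i))"
  by (induction I rule: infinite_finite_induct) (auto simp: ev_add)

lemma carrier_induct:
  assumes x: "x \<in> carrier Q" and V: "V \<subseteq> carrier Q" "\<zero> \<in> V" "\<And>y z. y \<in> V \<Longrightarrow> z \<in> V \<Longrightarrow> y \<oplus> z \<in> V"
    and singles: "\<And>h c. h \<in> keys (ev x) \<Longrightarrow> iv (Poly_Mapping.single h c) \<in> V"
  shows "x \<in> V"
proof -
  have H: "keys (ev x) \<subseteq> H" using ev_A[OF x] by (simp add: A_def)
  have "\<exists>y\<in>V. ev y = (\<Sum>h\<in>F. Poly_Mapping.single h (lookup (ev x) h))" if "finite F" "F \<subseteq> keys (ev x)" for F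
    using that
  proof (induction F rule: finite_induct)
    case empty
    show ?case using V by (intro bexI[of _ \<zero>]) auto
  next
    case (insert h F)
    then obtain y where y: "y \<in> V" "ev y = (\<Sum>h\<in>F. Poly_Mapping.single h (lookup (ev x) h))" by auto
    have "iv (Poly_Mapping.single h (lookup (ev x) h)) \<in> V" using singles insert by auto
    moreover have "y \<in> carrier Q" "h \<in> H" using y V(1) insert H by auto
    ultimately show ?case using y V(3) insert
      by (intro bexI[of _ "iv (Poly_Mapping.single h (lookup (ev x) h)) \<oplus> y"]) (auto simp: ev_add)
  qed
  from this[of "keys (ev x)"] obtain y where "y \<in> V" "ev y = ev x"
    by (auto simp: poly_sum_singles)
  then show ?thesis using ev_eqD x V by blast
qed

section \<open>The grading and the axioms of a standard graded algebra\<close>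

lemma gr_closed: "x \<in> gr i \<Longrightarrow> x \<in> carrier Q"
  by (simp add: gr_eq)

lemma gr_subset: "gr i \<subseteq> carrier Q"
  by (auto simp: gr_eq)

lemma gr_single: "h \<in> H \<Longrightarrow> dg h = i \<Longrightarrow> iv (Poly_Mapping.single h c) \<in> gr i"
  by (auto simp: gr_eq)

lemma gr_add: "x \<in> gr i \<Longrightarrow> y \<in> gr i \<Longrightarrow> x \<oplus> y \<in> gr i"
  using Poly_Mapping.keys_add[of "ev x" "ev y"] by (auto simp: gr_eq ev_add subset_iff)

lemma gr_minus: "x \<in> gr i \<Longrightarrow> \<ominus> x \<in> gr i"
  by (auto simp: gr_eq in_keys_iff)

lemma gr_additive_subgroup: "additive_subgroup (gr i) Q"
proof (rule additive_subgroupI, rule add.subgroupI)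
  show "gr i \<noteq> {}" by (auto simp: gr_eq intro!: exI[of _ \<zero>])
qed (auto simp: gr_subset[THEN subsetD] gr_add gr_minus)

lemma gr_times: "x \<in> gr i \<Longrightarrow> y \<in> gr j \<Longrightarrow> x \<otimes> y \<in> gr (i + j)"
proof -
  assume x: "x \<in> gr i" and y: "y \<in> gr j"
  have "dg h = i + j" if "h \<in> keys (ev x * ev y)" for h
  proof -
    from that obtain u v where uv: "h = u + v" "u \<in> keys (ev x)" "v \<in> keys (ev y)"
      by (rule keys_mult_E)
    moreover have "u \<in> H" "v \<in> H" using uv x y ev_A by (auto simp: A_def gr_eq subset_iff)
    ultimately show ?thesis using x y by (auto simp: gr_eq dg_add)
  qed
  then show ?thesis using x y by (auto simp: gr_eq ev_mult)
qed

lemma gr_decomposition: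
  assumes a: "a \<in> carrier Q"
  shows "\<exists>!c. (\<forall>i. c i \<in> gr i) \<and> finite {i. c i \<noteq> \<zero>} \<and> a = (\<Oplus>i\<in>{i. c i \<noteq> \<zero>}. c i)"
proof -
  define part where "part i = (\<Sum>h\<in>{h \<in> keys (ev a). dg h = i}. Poly_Mapping.single h (lookup (ev a) h))" for i
  have lookup_part: "lookup (part i) h = (if dg h = i then lookup (ev a) h else 0)" for i h
    by (auto simp: part_def lookup_sum lookup_single when_def in_keys_iff)
  have H: "keys (ev a) \<subseteq> H" using ev_A[OF a] by (simp add: A_def)
  have part_A: "part i \<in> A" for i unfolding part_def using H by (intro A_sum) auto
  define c0 where "c0 i = iv (part i)" for i
  have c0_gr: "c0 i \<in> gr i" for i
    by (auto simp: c0_def gr_eq part_A in_keys_iff lookup_part split: if_splits)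
  have part_0: "part i = 0" if "i \<notin> dg ` keys (ev a)" for i
    using that by (intro poly_mapping_eqI) (auto simp: lookup_part in_keys_iff image_iff)
  have supp: "{i. c0 i \<noteq> \<zero>} \<subseteq> dg ` keys (ev a)"
    using part_0 iv_eqI[of \<zero> 0] by (fastforce simp: c0_def)
  then have fin: "finite {i. c0 i \<noteq> \<zero>}" by (rule finite_subset) simp
  \<comment> \<open>A term \<open>h\<close> can come only from the component of degree
    \<open>dg h\<close>, so the coefficients of a sum recover its components. Existence and
    uniqueness of the decomposition both rest on this.\<close>
  have sum_lookup: "lookup (ev (\<Oplus>i\<in>{i. c i \<noteq> \<zero>}. c i)) h = lookup (ev (c (dg h))) h"
    if c: "\<And>i. c i \<in> gr i" and fin: "finite {i. c i \<noteq> \<zero>}" for c h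
  proof -
    have z: "lookup (ev (c i)) h = 0" if "i \<noteq> dg h" for i
      using c[of i] that by (auto simp: gr_eq in_keys_iff)
    have "lookup (ev (\<Oplus>i\<in>{i. c i \<noteq> \<zero>}. c i)) h = (\<Sum>i\<in>{i. c i \<noteq> \<zero>}. lookup (ev (c i)) h)"
      using c gr_closed by (subst ev_finsum) (auto simp: lookup_sum)
    also have "\<dots> = (\<Sum>i\<in>{i. c i \<noteq> \<zero>}. if i = dg h then lookup (ev (c (dg h))) h else 0)"
      using z by (intro sum.cong) auto
    also have "\<dots> = lookup (ev (c (dg h))) h"
      using fin by auto
    finally show ?thesis .
  qed
  show ?thesis
  proof (rule ex1I[of _ c0])
    have "ev (\<Oplus>i\<in>{i. c0 i \<noteq> \<zero>}. c0 i) = ev a"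
      using sum_lookup[OF c0_gr fin] by (intro poly_mapping_eqI) (simp add: c0_def part_A lookup_part)
    then have "a = (\<Oplus>i\<in>{i. c0 i \<noteq> \<zero>}. c0 i)"
      using a c0_gr gr_closed by (intro ev_eqD finsum_closed) auto
    with c0_gr fin show "(\<forall>i. c0 i \<in> gr i) \<and> finite {i. c0 i \<noteq> \<zero>} \<and> a = (\<Oplus>i\<in>{i. c0 i \<noteq> \<zero>}. c0 i)" by blast
  next
    fix c assume c: "(\<forall>i. c i \<in> gr i) \<and> finite {i. c i \<noteq> \<zero>} \<and> a = (\<Oplus>i\<in>{i. c i \<noteq> \<zero>}. c i)"
    show "c = c0"
    proof
      fix i
      have "ev (c i) = part i"
      proof (rule poly_mapping_eqI)
        fix h
        show "lookup (ev (c i)) h = lookup (part i) h"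
        proof (cases "dg h = i")
          case True
          with sum_lookup[of c h] c show ?thesis by (simp add: lookup_part)
        next
          case False
          moreover have "\<forall>h\<in>keys (ev (c i)). dg h = i" using c by (simp add: gr_eq)
          ultimately show ?thesis by (auto simp: lookup_part in_keys_iff)
        qed
      qed
      then have "ev (c i) = ev (c0 i)" by (simp add: c0_def part_A)
      then show "c i = c0 i" using c c0_gr gr_closed by (intro ev_eqD) blast+
    qed
  qed
qed

lemma gr_0_iff: "x \<in> gr 0 \<longleftrightarrow> x \<in> carrier Q \<and> (\<exists>c. ev x = Poly_Mapping.single 0 c)"
proof
  assume x: "x \<in> gr 0"
  then have "keys (ev x) \<subseteq> {0}"
    using ev_A[of x] by (auto simp: gr_eq A_def dg_0_iff[symmetric] subset_iff)
  then have "ev x = Poly_Mapping.single 0 (lookup (ev x) 0)"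
    by (intro poly_mapping_eqI) (auto simp: lookup_single when_def in_keys_iff)
  with x show "x \<in> carrier Q \<and> (\<exists>c. ev x = Poly_Mapping.single 0 c)" by (auto simp: gr_eq)
qed (auto simp: gr_eq split: if_splits)

lemma gr_0_subfield: "subfield (gr 0) Q"
proof (rule subfieldI)
  have one: "\<one> \<in> gr 0" by (auto simp: gr_eq ev_one)
  have sub: "subring (gr 0) Q"
    using gr_subset one gr_minus gr_add gr_times[of _ 0 _ 0] by (intro subringI) auto
  then show "subcring (gr 0) Q" by (rule subcringI')
  show "Units (Q \<lparr> carrier := gr 0 \<rparr>) = gr 0 - {\<zero>}"
  proof (intro equalityI subsetI)
    fix x assume "x \<in> Units (Q \<lparr> carrier := gr 0 \<rparr>)"
    then obtain y where x: "x \<in> gr 0" and y: "y \<in> gr 0" "y \<otimes> x = \<one>" by (auto simp: Units_def)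
    have "x \<noteq> \<zero>"
    proof
      assume "x = \<zero>"
      then have "\<one> = \<zero>" using y gr_closed by auto
      then have "(1 :: 'a \<Rightarrow>\<^sub>0 'k) = 0" using ev_one by simp
      then show False by simp
    qed
    with x show "x \<in> gr 0 - {\<zero>}" by simp
  next
    fix x assume x: "x \<in> gr 0 - {\<zero>}"
    then obtain c where c: "ev x = Poly_Mapping.single 0 c" and xQ: "x \<in> carrier Q" by (auto simp: gr_0_iff)
    have "ev x \<noteq> 0" using x xQ ev_eqD[of x \<zero>] by auto
    with c have c0: "c \<noteq> 0" by auto
    define y where "y = iv (Poly_Mapping.single 0 (inverse c))"
    have y: "y \<in> gr 0" unfolding y_def by (intro gr_single) auto
    have "y \<otimes> x = \<one>"
      by (rule ev_eqD) (use xQ c c0 y_def in \<open>auto simp: ev_mult ev_one mult_single\<close>)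
    moreover from this have "x \<otimes> y = \<one>" using xQ y gr_closed by (simp add: m_comm)
    ultimately show "x \<in> Units (Q \<lparr> carrier := gr 0 \<rparr>)" using x y by (auto simp: Units_def)
  qed
qed

lemma gr_1_single:
  assumes "h \<in> H" "dg h = 1" obtains e where "e \<in> G" "h = lt e"
proof -
  from assms obtain e where e: "nf h = Y e" by (metis dg_def mon_deg_1E)
  moreover have "e \<in> G" using nf_mons[OF assms(1)] by (simp add: e)
  ultimately show thesis using that val_nf[OF assms(1)] by metis
qed

lemma gr_1_finite_dimension: "finite_dimension (gr 0) (gr 1)"
proof -
  obtain es where es: "set es = G" using finite_list[OF finite_G] by blast
  define Us where "Us = map (\<lambda>e. iv (Poly_Mapping.single (lt e) 1)) es"
  have Us: "set Us \<subseteq> carrier Q" by (auto simp: Us_def es val_H)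
  interpret S: subalgebra "gr 0" "Span (gr 0) Us" Q
    by (rule Span_is_subalgebra[OF gr_0_subfield Us])
  have "gr 1 \<subseteq> Span (gr 0) Us"
  proof
    fix x assume x: "x \<in> gr 1"
    show "x \<in> Span (gr 0) Us"
    proof (rule carrier_induct)
      show "x \<in> carrier Q" using x gr_closed by blast
      show "Span (gr 0) Us \<subseteq> carrier Q" using Us gr_subset by (rule Span_in_carrier[rotated])
      show "\<zero> \<in> Span (gr 0) Us" using S.one_closed by simp
      show "y \<oplus> z \<in> Span (gr 0) Us" if "y \<in> Span (gr 0) Us" "z \<in> Span (gr 0) Us" for y z
        using S.m_closed that by simp
      fix h c assume h: "h \<in> keys (ev x)"
      then have "h \<in> H" "dg h = 1" using x ev_A[of x] by (auto simp: gr_eq A_def)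
      then obtain e where e: "e \<in> G" "h = lt e" by (rule gr_1_single)
      then have "iv (Poly_Mapping.single h 1) \<in> set Us" by (auto simp: Us_def es)
      then have "iv (Poly_Mapping.single h 1) \<in> Span (gr 0) Us"
        using Span_base_incl[OF gr_0_subfield Us] by blast
      moreover have "iv (Poly_Mapping.single 0 c) \<in> gr 0" by (intro gr_single) auto
      ultimately have "iv (Poly_Mapping.single 0 c) \<otimes> iv (Poly_Mapping.single h 1) \<in> Span (gr 0) Us"
        by (intro S.smult_closed)
      moreover have "iv (Poly_Mapping.single 0 c) \<otimes> iv (Poly_Mapping.single h 1) = iv (Poly_Mapping.single h c)"
        using \<open>h \<in> H\<close> by (intro iv_eqI[symmetric]) (auto simp: ev_mult mult_single)
      ultimately show "iv (Poly_Mapping.single h c) \<in> Span (gr 0) Us" by simp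
    qed
  qed
  \<comment> \<open>Here \<open>subalgebra\<close> asks only for an additive subgroup closed under
    scalars, that is, a linear subspace.\<close>
  moreover have "subalgebra (gr 0) (gr 1) Q"
    using gr_times[of _ 0 _ 1] additive_subgroup.a_subgroup[OF gr_additive_subgroup]
    by (auto simp: subalgebra_def subalgebra_axioms_def)
  ultimately show ?thesis
    using subalbegra_incl_imp_finite_dimension[OF gr_0_subfield Span_finite_dimension[OF gr_0_subfield Us]] by blast
qed

lemma generate_gr: "generate_ring Q (gr 0 \<union> gr 1) = carrier Q"
proof
  let ?V = "generate_ring Q (gr 0 \<union> gr 1)"
  show V: "?V \<subseteq> carrier Q"
  proof
    fix x assume "x \<in> ?V"
    then show "x \<in> carrier Q" by induction (auto simp: gr_closed)
  qed
  have mon: "iv (Poly_Mapping.single (val Z) 1) \<in> ?V" if "Z \<in> mons G" for Z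
    using that
  proof (induction "mon_deg Z" arbitrary: Z)
    case 0
    then have "iv (Poly_Mapping.single (val Z) 1) = \<one>" by (auto intro!: iv_eqI simp: ev_one)
    then show ?case by (simp add: generate_ring.one)
  next
    case (Suc i)
    then have "Z \<noteq> 0" by auto
    then obtain e W where e: "e \<in> keys Z" "Z = W + Y e" by (rule monom_nonzero_split)
    then have W: "W \<in> mons G" "e \<in> G" "i = mon_deg W" using Suc by (auto simp: mons_add_iff mon_deg_add)
    then have "iv (Poly_Mapping.single (val W) 1) \<in> ?V" using Suc by blast
    moreover have "iv (Poly_Mapping.single (lt e) 1) \<in> ?V"
      using W by (intro generate_ring.incl UnI2 gr_single) (auto simp: val_H dg_val)
    ultimately have "iv (Poly_Mapping.single (val W) 1) \<otimes> iv (Poly_Mapping.single (lt e) 1) \<in> ?V"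
      by (rule generate_ring.eng_mult)
    moreover have "iv (Poly_Mapping.single (val Z) 1) =
        iv (Poly_Mapping.single (val W) 1) \<otimes> iv (Poly_Mapping.single (lt e) 1)"
      using W by (intro iv_eqI) (auto simp: ev_mult mult_single e(2) val_add val_H)
    ultimately show ?case by simp
  qed
  show "carrier Q \<subseteq> ?V"
  proof
    fix x assume x: "x \<in> carrier Q"
    show "x \<in> ?V"
    proof (rule carrier_induct[OF x V])
      show "\<zero> \<in> ?V" by (rule generate_ring.incl) (auto simp: gr_eq)
      fix h c assume "h \<in> keys (ev x)"
      then have h: "h \<in> H" using ev_A[OF x] by (auto simp: A_def)
      then have "iv (Poly_Mapping.single h 1) \<in> ?V" using mon[of "nf h"] by (simp add: nf_mons val_nf)
      moreover have "iv (Poly_Mapping.single 0 c) \<in> ?V"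
        by (intro generate_ring.incl UnI1 gr_single) auto
      ultimately have "iv (Poly_Mapping.single 0 c) \<otimes> iv (Poly_Mapping.single h 1) \<in> ?V"
        by (rule generate_ring.eng_mult[rotated])
      moreover have "iv (Poly_Mapping.single h c) = iv (Poly_Mapping.single 0 c) \<otimes> iv (Poly_Mapping.single h 1)"
        using h by (intro iv_eqI) (auto simp: ev_mult mult_single)
      ultimately show "iv (Poly_Mapping.single h c) \<in> ?V" by simp
    qed (rule generate_ring.eng_add)
  qed
qed

lemma standard_graded: "standard_graded_algebra Q gr"
  by (intro standard_graded_algebra.intro standard_graded_algebra_axioms.intro cring_axioms
      gr_additive_subgroup gr_times gr_decomposition gr_0_subfield gr_1_finite_dimension generate_gr)

text \<open>Vanishing constant term is an ideal condition because 0 splits in \<open>H\<close> only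
  as 0 + 0. Conversely, every term with nonzero exponent is homogeneous of positive degree.\<close>

lemma irrelevant_ideal_eq: "irrelevant_ideal Q gr = {x \<in> carrier Q. lookup (ev x) 0 = 0}" (is "_ = ?J")
proof
  have "subgroup ?J (add_monoid Q)"
    by (rule add.subgroupI) (auto simp: ev_add lookup_add intro!: exI[of _ \<zero>])
  moreover have "x \<otimes> a \<in> ?J" if "a \<in> ?J" "x \<in> carrier Q" for a x
  proof -
    have "lookup (ev x * ev a) 0 = 0"
    proof (rule ccontr)
      assume "lookup (ev x * ev a) 0 \<noteq> 0"
      then obtain u v where uv: "0 = u + v" "u \<in> keys (ev x)" "v \<in> keys (ev a)"
        unfolding in_keys_iff[symmetric] by (rule keys_mult_E)
      then have "u \<in> H" "v \<in> H" using that ev_A by (auto simp: A_def subset_iff)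
      then have "dg u + dg v = 0" using dg_add[of u v] uv(1) by simp
      then have "v = 0" using \<open>v \<in> H\<close> by (simp add: dg_0_iff)
      with uv that show False by (auto simp: in_keys_iff)
    qed
    with that show ?thesis by (simp add: ev_mult)
  qed
  ultimately have "ideal ?J Q"
    using m_comm by (intro idealI) (auto simp: ring_axioms)
  moreover have "(\<Union>i\<in>{1..}. gr i) \<subseteq> ?J"
  proof
    fix x assume "x \<in> (\<Union>i\<in>{1..}. gr i)"
    then obtain i where i: "i \<ge> 1" "x \<in> carrier Q" "\<forall>h\<in>keys (ev x). dg h = i" by (auto simp: gr_eq)
    then have "0 \<notin> keys (ev x)" by (metis dg_0 not_one_le_zero)
    with i show "x \<in> ?J" by (simp add: in_keys_iff)
  qed
  ultimately show "irrelevant_ideal Q gr \<subseteq> ?J"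
    unfolding irrelevant_ideal_def by (rule genideal_minimal)
  show "?J \<subseteq> irrelevant_ideal Q gr"
  proof
    fix x assume x: "x \<in> ?J"
    have sub: "(\<Union>i\<in>{1..}. gr i) \<subseteq> carrier Q" using gr_subset by blast
    interpret I: ideal "irrelevant_ideal Q gr" Q
      unfolding irrelevant_ideal_def by (rule genideal_ideal[OF sub])
    show "x \<in> irrelevant_ideal Q gr"
    proof (rule carrier_induct)
      show "x \<in> carrier Q" using x by simp
      fix h c assume h: "h \<in> keys (ev x)"
      then have "h \<in> H" "h \<noteq> 0" using x ev_A[of x] by (auto simp: A_def in_keys_iff)
      then have "iv (Poly_Mapping.single h c) \<in> gr (dg h)" "dg h \<ge> 1"
        by (auto intro: gr_single simp: Suc_le_eq dg_0_iff zero_less_iff_neq_zero)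
      then show "iv (Poly_Mapping.single h c) \<in> irrelevant_ideal Q gr"
        using genideal_self[OF sub] unfolding irrelevant_ideal_def by blast
    qed (rule I.a_subset I.zero_closed I.a_closed; assumption?)+
  qed
qed

text \<open>Besides applying \<open>ev\<close>, this turns the extensional vectors of
  \<open>free_module\<close>, undefined beyond \<open>b\<close>, into vectors that vanish
  there.\<close>

definition to_freemod :: "nat \<Rightarrow> (nat \<Rightarrow> 'q) \<Rightarrow> nat \<Rightarrow> 'a \<Rightarrow>\<^sub>0 'k" where
  "to_freemod b v = (\<lambda>p. if p < b then ev (v p) else 0)"

lemma to_freemod_bij: "bij_betw (to_freemod b) (free_module Q b) (freemod b)"
proof (rule bij_betw_byWitness[where f' = "\<lambda>f. \<lambda>p\<in>{..<b}. iv (f p)"])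
  show "\<forall>v\<in>free_module Q b. (\<lambda>p\<in>{..<b}. iv (to_freemod b v p)) = v"
  proof (intro ballI ext)
    fix v p assume v: "v \<in> free_module Q b"
    show "(\<lambda>p\<in>{..<b}. iv (to_freemod b v p)) p = v p"
    proof (cases "p < b")
      case True
      then have "v p \<in> carrier Q" using v by (auto simp: free_module_def)
      from iv_eqI[OF this refl] True show ?thesis by (simp add: to_freemod_def)
    next
      case False
      with PiE_arb[OF v[unfolded free_module_def], of p] show ?thesis by simp
    qed
  qed
  show "\<forall>f\<in>freemod b. to_freemod b (\<lambda>p\<in>{..<b}. iv (f p)) = f"
    by (intro ballI ext) (simp add: to_freemod_def freemod_def)
  show "to_freemod b ` free_module Q b \<subseteq> freemod b"
    by (intro image_subsetI) (auto simp: to_freemod_def freemod_def free_module_def intro!: ev_A)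
  show "(\<lambda>f. \<lambda>p\<in>{..<b}. iv (f p)) ` freemod b \<subseteq> free_module Q b"
    by (intro image_subsetI) (simp add: freemod_def free_module_def)
qed

lemma to_freemod_zero: "to_freemod b (zero_vec Q b) = (\<lambda>_. 0)"
  by (auto simp: to_freemod_def zero_vec_def)

lemma zero_vec_free: "zero_vec Q b \<in> free_module Q b"
  by (auto simp: zero_vec_def free_module_def)

lemma mat_map_free:
  assumes "\<And>p q. p < r \<Longrightarrow> q < c \<Longrightarrow> D p q \<in> carrier Q" "v \<in> free_module Q c"
  shows "mat_map Q r c D v \<in> free_module Q r"
  using assms by (auto simp: mat_map_def free_module_def PiE_iff intro!: finsum_closed)

text \<open>Note the transposition: column \<open>q\<close> of the matrix is \<open>n q\<close>, the
  image of the \<open>q\<close>-th basis vector.\<close>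

lemma to_freemod_mat_map:
  assumes n: "\<And>q. q < c \<Longrightarrow> n q \<in> freemod r" and v: "v \<in> free_module Q c"
  shows "to_freemod r (mat_map Q r c (\<lambda>p q. iv (n q p)) v) = dmap c n (to_freemod c v)"
proof
  fix p
  have vq: "v q \<in> carrier Q" if "q < c" for q using v that by (auto simp: free_module_def)
  show "to_freemod r (mat_map Q r c (\<lambda>p q. iv (n q p)) v) p = dmap c n (to_freemod c v) p"
  proof (cases "p < r")
    case True
    then have "to_freemod r (mat_map Q r c (\<lambda>p q. iv (n q p)) v) p = ev (\<Oplus>q\<in>{..<c}. iv (n q p) \<otimes> v q)"
      by (simp add: to_freemod_def mat_map_def)
    also have "\<dots> = (\<Sum>q<c. ev (iv (n q p) \<otimes> v q))"
      by (intro ev_finsum Pi_I m_closed iv_closed freemod_A[OF n] vq) auto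
    also have "\<dots> = (\<Sum>q<c. ev (v q) * n q p)"
      using vq by (intro sum.cong) (auto simp: ev_mult freemod_A[OF n] mult.commute)
    finally show ?thesis by (simp add: dmap_def to_freemod_def)
  next
    case False
    then have "n q p = 0" if "q < c" for q using n[OF that] by (simp add: freemod_def)
    with False show ?thesis by (simp add: to_freemod_def dmap_def)
  qed
qed

text \<open>Injectivity of \<open>to_freemod\<close> reduces an equality of sets of vectors over
  \<open>Q\<close> to one of their images, so exactness carries over.\<close>

lemma image_mat_map_eqI:
  assumes n: "\<And>q. q < c \<Longrightarrow> n q \<in> freemod r" and S: "S \<subseteq> free_module Q r"
    and eq: "to_freemod r ` S = dmap c n ` freemod c"
  shows "S = mat_map Q r c (\<lambda>p q. iv (n q p)) ` free_module Q c" (is "_ = ?M ` _")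
proof -
  have "to_freemod r ` (?M ` free_module Q c) = dmap c n ` (to_freemod c ` free_module Q c)"
    unfolding image_image by (intro image_cong refl to_freemod_mat_map n)
  also have "\<dots> = to_freemod r ` S" using to_freemod_bij[of c] eq by (simp add: bij_betw_def)
  finally have "to_freemod r ` S = to_freemod r ` (?M ` free_module Q c)" by simp
  moreover have "?M ` free_module Q c \<subseteq> free_module Q r"
    using n freemod_A by (intro image_subsetI mat_map_free iv_closed) auto
  ultimately show ?thesis
    using S to_freemod_bij[of r] inj_on_image_eq_iff[of "to_freemod r" "free_module Q r"] by (auto simp: bij_betw_def)
qed

theorem koszul_toric_model: "koszul Q gr"
proof -
  define J where "J = irrelevant_ideal Q gr"
  have J_eq: "J = {x \<in> carrier Q. lookup (ev x) 0 = 0}" by (simp add: J_def irrelevant_ideal_eq)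
  have sub: "(\<Union>i\<in>{1..}. gr i) \<subseteq> carrier Q" using gr_subset by blast
  interpret J: ideal J Q
    unfolding J_def irrelevant_ideal_def by (rule genideal_ideal[OF sub])
  interpret QJ: cring "Q Quot J" by (rule J.quotient_is_cring[OF is_cring])
  obtain b n where b0: "b 0 = 1"
    and n_freemod: "\<And>i q. q < b (Suc i) \<Longrightarrow> n i q \<in> freemod (b i)"
    and n_dg: "\<And>i q p h. q < b (Suc i) \<Longrightarrow> lookup (n i q p :: 'a \<Rightarrow>\<^sub>0 'k) h \<noteq> 0 \<Longrightarrow> dg h = 1"
    and exact0: "dmap (b 1) (n 0) ` freemod (b 1) = {f \<in> freemod 1. lookup (f 0) 0 = 0}"
    and exact: "\<And>i. dmap (b (Suc (Suc i))) (n (Suc i)) ` freemod (b (Suc (Suc i))) =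
      {f \<in> freemod (b (Suc i)). dmap (b (Suc i)) (n i) f = (\<lambda>_. 0)}"
    using linear_resolution by blast
  define D where "D i = (\<lambda>p q. iv (n i q p))" for i
  define e :: "nat \<Rightarrow> 'q set" where "e = (\<lambda>_. J +> \<one>)"
  let ?M = "quotient_module Q J"
  have aug: "aug_map ?M (b 0) e v = J +> v 0" if "v \<in> free_module Q (b 0)" for v
  proof -
    have v0: "v 0 \<in> carrier Q" using that by (auto simp: free_module_def b0)
    have am: "finsum ?M f S = finsum (Q Quot J) f S" for f and S :: "nat set"
      by (simp add: finsum_def finprod_def quotient_module_def)
    have "aug_map ?M (b 0) e v = finsum (Q Quot J) (\<lambda>q. (J +> v q) \<otimes>\<^bsub>Q Quot J\<^esub> (J +> \<one>)) {..<b 0}"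
      unfolding aug_map_def am by (simp add: quotient_module_def e_def)
    also have "{..<b 0} = {0}" by (auto simp: b0)
    also have "finsum (Q Quot J) (\<lambda>q. (J +> v q) \<otimes>\<^bsub>Q Quot J\<^esub> (J +> \<one>)) {0} = J +> v 0"
    proof -
      have "(J +> v 0) \<otimes>\<^bsub>Q Quot J\<^esub> (J +> \<one>) = J +> v 0"
        using J.rcoset_mult_add[OF v0 one_closed] v0 by (simp add: FactRing_def)
      moreover have "J +> v 0 \<in> carrier (Q Quot J)"
        using v0 by (auto simp: FactRing_def A_RCOSETS_def')
      ultimately show ?thesis by (subst QJ.finsum_insert) auto
    qed
    finally show ?thesis .
  qed
  have "graded_free_resolution Q gr ?M (\<lambda>i. (\<lambda>a. J +> a) ` gr i) b (\<lambda>i _. i) D e"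
    unfolding graded_free_resolution_def
  proof (intro conjI allI impI)
    show "e q \<in> (+>) J ` gr 0" for q
      by (auto simp: e_def gr_eq ev_one)
    show "D i p q \<in> (if i \<le> Suc i then gr (Suc i - i) else {\<zero>})" if "p < b i" "q < b (Suc i)" for i p q
      using n_dg[OF that(2)] freemod_A[OF n_freemod[OF that(2)]] by (auto simp: D_def gr_eq in_keys_iff)
    show "aug_map ?M (b 0) e ` free_module Q (b 0) = carrier ?M"
    proof -
      have "aug_map ?M (b 0) e ` free_module Q (b 0) = (\<lambda>v. J +> v 0) ` free_module Q (b 0)"
        by (intro image_cong refl aug)
      also have "\<dots> = (\<lambda>a. J +> a) ` ((\<lambda>v. v 0) ` free_module Q (b 0))" by (simp add: image_image)
      also have "(\<lambda>v. v 0) ` free_module Q (b 0) = carrier Q"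
      proof
        show "carrier Q \<subseteq> (\<lambda>v. v 0) ` free_module Q (b 0)"
        proof
          fix x assume "x \<in> carrier Q"
          then show "x \<in> (\<lambda>v. v 0) ` free_module Q (b 0)"
            by (intro image_eqI[of _ _ "\<lambda>p\<in>{..<1}. x"]) (simp_all add: free_module_def b0)
        qed
      qed (auto simp: free_module_def b0)
      finally show ?thesis by (auto simp: quotient_module_def FactRing_def A_RCOSETS_def')
    qed
    have ker: "{v \<in> free_module Q (b 0). aug_map ?M (b 0) e v = \<zero>\<^bsub>?M\<^esub>} = {v \<in> free_module Q (b 0). v 0 \<in> J}"
    proof (intro Collect_cong conj_cong refl)
      fix v assume v: "v \<in> free_module Q (b 0)"
      then have v0: "v 0 \<in> carrier Q" by (auto simp: free_module_def b0)
      show "(aug_map ?M (b 0) e v = \<zero>\<^bsub>?M\<^esub>) = (v 0 \<in> J)"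
        unfolding aug[OF v] using J.rcos_const_imp_mem[OF v0]
        by (auto simp: quotient_module_def FactRing_def a_rcos_zero[OF J.ideal_axioms])
    qed
    show "{v \<in> free_module Q (b 0). aug_map ?M (b 0) e v = \<zero>\<^bsub>?M\<^esub>} =
        mat_map Q (b 0) (b 1) (D 0) ` free_module Q (b 1)"
      unfolding ker D_def
    proof (rule image_mat_map_eqI)
      have "to_freemod (b 0) ` {v \<in> free_module Q (b 0). v 0 \<in> J} =
          {f \<in> to_freemod (b 0) ` free_module Q (b 0). lookup (f 0) 0 = 0}"
      proof -
        have "v 0 \<in> J \<longleftrightarrow> lookup (to_freemod (b 0) v 0) 0 = 0" if "v \<in> free_module Q (b 0)" for v
        proof -
          have "v 0 \<in> carrier Q" using that by (auto simp: free_module_def b0)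
          then show ?thesis
            unfolding J_eq to_freemod_def b0 mem_Collect_eq by (simp only: if_True zero_less_one simp_thms)
        qed
        then show ?thesis by blast
      qed
      then show "to_freemod (b 0) ` {v \<in> free_module Q (b 0). v 0 \<in> J} = dmap (b 1) (n 0) ` freemod (b 1)"
        using to_freemod_bij[of "b 0"] exact0 b0 by (simp add: bij_betw_def)
    qed (use n_freemod in auto)
    fix i
    show "{v \<in> free_module Q (b (Suc i)). mat_map Q (b i) (b (Suc i)) (D i) v = zero_vec Q (b i)} =
        mat_map Q (b (Suc i)) (b (Suc (Suc i))) (D (Suc i)) ` free_module Q (b (Suc (Suc i)))"
      unfolding D_def
    proof (rule image_mat_map_eqI)
      let ?D = "\<lambda>p q. iv (n i q p)"
      have iff: "mat_map Q (b i) (b (Suc i)) ?D v = zero_vec Q (b i) \<longleftrightarrow>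
          dmap (b (Suc i)) (n i) (to_freemod (b (Suc i)) v) = (\<lambda>_. 0)" if v: "v \<in> free_module Q (b (Suc i))" for v
      proof -
        have "mat_map Q (b i) (b (Suc i)) ?D v \<in> free_module Q (b i)"
          by (intro mat_map_free iv_closed freemod_A[OF n_freemod] v)
        then have "mat_map Q (b i) (b (Suc i)) ?D v = zero_vec Q (b i) \<longleftrightarrow>
            to_freemod (b i) (mat_map Q (b i) (b (Suc i)) ?D v) = to_freemod (b i) (zero_vec Q (b i))"
          using to_freemod_bij[of "b i"] zero_vec_free by (auto simp: bij_betw_def inj_on_def)
        then show ?thesis using to_freemod_mat_map[OF n_freemod v] by (simp add: to_freemod_zero)
      qed
      have "to_freemod (b (Suc i)) ` {v \<in> free_module Q (b (Suc i)). mat_map Q (b i) (b (Suc i)) ?D v = zero_vec Q (b i)} =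
          {f \<in> to_freemod (b (Suc i)) ` free_module Q (b (Suc i)). dmap (b (Suc i)) (n i) f = (\<lambda>_. 0)}"
        using iff by blast
      then show "to_freemod (b (Suc i)) ` {v \<in> free_module Q (b (Suc i)). mat_map Q (b i) (b (Suc i)) ?D v = zero_vec Q (b i)} =
          dmap (b (Suc (Suc i))) (n (Suc i)) ` freemod (b (Suc (Suc i)))"
        using to_freemod_bij[of "b (Suc i)"] exact[of i] by (simp add: bij_betw_def)
    qed (use n_freemod in auto)
  qed
  then show ?thesis
    unfolding koszul_def Let_def J_def[symmetric]
    by (intro conjI standard_graded exI[of _ b] exI[of _ "\<lambda>i _. i"] exI[of _ D] exI[of _ e]) auto
qed

end

section \<open>Toric rings\<close>

text \<open>The multiple of \<open>w\<close> by its exponent is a repeated sum, which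
  \<open>mon\<close> turns directly into the power occurring in \<open>toric_map\<close>.\<close>

definition monval :: "nat monom monom \<Rightarrow> nat monom" where
  "monval Z = (\<Sum>w\<in>keys Z. \<Sum>i<lookup Z w. w)"

lemma lookup_monval: "lookup (monval Z) x = (\<Sum>w\<in>keys Z. lookup Z w * lookup w x)"
  unfolding monval_def lookup_sum by simp

lemma lookup_monval_superset:
  "finite S \<Longrightarrow> keys Z \<subseteq> S \<Longrightarrow> lookup (monval Z) x = (\<Sum>w\<in>S. lookup Z w * lookup w x)"
  unfolding lookup_monval by (rule sum.mono_neutral_left) (auto simp: in_keys_iff)

lemma monval_add: "monval (Z + Z') = monval Z + monval Z'"
proof (rule poly_mapping_eqI)
  fix x
  show "lookup (monval (Z + Z')) x = lookup (monval Z + monval Z') x"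
    by (simp add: lookup_add lookup_monval_superset[of "keys Z \<union> keys Z'"] keys_add_monom
        distrib_right sum.distrib)
qed

lemma monval_single [simp]: "monval (Poly_Mapping.single w (Suc 0)) = w"
  by (simp add: monval_def)

lemma monval_0 [simp]: "monval 0 = 0"
  by (simp add: monval_def)

lemma monval_mons:
  assumes "U \<subseteq> mons X" "Z \<in> mons U" shows "monval Z \<in> mons X"
proof -
  have "keys (monval Z) \<subseteq> (\<Union>w\<in>keys Z. keys w)"
    by (auto simp: in_keys_iff lookup_monval)
  moreover have "keys w \<subseteq> X" if "w \<in> keys Z" for w using assms that by (auto simp: mons_def)
  ultimately show ?thesis by (auto simp: mons_def)
qed

lemma mon_deg_monval:
  assumes "\<And>w. w \<in> U \<Longrightarrow> mon_deg w = d" "Z \<in> mons U"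
  shows "mon_deg (monval Z) = d * mon_deg Z"
  using assms(2)
proof (induction "mon_deg Z" arbitrary: Z)
  case (Suc i)
  then have "Z \<noteq> 0" by auto
  then obtain e W where e: "e \<in> keys Z" "Z = W + Y e" by (rule monom_nonzero_split)
  then have W: "W \<in> mons U" "e \<in> U" "i = mon_deg W" using Suc by (auto simp: mons_add_iff mon_deg_add)
  with Suc(1)[of W] assms(1) show ?case by (simp add: e monval_add mon_deg_add)
qed simp

lemma mon_add: "mon (u + v) = (mon u * mon v :: ('a, 'k::field) mpoly)"
  by (simp add: mon_def mult_single)

lemma mon_zero [simp]: "mon 0 = 1"
  by (simp add: mon_def)

lemma mon_sum: "mon (\<Sum>i\<in>S. f i) = (\<Prod>i\<in>S. mon (f i) :: ('a, 'k::field) mpoly)"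
  by (induction S rule: infinite_finite_induct) (auto simp: mon_add)

lemma keys_mon [simp]: "keys (mon m :: ('a, 'k::field) mpoly) = {m}"
  by (simp add: mon_def)

lemma mon_monval: "(\<Prod>w\<in>keys m. mon w ^ lookup m w) = (mon (monval m) :: (nat, 'k::field) mpoly)"
  unfolding monval_def mon_sum by simp

lemma toric_map_eq: "toric_map f = (\<Sum>m\<in>keys f. Poly_Mapping.single (monval m) (lookup f m))"
  unfolding toric_map_def mon_monval by (simp add: mon_def mult_single)

lemma toric_map_superset:
  "finite S \<Longrightarrow> keys f \<subseteq> S \<Longrightarrow> toric_map f = (\<Sum>m\<in>S. Poly_Mapping.single (monval m) (lookup f m))"
  unfolding toric_map_eq by (rule sum.mono_neutral_left) (auto simp: in_keys_iff)

lemma toric_map_add: "toric_map (f + g) = toric_map f + toric_map g"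
  using Poly_Mapping.keys_add[of f g]
  by (simp add: toric_map_superset[of "keys f \<union> keys g"] lookup_add single_add sum.distrib)

lemma toric_map_0 [simp]: "toric_map 0 = 0"
  by (simp add: toric_map_eq)

lemma toric_map_sum: "toric_map (\<Sum>i\<in>S. f i) = (\<Sum>i\<in>S. toric_map (f i))"
  by (induction S rule: infinite_finite_induct) (auto simp: toric_map_add)

lemma toric_map_single [simp]: "toric_map (Poly_Mapping.single m c) = Poly_Mapping.single (monval m) c"
  by (simp add: toric_map_eq)

lemma toric_map_mult: "toric_map (f * g) = toric_map f * toric_map g"
proof -
  have "f * g = (\<Sum>m\<in>keys f. \<Sum>m'\<in>keys g. Poly_Mapping.single (m + m') (lookup f m * lookup g m'))"
    by (subst (1) poly_sum_singles[of f, symmetric], subst (1) poly_sum_singles[of g, symmetric])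
      (simp add: sum_product mult_single)
  then have "toric_map (f * g) = (\<Sum>m\<in>keys f. \<Sum>m'\<in>keys g.
      Poly_Mapping.single (monval m) (lookup f m) * Poly_Mapping.single (monval m') (lookup g m'))"
    by (simp add: toric_map_sum monval_add mult_single)
  then show ?thesis by (simp add: toric_map_eq sum_product)
qed

lemma toric_map_diff: "toric_map (f - g) = toric_map f - toric_map g"
  using toric_map_add[of "f - g" g] by simp

text \<open>Coefficients are collected fibre by fibre, so an element of the kernel must cancel
  within each fibre separately.\<close>

lemma lookup_toric_map: "lookup (toric_map f) h = (\<Sum>m\<in>{m \<in> keys f. monval m = h}. lookup f m)"
proof -
  have "lookup (toric_map f) h = (\<Sum>m\<in>keys f. if monval m = h then lookup f m else 0)"
    by (simp add: toric_map_eq lookup_sum lookup_single when_def)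
  then show ?thesis by (simp add: sum.inter_filter)
qed

lemma keys_toric_map: "keys (toric_map f) \<subseteq> monval ` keys f"
  using lookup_toric_map[of f] by (fastforce simp: in_keys_iff intro: sum.neutral)

lemma poly_ring_simps [simp]:
  "carrier (poly_ring X) = {f. keys f \<subseteq> mons X}" "\<one>\<^bsub>poly_ring X\<^esub> = 1" "\<zero>\<^bsub>poly_ring X\<^esub> = 0"
  "f \<otimes>\<^bsub>poly_ring X\<^esub> g = f * g" "f \<oplus>\<^bsub>poly_ring X\<^esub> g = f + g"
  by (simp_all add: poly_ring_def)

lemma keys_uminus: "keys (- f :: 'a \<Rightarrow>\<^sub>0 'k::ab_group_add) = keys f"
  by (auto simp: in_keys_iff)

lemma poly_ring_cring: "cring (poly_ring X :: ('a, 'k::field) mpoly ring)"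
proof (rule cringI)
  show "abelian_group (poly_ring X :: ('a, 'k) mpoly ring)"
  proof (rule abelian_groupI)
    fix f :: "('a, 'k) mpoly" assume "f \<in> carrier (poly_ring X)"
    then show "\<exists>g\<in>carrier (poly_ring X). g \<oplus>\<^bsub>poly_ring X\<^esub> f = \<zero>\<^bsub>poly_ring X\<^esub>"
      by (intro bexI[of _ "- f"]) (auto simp: keys_uminus)
  next
    fix f g :: "('a, 'k) mpoly" assume "f \<in> carrier (poly_ring X)" "g \<in> carrier (poly_ring X)"
    then show "f \<oplus>\<^bsub>poly_ring X\<^esub> g \<in> carrier (poly_ring X)"
      using Poly_Mapping.keys_add[of f g] by auto
  qed (simp_all add: ac_simps)
  show "comm_monoid (poly_ring X :: ('a, 'k) mpoly ring)"
  proof (rule comm_monoidI)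
    fix f g :: "('a, 'k) mpoly" assume fg: "f \<in> carrier (poly_ring X)" "g \<in> carrier (poly_ring X)"
    have "k \<in> mons X" if k: "k \<in> keys (f * g)" for k
    proof -
      from k obtain u v where "k = u + v" "u \<in> keys f" "v \<in> keys g" by (rule keys_mult_E)
      with fg show ?thesis by (auto simp: mons_add_iff)
    qed
    then show "f \<otimes>\<^bsub>poly_ring X\<^esub> g \<in> carrier (poly_ring X)" by auto
  qed (auto simp: ac_simps)
qed (simp add: distrib_right)

locale toric_setup = toric_quadratic U monval rk for U :: "nat monom set" and rk :: "nat monom monom \<Rightarrow> nat" +
  fixes n :: nat and I :: "(nat, 'k::field) mpoly set"
  assumes gens_eq: "gens I = U" and U_mons: "U \<subseteq> mons {1..n}"
begin

abbreviation "S \<equiv> toric_poly_ring I"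
abbreviation "T \<equiv> toric_ideal n I"

lemma S_eq: "S = poly_ring U"
  by (simp add: toric_poly_ring_def gens_eq)

lemma toric_map_hom: "ring_hom_ring S (poly_ring {1..n}) (toric_map :: _ \<Rightarrow> (nat, 'k) mpoly)"
proof (rule ring_hom_ringI)
  show "ring S" "ring (poly_ring {1..n} :: (nat, 'k) mpoly ring)"
    unfolding S_eq by (rule cring.axioms, rule poly_ring_cring)+
  show "toric_map f \<in> carrier (poly_ring {1..n})" if f: "f \<in> carrier S" for f :: "(nat monom, 'k) mpoly"
  proof -
    have "monval ` keys f \<subseteq> mons {1..n}" using f monval_mons[OF U_mons] by (auto simp: S_eq)
    with keys_toric_map[of f] show ?thesis by simp
  qed
qed (simp_all add: S_eq toric_map_add toric_map_mult toric_map_eq[of 1])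

lemma T_eq: "T = {f. keys f \<subseteq> mons U \<and> toric_map f = 0}"
  unfolding toric_ideal_def a_kernel_def' S_eq poly_ring_simps by simp

lemma T_ideal: "ideal T S"
  unfolding toric_ideal_def by (rule ring_hom_ring.kernel_is_ideal[OF toric_map_hom])

definition "ev X = the_elem (toric_map ` X)" for X :: "(nat monom, 'k) mpoly set"

lemma ev_iso: "ev \<in> ring_iso (toric_ring n I) (poly_ring {1..n} \<lparr> carrier := toric_map ` carrier S \<rparr>)"
  unfolding toric_ring_def toric_ideal_def ev_def[abs_def] by (rule ring_hom_ring.FactRing_iso_set_aux[OF toric_map_hom])

lemma toric_ring_carrier: "carrier (toric_ring n I) = (\<lambda>f. T +>\<^bsub>S\<^esub> f) ` carrier S"
  by (auto simp: toric_ring_def FactRing_def A_RCOSETS_def')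

lemma ev_coset: "f \<in> carrier S \<Longrightarrow> ev (T +>\<^bsub>S\<^esub> f) = toric_map f"
  unfolding ev_def toric_ideal_def by (rule ring_hom_ring.the_elem_simp[OF toric_map_hom])

text \<open>The linear extension of \<open>nf\<close> is a section of the toric map over
  \<open>A\<close>.\<close>

lemma toric_map_image: "toric_map ` carrier S = (A :: (nat, 'k) mpoly set)"
proof (intro equalityI subsetI)
  fix f :: "(nat, 'k) mpoly" assume "f \<in> toric_map ` carrier S"
  then show "f \<in> A" using keys_toric_map by (fastforce simp: S_eq A_def H_def)
next
  fix f :: "(nat, 'k) mpoly" assume f: "f \<in> A"
  have "f = toric_map (\<Sum>h\<in>keys f. Poly_Mapping.single (nf h) (lookup f h))"
    using f by (simp add: toric_map_sum A_def subset_iff val_nf poly_sum_singles)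
  moreover have "keys (\<Sum>h\<in>keys f. Poly_Mapping.single (nf h) (lookup f h)) \<subseteq> mons U"
    using f nf_mons by (intro order_trans[OF keys_sum]) (auto simp: A_def split: if_splits)
  ultimately show "f \<in> toric_map ` carrier S" by (auto simp: S_eq)
qed

text \<open>Fibres are homogeneous, so the degree of a coset can be read off its image under
  \<open>ev\<close>; conversely, the normal forms of the occurring exponents give a homogeneous
  representative.\<close>

lemma toric_grading_eq:
  "toric_grading n I i = {X \<in> carrier (toric_ring n I). \<forall>h\<in>keys (ev X). dg h = i}"
proof (intro equalityI subsetI)
  fix X assume "X \<in> toric_grading n I i"
  then obtain f where f: "f \<in> carrier S" "homogeneous i f" and X: "X = T +>\<^bsub>S\<^esub> f"
    by (auto simp: toric_grading_def)
  have "dg h = i" if "h \<in> keys (toric_map f)" for h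
    using that keys_toric_map[of f] f by (auto simp: S_eq homogeneous_def dg_val subset_iff)
  with f X show "X \<in> {X \<in> carrier (toric_ring n I). \<forall>h\<in>keys (ev X). dg h = i}"
    by (auto simp: toric_ring_carrier ev_coset)
next
  fix X assume X: "X \<in> {X \<in> carrier (toric_ring n I). \<forall>h\<in>keys (ev X). dg h = i}"
  define f where "f = (\<Sum>h\<in>keys (ev X). Poly_Mapping.single (nf h) (lookup (ev X) h))"
  have XH: "keys (ev X) \<subseteq> H"
    using X ev_iso toric_map_image by (auto simp: ring_iso_def ring_hom_def A_def Pi_iff)
  have kf: "keys f \<subseteq> nf ` keys (ev X)"
    unfolding f_def by (intro order_trans[OF keys_sum]) (auto split: if_splits)
  have fS: "f \<in> carrier S" using kf XH nf_mons by (auto simp: S_eq)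
  have "toric_map f = ev X"
    using XH by (simp add: f_def toric_map_sum subset_iff val_nf poly_sum_singles)
  then have "ev (T +>\<^bsub>S\<^esub> f) = ev X" by (simp add: ev_coset fS)
  then have "X = T +>\<^bsub>S\<^esub> f"
    using ev_iso X fS by (intro inj_onD[of ev "carrier (toric_ring n I)"])
      (auto simp: ring_iso_def bij_betw_def toric_ring_carrier)
  moreover have "homogeneous i f" using kf X by (auto simp: homogeneous_def dg_def)
  ultimately show "X \<in> toric_grading n I i" using fS by (auto simp: toric_grading_def)
qed

lemma toric_ring_koszul: "koszul (toric_ring n I) (toric_grading n I)"
proof -
  have cr: "cring (toric_ring n I)"
    unfolding toric_ring_def by (rule ideal.quotient_is_cring[OF T_ideal]) (simp add: S_eq poly_ring_cring)
  interpret Q: cring "toric_ring n I" by (rule cr)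
  interpret toric_model U monval rk "toric_ring n I" ev "toric_grading n I"
    by unfold_locales (use ev_iso toric_map_image toric_grading_eq in
      \<open>auto simp: ring_iso_def ring_hom_def bij_betw_def\<close>)
  show ?thesis by (rule koszul_toric_model)
qed

end

section \<open>Groebner bases\<close>

context toric_setup
begin

lemma lead_mon_eqI:
  assumes gt: "\<And>Z Z'. Z \<in> mons U \<Longrightarrow> Z' \<in> mons U \<Longrightarrow> gt Z Z' \<longleftrightarrow> rk Z' < rk Z"
    and f: "keys (f :: (nat monom, 'k) mpoly) \<subseteq> mons U" and m: "m \<in> keys f"
    and max: "\<And>m'. m' \<in> keys f \<Longrightarrow> rk m' \<le> rk m"
  shows "lead_mon gt f = m"
  unfolding lead_mon_def
proof (rule the_equality)
  have "gt m m'" if "m' \<in> keys f" "m' \<noteq> m" for m'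
  proof -
    have U: "m \<in> mons U" "m' \<in> mons U" using f m that by auto
    moreover have "rk m' \<noteq> rk m" using rk_eqD[OF U] that by auto
    ultimately show ?thesis using gt max[OF that(1)] by simp
  qed
  with m show "m \<in> keys f \<and> (\<forall>m'\<in>keys f. m' \<noteq> m \<longrightarrow> gt m m')" by blast
next
  fix m2 assume "m2 \<in> keys f \<and> (\<forall>m'\<in>keys f. m' \<noteq> m2 \<longrightarrow> gt m2 m')"
  then show "m2 = m" using max[of m2] gt[of m2 m] f m by (metis not_less subsetD)
qed

text \<open>The basis consists of the binomials of two quadratic monomials in one fibre. A leading
  monomial of an element of \<open>T\<close> is never standard: being smallest in its fibre and
  largest in the support, it would be alone there and its coefficient would survive. So
  \<open>quad\<close> finds a nonstandard pair in it, and that pair leads one of the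
  binomials.\<close>

lemma quadratic_groebner_basis:
  assumes gt: "\<And>Z Z'. Z \<in> mons U \<Longrightarrow> Z' \<in> mons U \<Longrightarrow> gt Z Z' \<longleftrightarrow> rk Z' < rk Z"
  shows "\<exists>B. groebner_basis S gt T B \<and> (\<forall>g\<in>B. homogeneous 2 g)"
proof -
  define Z2 where "Z2 = {Z \<in> mons U. mon_deg Z = 2}"
  define X where "X = {(Z, Z'). Z \<in> Z2 \<and> Z' \<in> Z2 \<and> monval Z = monval Z' \<and> rk Z' < rk Z}"
  define bin :: "nat monom monom \<times> nat monom monom \<Rightarrow> (nat monom, 'k) mpoly"
    where "bin = (\<lambda>(Z, Z'). mon Z - mon Z')"
  define lm :: "(nat monom, 'k) mpoly \<Rightarrow> (nat monom, 'k) mpoly"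
    where "lm = (\<lambda>f. mon (lead_mon gt f))"
  have ring: "ring S" using toric_map_hom by (simp add: ring_hom_ring_def)
  have fin: "finite (bin ` X)"
    by (rule finite_imageI, rule finite_subset[of _ "Z2 \<times> Z2"])
      (auto simp: X_def Z2_def finite_mons_deg finite_G)
  have keys_bin: "keys (bin (Z, Z')) = {Z, Z'}" if "Z \<noteq> Z'" for Z Z'
    using that by (auto simp: bin_def mon_def in_keys_iff lookup_minus lookup_single when_def split: if_splits)
  have X: "Z \<in> mons U \<and> Z' \<in> mons U \<and> Z \<noteq> Z'" if "(Z, Z') \<in> X" for Z Z'
    using that by (auto simp: X_def Z2_def)
  have bin_T: "bin ` X \<subseteq> T - {0}"
  proof
    fix f assume "f \<in> bin ` X"
    then obtain Z Z' where f: "f = bin (Z, Z')" and ZX: "(Z, Z') \<in> X" by auto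
    have k: "keys f = {Z, Z'}" using keys_bin X[OF ZX] by (simp add: f)
    have "toric_map f = 0"
      using ZX by (simp add: f bin_def X_def toric_map_diff mon_def)
    moreover have "f \<noteq> 0" using k by auto
    ultimately show "f \<in> T - {0}" using k X[OF ZX] by (simp add: T_eq)
  qed
  have lm_bin: "lm (bin (Z, Z')) = mon Z" if "(Z, Z') \<in> X" for Z Z'
  proof -
    have k: "keys (bin (Z, Z')) = {Z, Z'}" using keys_bin X[OF that] by blast
    have "lead_mon gt (bin (Z, Z')) = Z"
      by (rule lead_mon_eqI[OF gt]) (use X[OF that] that k in \<open>auto simp: X_def\<close>)
    then show ?thesis by (simp add: lm_def)
  qed
  have lm_lead: "\<exists>m\<in>keys f. lm f = mon m \<and> (\<forall>m'\<in>keys f. rk m' \<le> rk m)" if f: "f \<in> T - {0}" for f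
  proof -
    have fin: "finite (rk ` keys f)" and ne: "rk ` keys f \<noteq> {}" using f by auto
    from Max_in[OF this] obtain m where m: "m \<in> keys f" "rk m = Max (rk ` keys f)" by auto
    then have "\<forall>m'\<in>keys f. rk m' \<le> rk m" using fin by auto
    moreover from this have "lead_mon gt f = m"
      using f m by (intro lead_mon_eqI[OF gt]) (auto simp: T_eq)
    ultimately show ?thesis using m by (auto simp: lm_def)
  qed
  have carr: "lm ` (T - {0}) \<subseteq> carrier S"
    using lm_lead by (force simp: T_eq S_eq)
  let ?I1 = "Idl\<^bsub>S\<^esub> (lm ` bin ` X)"
  have carr1: "lm ` bin ` X \<subseteq> carrier S" using bin_T carr by blast
  have I1: "ideal ?I1 S" by (rule ring.genideal_ideal[OF ring carr1])
  have I2: "ideal (Idl\<^bsub>S\<^esub> (lm ` (T - {0}))) S" by (rule ring.genideal_ideal[OF ring carr])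
  have "Idl\<^bsub>S\<^esub> (lm ` bin ` X) = Idl\<^bsub>S\<^esub> (lm ` (T - {0}))"
  proof
    show "?I1 \<subseteq> Idl\<^bsub>S\<^esub> (lm ` (T - {0}))"
      by (rule ring.genideal_minimal[OF ring I2]) (use ring.genideal_self[OF ring carr] bin_T in blast)
    show "Idl\<^bsub>S\<^esub> (lm ` (T - {0})) \<subseteq> ?I1"
    proof (rule ring.genideal_minimal[OF ring I1], rule image_subsetI)
      fix f assume f: "f \<in> T - {0}"
      then obtain m where m: "m \<in> keys f" "lm f = mon m" and max: "\<forall>m'\<in>keys f. rk m' \<le> rk m"
        using lm_lead by blast
      have fU: "keys f \<subseteq> mons U" using f by (simp add: T_eq)
      have "\<not> std m"
      proof
        assume s: "std m"
        have "{m' \<in> keys f. monval m' = monval m} = {m}"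
        proof (intro equalityI subsetI)
          fix m' assume m': "m' \<in> {m' \<in> keys f. monval m' = monval m}"
          then have "rk m \<le> rk m'" using s fU by (auto simp: min_fiber_def)
          with m' max have "rk m = rk m'" by (simp add: le_antisym)
          with m' m fU show "m' \<in> {m}" using rk_eqD[of m m'] by auto
        qed (use m in auto)
        then have "lookup (toric_map f) (monval m) = lookup f m" by (simp add: lookup_toric_map)
        with f m show False by (auto simp: T_eq in_keys_iff)
      qed
      moreover have mU: "m \<in> mons U" using m fU by blast
      ultimately obtain a b W where W: "m = W + (Y a + Y b)" and ns: "\<not> std (Y a + Y b)"
        using quad by blast
      let ?Z = "Y a + Y b"
      have Z: "?Z \<in> mons U" "W \<in> mons U" using mU by (simp_all add: W mons_add_iff)
      with ns obtain Z' where Z': "Z' \<in> mons U" "monval Z' = monval ?Z" "rk Z' < rk ?Z"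
        by (auto simp: min_fiber_def not_le)
      then have inX: "(?Z, Z') \<in> X"
        using val_deg[OF Z'(1) Z(1)] Z by (auto simp: X_def Z2_def mon_deg_add)
      have "lm (bin (?Z, Z')) \<in> lm ` bin ` X" by (intro imageI inX)
      then have "mon ?Z \<in> ?I1"
        unfolding lm_bin[OF inX] by (rule subsetD[OF ring.genideal_self[OF ring carr1]])
      then have "mon W \<otimes>\<^bsub>S\<^esub> mon ?Z \<in> ?I1"
        using Z by (intro ideal.I_l_closed[OF I1]) (auto simp: S_eq)
      then show "lm f \<in> ?I1" by (simp add: m W mon_add S_eq)
    qed
  qed
  then have "groebner_basis S gt T (bin ` X)"
    using fin bin_T by (simp add: groebner_basis_def lm_def)
  moreover have "\<forall>g\<in>bin ` X. homogeneous 2 g"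
  proof
    fix g assume "g \<in> bin ` X"
    then obtain Z Z' where g: "g = bin (Z, Z')" "(Z, Z') \<in> X" by auto
    have "keys g = {Z, Z'}" unfolding g(1) using X[OF g(2)] by (intro keys_bin) blast
    moreover have "mon_deg Z = 2" "mon_deg Z' = 2" using g(2) by (simp_all add: X_def Z2_def)
    ultimately show "homogeneous 2 g" by (simp add: homogeneous_def)
  qed
  ultimately show ?thesis by blast
qed

end

section \<open>Reverse lexicographic orders\<close>

lemma last_element:
  assumes "finite X" "X \<noteq> {}"
    and trans: "\<And>u v w. u \<in> X \<Longrightarrow> v \<in> X \<Longrightarrow> w \<in> X \<Longrightarrow> before u v \<Longrightarrow> before v w \<Longrightarrow> before u w"
    and total: "\<And>u v. u \<in> X \<Longrightarrow> v \<in> X \<Longrightarrow> u = v \<or> before u v \<or> before v u"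
  shows "\<exists>w\<in>X. \<forall>v\<in>X. v = w \<or> before v w"
  using assms
proof (induction X rule: finite_ne_induct)
  case (insert x F)
  have "\<exists>w\<in>F. \<forall>v\<in>F. v = w \<or> before v w"
    using insert.prems by (intro insert.IH) blast+
  then obtain w where w: "w \<in> F" "\<And>v. v \<in> F \<Longrightarrow> v = w \<or> before v w" by blast
  have "x = w \<or> before x w \<or> before w x" using insert.prems(2) w by blast
  then show ?case
  proof (elim disjE)
    assume "before w x"
    then have "\<forall>v\<in>insert x F. v = x \<or> before v x" using w insert.prems(1) by (metis insert_iff)
    then show ?thesis by blast
  qed (use w in blast)+
qed simp

locale finite_variable_order =
  fixes X :: "'a set" and before :: "'a \<Rightarrow> 'a \<Rightarrow> bool"
  assumes finite_X: "finite X"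
    and before_irrefl: "u \<in> X \<Longrightarrow> \<not> before u u"
    and before_trans: "u \<in> X \<Longrightarrow> v \<in> X \<Longrightarrow> w \<in> X \<Longrightarrow> before u v \<Longrightarrow> before v w \<Longrightarrow> before u w"
    and before_total: "u \<in> X \<Longrightarrow> v \<in> X \<Longrightarrow> u = v \<or> before u v \<or> before v u"
begin

abbreviation "gr \<equiv> grevlex X before"

lemma exists_last:
  assumes "D \<subseteq> X" "D \<noteq> {}" shows "\<exists>w\<in>D. \<forall>v\<in>D. v = w \<or> before v w"
proof (rule last_element[OF finite_subset[OF assms(1) finite_X] assms(2)])
  show "before u w" if "u \<in> D" "v \<in> D" "w \<in> D" "before u v" "before v w" for u v w
    using before_trans[of u v w] that assms(1) by auto
  show "u = v \<or> before u v \<or> before v u" if "u \<in> D" "v \<in> D" for u v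
    using before_total[of u v] that assms(1) by auto
qed

lemma before_asym: "u \<in> X \<Longrightarrow> v \<in> X \<Longrightarrow> before u v \<Longrightarrow> \<not> before v u"
  using before_trans before_irrefl by blast

lemma gr_total:
  assumes "Z \<in> mons X" "Z' \<in> mons X" "Z \<noteq> Z'"
  shows "gr Z Z' \<or> gr Z' Z"
proof (cases "mon_deg Z = mon_deg Z'")
  case True
  let ?D = "{w \<in> X. lookup Z w \<noteq> lookup Z' w}"
  have "?D \<noteq> {}"
  proof
    assume "?D = {}"
    moreover have "lookup Z w = 0" "lookup Z' w = 0" if "w \<notin> X" for w
      using assms that by (auto simp: mons_def simp flip: not_in_keys_iff_lookup_eq_zero)
    ultimately have "lookup Z w = lookup Z' w" for w by (cases "w \<in> X") auto
    with assms show False by (auto intro: poly_mapping_eqI)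
  qed
  from exists_last[OF _ this] obtain w where w: "w \<in> ?D" "\<forall>v\<in>?D. v = w \<or> before v w" by auto
  have "lookup Z v = lookup Z' v" if v: "v \<in> X" "before w v" for v
  proof (rule ccontr)
    assume "lookup Z v \<noteq> lookup Z' v"
    with v w have "v = w \<or> before v w" by auto
    with v w before_asym[of w v] before_irrefl[of w] show False by auto
  qed
  moreover from w have "lookup Z w < lookup Z' w \<or> lookup Z' w < lookup Z w" and "w \<in> X" by auto
  ultimately have "(lookup Z w < lookup Z' w \<and> (\<forall>v\<in>X. before w v \<longrightarrow> lookup Z v = lookup Z' v)) \<or>
      (lookup Z' w < lookup Z w \<and> (\<forall>v\<in>X. before w v \<longrightarrow> lookup Z' v = lookup Z v))" by auto
  then show ?thesis using True \<open>w \<in> X\<close> by (auto simp: grevlex_def)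
qed (auto simp: grevlex_def)

lemma gr_irrefl: "\<not> gr Z Z"
  by (auto simp: grevlex_def)

lemma gr_trans:
  assumes "gr Z1 Z2" "gr Z2 Z3" shows "gr Z1 Z3"
proof (cases "mon_deg Z1 = mon_deg Z2 \<and> mon_deg Z2 = mon_deg Z3")
  case True
  with assms obtain w1 w2 where
    w1: "w1 \<in> X" "lookup Z1 w1 < lookup Z2 w1" "\<forall>v\<in>X. before w1 v \<longrightarrow> lookup Z1 v = lookup Z2 v" and
    w2: "w2 \<in> X" "lookup Z2 w2 < lookup Z3 w2" "\<forall>v\<in>X. before w2 v \<longrightarrow> lookup Z2 v = lookup Z3 v"
    by (auto simp: grevlex_def)
  from before_total[OF w1(1) w2(1)] have
    "\<exists>w\<in>X. lookup Z1 w < lookup Z3 w \<and> (\<forall>v\<in>X. before w v \<longrightarrow> lookup Z1 v = lookup Z3 v)"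
  proof (elim disjE)
    assume "w1 = w2"
    with w1 w2 show ?thesis by (intro bexI[of _ w1]) auto
  next
    assume b: "before w1 w2"
    then have "\<forall>v\<in>X. before w2 v \<longrightarrow> before w1 v" using before_trans[OF w1(1) w2(1)] by blast
    with b w1 w2 show ?thesis by (intro bexI[of _ w2]) auto
  next
    assume b: "before w2 w1"
    then have "\<forall>v\<in>X. before w1 v \<longrightarrow> before w2 v" using before_trans[OF w2(1) w1(1)] by blast
    with b w1 w2 show ?thesis by (intro bexI[of _ w1]) auto
  qed
  with True show ?thesis by (simp add: grevlex_def)
next
  case False
  with assms show ?thesis by (auto simp: grevlex_def)
qed

lemma gr_add: "gr Z Z' \<Longrightarrow> gr (Z + W) (Z' + W)"
  by (auto simp: grevlex_def mon_deg_add lookup_add)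

text \<open>Degrees are compared first and there are finitely many variables, so only finitely many
  monomials lie below \<open>Z\<close>; counting them represents the order by natural
  numbers.\<close>

definition gr_rank :: "'a monom \<Rightarrow> nat" where
  "gr_rank Z = card {Z' \<in> mons X. gr Z Z'}"

lemma gr_finite: "finite {Z' \<in> mons X. gr Z Z'}"
proof (rule finite_subset)
  show "{Z' \<in> mons X. gr Z Z'} \<subseteq> (\<Union>i\<le>mon_deg Z. {Z' \<in> mons X. mon_deg Z' = i})"
    by (auto simp: grevlex_def)
qed (simp add: finite_mons_deg finite_X)

lemma gr_rank_less:
  assumes "Z \<in> mons X" "Z' \<in> mons X" shows "gr Z Z' \<longleftrightarrow> gr_rank Z' < gr_rank Z"
proof -
  have less: "gr_rank Z' < gr_rank Z" if "gr Z Z'" "Z' \<in> mons X" for Z Z'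
    unfolding gr_rank_def using that gr_trans gr_irrefl
    by (intro psubset_card_mono[OF gr_finite]) blast
  show ?thesis using less[of Z Z'] less[of Z' Z] gr_total[OF assms] assms by fastforce
qed

lemma gr_rank_inj: "inj_on gr_rank (mons X)"
  using gr_total gr_rank_less by (force simp: inj_on_def)

text \<open>The last variable of \<open>Z'\<close> is \<open>w\<close> or comes after it, hence
  after all variables of \<open>Z\<close>. There \<open>Z\<close> has exponent zero, and beyond it
  both monomials do.\<close>

lemma grevlex_lastI:
  assumes "mon_deg Z = mon_deg Z'" "Z' \<in> mons X" "Z \<in> mons X" "w \<in> keys Z'"
    and "\<And>y. y \<in> keys Z \<Longrightarrow> before y w"
  shows "gr Z Z'"
proof -
  obtain w' where w': "w' \<in> keys Z'" "\<forall>v\<in>keys Z'. v = w' \<or> before v w'"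
    using exists_last[of "keys Z'"] assms(2,4) unfolding mons_def by blast
  have X: "w' \<in> X" "w \<in> X" "keys Z \<subseteq> X" using w' assms by (auto simp: mons_def)
  have yw: "before y w'" if "y \<in> keys Z" for y
  proof -
    have "y \<in> X" "before y w" using that assms(5) X by auto
    moreover have "w = w' \<or> before w w'" using w' assms(4) by auto
    ultimately show ?thesis using before_trans[of y w w'] X by auto
  qed
  then have "lookup Z w' < lookup Z' w'"
    using before_irrefl X w' by (metis in_keys_iff neq0_conv)
  moreover have "lookup Z v = lookup Z' v" if v: "v \<in> X" "before w' v" for v
  proof -
    have "v \<notin> keys Z" using yw[of v] before_asym[OF X(1) v(1)] v by blast
    moreover have "v \<notin> keys Z'" using w' before_asym[OF X(1) v(1)] before_irrefl[OF X(1)] v by auto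
    ultimately show ?thesis by (simp add: in_keys_iff)
  qed
  ultimately show ?thesis using assms(1) X by (auto simp: grevlex_def)
qed

end

section \<open>The lex order as a strict total order\<close>

lemma lex_earlier_irrefl: "\<not> lex_earlier u u"
  by (simp add: lex_earlier_def)

lemma lex_earlier_trans: "lex_earlier u v \<Longrightarrow> lex_earlier v w \<Longrightarrow> lex_earlier u w"
proof -
  assume "lex_earlier u v" "lex_earlier v w"
  then obtain i j where i: "lookup v i < lookup u i" "\<forall>l<i. lookup u l = lookup v l"
    and j: "lookup w j < lookup v j" "\<forall>l<j. lookup v l = lookup w l"
    by (auto simp: lex_earlier_def)
  then show ?thesis
    unfolding lex_earlier_def
    by (intro exI[of _ "min i j"]) (cases i j rule: linorder_cases; auto simp: min_def)
qed

lemma lex_earlier_total: "u = v \<or> lex_earlier u v \<or> lex_earlier v u"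
proof (rule disjCI)
  assume n: "\<not> (lex_earlier u v \<or> lex_earlier v u)"
  have "lookup u i = lookup v i" for i
  proof (induction i rule: less_induct)
    case (less i)
    with n show ?case unfolding lex_earlier_def by (metis linorder_neqE_nat)
  qed
  then show "u = v" by (rule poly_mapping_eqI)
qed

lemma lex_latest_exists:
  assumes "finite F" "F \<noteq> {}" obtains a where "a \<in> F" "\<And>b. b \<in> F \<Longrightarrow> b = a \<or> lex_earlier b a"
proof -
  have "\<exists>a\<in>F. \<forall>b\<in>F. b = a \<or> lex_earlier b a"
    by (rule last_element[OF assms]) (erule (1) lex_earlier_trans, rule lex_earlier_total)
  then obtain a where a: "a \<in> F" "\<forall>b\<in>F. b = a \<or> lex_earlier b a" by (rule bexE)
  show thesis by (rule that[OF a(1)]) (rule a(2)[rule_format])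
qed

lemma lex_first_exists:
  assumes "finite F" "F \<noteq> {}" obtains a where "a \<in> F" "\<And>b. b \<in> F \<Longrightarrow> a = b \<or> lex_earlier a b"
proof -
  have "\<exists>a\<in>F. \<forall>b\<in>F. b = a \<or> (\<lambda>u v. lex_earlier v u) b a"
  proof (rule last_element[OF assms])
    show "(\<lambda>u v. lex_earlier v u) u w"
      if "(\<lambda>u v. lex_earlier v u) u v" "(\<lambda>u v. lex_earlier v u) v w" for u v w
      using lex_earlier_trans[of w v u] that by simp
    show "u = v \<or> (\<lambda>u v. lex_earlier v u) u v \<or> (\<lambda>u v. lex_earlier v u) v u" for u v
      using lex_earlier_total[of u v] by blast
  qed
  then obtain a where a: "a \<in> F" "\<forall>b\<in>F. b = a \<or> lex_earlier a b" by auto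
  show thesis by (rule that[OF a(1)]) (use a(2) in auto)
qed

section \<open>Prefix sums and Borel exchanges\<close>

text \<open>The sum starts at index 0, where monomials of \<open>mons {1..n}\<close> have exponent
  zero; thus \<open>pre u (k - 1)\<close> is the prefix just before \<open>x_k\<close>, and it is 0
  for \<open>k = 1\<close>.\<close>

definition pre :: "nat monom \<Rightarrow> nat \<Rightarrow> nat" where
  "pre u i = (\<Sum>j\<le>i. lookup u j)"

definition borel_up :: "nat \<Rightarrow> nat monom \<Rightarrow> nat monom set" where
  "borel_up n L = {u \<in> mons {1..n}. mon_deg u = mon_deg L \<and> (\<forall>i. pre L i \<le> pre u i)}"

lemma pre_Suc: "pre u (Suc i) = pre u i + lookup u (Suc i)"
  by (simp add: pre_def)

lemma pre_add: "pre (u + v) i = pre u i + pre v i"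
  by (simp add: pre_def lookup_add sum.distrib)

lemma pre_zero [simp]: "pre 0 i = 0"
  by (simp add: pre_def)

lemma pre_single: "pre (Poly_Mapping.single k (Suc 0)) i = (if k \<le> i then 1 else 0)"
  by (simp add: pre_def lookup_single when_def)

lemma pre_mono: "i \<le> j \<Longrightarrow> pre u i \<le> pre u j"
  unfolding pre_def by (intro sum_mono2) auto

lemma pre_top:
  assumes "u \<in> mons {1..n}" "n \<le> i" shows "pre u i = mon_deg u"
  unfolding pre_def by (rule mon_deg_superset[symmetric]) (use assms in \<open>auto simp: mons_def\<close>)

lemma pre_eqD:
  assumes "\<And>i. pre u i = pre v i" shows "u = v"
proof (rule poly_mapping_eqI)
  fix i show "lookup u i = lookup v i"
  proof (cases i)
    case 0
    then show ?thesis using assms[of 0] by (simp add: pre_def)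
  next
    case (Suc j)
    then show ?thesis using assms[of i] assms[of j] by (simp add: pre_Suc)
  qed
qed

lemma borel_up_mono: "u \<in> borel_up n L \<Longrightarrow> v \<in> mons {1..n} \<Longrightarrow> mon_deg v = mon_deg u \<Longrightarrow>
    (\<And>i. pre u i \<le> pre v i) \<Longrightarrow> v \<in> borel_up n L"
  unfolding borel_up_def by (auto intro: order_trans)

lemma lex_earlier_swap:
  assumes "i < k"
  shows "lex_earlier (w + Poly_Mapping.single i (Suc 0)) (w + Poly_Mapping.single k (Suc 0))"
  unfolding lex_earlier_def using assms
  by (intro exI[of _ i]) (auto simp: lookup_add lookup_single when_def)

lemma pre_swap:
  assumes "i < k"
  shows "pre (w + Poly_Mapping.single k (Suc 0)) j \<le> pre (w + Poly_Mapping.single i (Suc 0)) j"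
  using assms by (simp add: pre_add pre_single)

text \<open>
  If the prefix sums of \<open>u\<close> exceed those of \<open>L\<close> just before \<open>k\<close>, then a variable of \<open>u\<close> below \<open>k\<close>
  can be exchanged with the variable \<open>k\<close> of \<open>v\<close> without leaving the Borel ideal of \<open>L\<close>.
\<close>

lemma borel_exchange:
  assumes u: "u \<in> borel_up n L" and v: "v \<in> mons {1..n}" and k: "lookup v k > 0"
    and gt: "pre L (k - 1) \<noteq> pre u (k - 1)"
  obtains u' v' where "u' \<in> borel_up n L" "v' \<in> mons {1..n}" "mon_deg v' = mon_deg v"
    "\<And>j. pre v j \<le> pre v' j" "u + v = u' + v'" "lex_earlier u u'" "lex_earlier v' v"
proof -
  have kn: "k \<in> {1..n}" using v k by (auto simp: mons_def in_keys_iff subset_iff)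
  then obtain m where m: "k = Suc m" by (cases k) auto
  have um: "u \<in> mons {1..n}" and ge: "\<And>i. pre L i \<le> pre u i" and du: "mon_deg u = mon_deg L"
    using u by (auto simp: borel_up_def)
  have gt: "pre L m < pre u m" using gt ge[of m] by (simp add: m)
  let ?P = "\<lambda>i. i \<le> m \<and> lookup u i > 0"
  have "\<exists>i. ?P i"
  proof (rule ccontr)
    assume "\<nexists>i. ?P i"
    then have "pre u m = 0" by (auto simp: pre_def)
    with gt show False by simp
  qed
  then have P: "?P (Greatest ?P)" by (rule GreatestI_ex_nat[of ?P m]) auto
  have P_max: "j \<le> Greatest ?P" if "?P j" for j
    using that by (rule Greatest_le_nat[of ?P _ m]) auto
  define i where "i = Greatest ?P"
  have i: "i \<le> m" "lookup u i > 0" "\<And>j. i < j \<Longrightarrow> j \<le> m \<Longrightarrow> lookup u j = 0"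
    using P P_max by (fastforce simp: i_def)+
  have ik: "i < k" using i m by simp
  have in': "i \<in> {1..n}" using um i(2) by (auto simp: mons_def in_keys_iff subset_iff)
  have const: "pre u j = pre u m" if "i \<le> j" "j \<le> m" for j
  proof -
    have "(\<Sum>l\<le>m. lookup u l) = (\<Sum>l\<le>j. lookup u l)"
      using that i(3) by (intro sum.mono_neutral_right) auto
    then show ?thesis by (simp add: pre_def)
  qed
  obtain u0 where u0: "u = u0 + Poly_Mapping.single i (Suc 0)"
    using i(2) by (auto simp: in_keys_iff intro: monom_split)
  obtain v0 where v0: "v = v0 + Poly_Mapping.single k (Suc 0)"
    using k by (auto simp: in_keys_iff intro: monom_split)
  show thesis
  proof
    have "pre L j \<le> pre (u0 + Poly_Mapping.single k (Suc 0)) j" for j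
    proof (cases "i \<le> j \<and> j \<le> m")
      case True
      then have "pre L j < pre u j" using const[of j] gt pre_mono[of j m L] by simp
      with True show ?thesis by (simp add: u0 pre_add pre_single)
    next
      case False
      then show ?thesis using ge[of j] ik by (auto simp: u0 pre_add pre_single m)
    qed
    then show "u0 + Poly_Mapping.single k (Suc 0) \<in> borel_up n L"
      using um kn du by (auto simp: borel_up_def u0 mons_add_iff mon_deg_add)
    show "v0 + Poly_Mapping.single i (Suc 0) \<in> mons {1..n}" using v in' by (simp add: v0 mons_add_iff)
    show "lex_earlier u (u0 + Poly_Mapping.single k (Suc 0))"
      unfolding u0 using ik by (rule lex_earlier_swap)
    show "lex_earlier (v0 + Poly_Mapping.single i (Suc 0)) v"
      unfolding v0 using ik by (rule lex_earlier_swap)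
    show "pre v j \<le> pre (v0 + Poly_Mapping.single i (Suc 0)) j" for j
      unfolding v0 using ik by (rule pre_swap)
  qed (simp_all add: u0 v0 mon_deg_add ac_simps)
qed

text \<open>Downward induction from \<open>n\<close>, where both prefix sums equal the degree. If
  \<open>Q\<close> contains the next variable, tightness puts \<open>A\<close> at the lower bound
  \<open>l\<close>. If not, \<open>A\<close> contains at least as much of that variable as
  \<open>A'\<close>, so removing it preserves the inequality.\<close>

lemma pre_minimal:
  assumes m: "A \<in> mons {1..n}" "A' \<in> mons {1..n}" and deg: "mon_deg A = mon_deg A'"
    and eq: "A + Q = A' + Q'"
    and tight: "\<And>k. lookup Q k > 0 \<Longrightarrow> pre A (k - 1) = l (k - 1)" and ge: "\<And>i. l i \<le> pre A' i"
  shows "pre A i \<le> pre A' i"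
proof (cases "i \<le> n")
  case True
  then show ?thesis
  proof (induction i rule: inc_induct)
    case base
    show ?case using m deg by (simp add: pre_top)
  next
    case (step i)
    show ?case
    proof (cases "lookup Q (Suc i) > 0")
      case True
      from tight[OF this] ge[of i] show ?thesis by simp
    next
      case False
      have "lookup (A + Q) (Suc i) = lookup (A' + Q') (Suc i)" by (simp add: eq)
      with False step.IH show ?thesis by (simp add: lookup_add pre_Suc)
    qed
  qed
next
  case False
  with m deg show ?thesis by (simp add: pre_top)
qed

text \<open>An additive relation between the number of factors and a prefix sum passes from single
  factors to products; the three bounds that follow are instances.\<close>

lemma pre_monval_induct:
  assumes "\<And>w. w \<in> keys Z \<Longrightarrow> R 1 (pre w i)" "R 0 0"
    "\<And>a b r s. R a r \<Longrightarrow> R b s \<Longrightarrow> R (a + b) (r + s)"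
  shows "R (mon_deg Z) (pre (monval Z) i)"
  using assms(1)
proof (induction "mon_deg Z" arbitrary: Z)
  case 0
  then show ?case using assms(2) by simp
next
  case (Suc m)
  then have "Z \<noteq> 0" by auto
  then obtain e W where e: "e \<in> keys Z" "Z = W + Y e" by (rule monom_nonzero_split)
  then have "R (mon_deg W) (pre (monval W) i)" "R 1 (pre e i)"
    using Suc by (auto simp: mon_deg_add keys_add_monom)
  from assms(3)[OF this] show ?case by (simp add: e(2) monval_add pre_add mon_deg_add)
qed

lemma pre_monval_ge: "(\<And>w. w \<in> keys Z \<Longrightarrow> c \<le> pre w i) \<Longrightarrow> mon_deg Z * c \<le> pre (monval Z) i"
  by (rule pre_monval_induct[where R = "\<lambda>a r. a * c \<le> r"]) (auto simp: distrib_right)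

lemma pre_monval_eq: "(\<And>w. w \<in> keys Z \<Longrightarrow> pre w i = c) \<Longrightarrow> pre (monval Z) i = mon_deg Z * c"
  by (rule pre_monval_induct[where R = "\<lambda>a r. r = a * c"]) (auto simp: distrib_right)

lemma pre_monval_less:
  assumes "\<And>w. w \<in> keys Z \<Longrightarrow> pre w i < c" "Z \<noteq> 0"
  shows "pre (monval Z) i < mon_deg Z * c"
proof -
  \<comment> \<open>Each strict bound leaves room for one unit, and these units add up to the number
    of factors.\<close>
  have "pre (monval Z) i + mon_deg Z \<le> mon_deg Z * c"
    by (rule pre_monval_induct[where R = "\<lambda>a r. r + a \<le> a * c"])
      (use assms in \<open>auto simp: distrib_right Suc_le_eq\<close>)
  moreover have "mon_deg Z > 0" using assms(2) by (simp add: zero_less_iff_neq_zero)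
  ultimately show ?thesis by linarith
qed

lemma lookup_monval_pos: "lookup (monval Z) k > 0 \<Longrightarrow> \<exists>w\<in>keys Z. lookup w k > 0"
  by (rule ccontr) (auto simp: lookup_monval)

lemma lex_split:
  "r \<le> mon_deg (Z :: nat monom monom) \<Longrightarrow> \<exists>Zl Zh. Z = Zl + Zh \<and> mon_deg Zl = r \<and>
    (\<forall>a\<in>keys Zl. \<forall>b\<in>keys Zh. b = a \<or> lex_earlier b a)"
proof (induction r)
  case 0
  show ?case by (intro exI[of _ 0] exI[of _ Z]) simp
next
  case (Suc r)
  then obtain Zl Zh where Z: "Z = Zl + Zh" "mon_deg Zl = r"
    and lh: "\<And>a b. a \<in> keys Zl \<Longrightarrow> b \<in> keys Zh \<Longrightarrow> b = a \<or> lex_earlier b a" by auto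
  with Suc.prems have "Zh \<noteq> 0" by (auto simp: mon_deg_add)
  then obtain a where a: "a \<in> keys Zh" "\<And>b. b \<in> keys Zh \<Longrightarrow> b = a \<or> lex_earlier b a"
    using lex_latest_exists[of "keys Zh"] by (auto simp: keys_eq_empty)
  from a(1) obtain W where W: "Zh = W + Y a" by (rule monom_split)
  show ?case
    by (rule exI[of _ "Zl + Y a"], rule exI[of _ W])
      (use Z W lh a in \<open>auto simp: ac_simps mon_deg_add keys_add_monom\<close>)
qed

lemma monom_partition:
  "\<exists>Z1 Z2. (Z :: 'a monom) = Z1 + Z2 \<and> keys Z1 \<subseteq> P \<and> keys Z2 \<inter> P = {}"
proof (induction "mon_deg Z" arbitrary: Z)
  case 0
  then show ?case by (intro exI[of _ 0]) simp
next
  case (Suc m)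
  then have "Z \<noteq> 0" by auto
  then obtain e W where e: "Z = W + Y e" by (rule monom_nonzero_split)
  then obtain Z1 Z2 where Z: "W = Z1 + Z2" "keys Z1 \<subseteq> P" "keys Z2 \<inter> P = {}"
    using Suc by (force simp: mon_deg_add)
  show ?case
  proof (cases "e \<in> P")
    case True
    then show ?thesis using Z e
      by (intro exI[of _ "Z1 + Y e"] exI[of _ Z2]) (auto simp: keys_add_monom ac_simps)
  next
    case False
    then show ?thesis using Z e
      by (intro exI[of _ Z1] exI[of _ "Z2 + Y e"]) (auto simp: keys_add_monom ac_simps)
  qed
qed

section \<open>Standard monomials of two-Borel ideals\<close>

text \<open>\<open>d > 0\<close> lets the number of factors be recovered from the degree of a
  product, which makes the fibres homogeneous.\<close>

locale two_borel_monomials =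
  fixes n d :: nat and M N :: "nat monom" and U GM GN :: "nat monom set" and rk :: "nat monom monom \<Rightarrow> nat"
    and before :: "nat monom \<Rightarrow> nat monom \<Rightarrow> bool"
  assumes MN: "M \<in> mons {1..n}" "N \<in> mons {1..n}" "mon_deg M = d" "mon_deg N = d" "d > 0"
    and GM: "GM = borel_up n M" and GN: "GN = borel_up n N - GM" and U: "U = GM \<union> GN"
    and before: "before v w \<longleftrightarrow> (v \<in> GN \<and> w \<in> GN \<and> lex_earlier w v) \<or> (v \<in> GN \<and> w \<in> GM) \<or>
      (v \<in> GM \<and> w \<in> GM \<and> lex_earlier v w)"
    and rk: "rk = finite_variable_order.gr_rank U before"
begin

lemma U_D: "u \<in> U \<Longrightarrow> u \<in> mons {1..n}" "u \<in> U \<Longrightarrow> mon_deg u = d"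
  using MN by (auto simp: U GM GN borel_up_def)

lemma U_eq: "U = borel_up n M \<union> borel_up n N"
  by (auto simp: U GM GN)

lemma U_finite: "finite U"
proof (rule finite_subset)
  show "U \<subseteq> {u \<in> mons {1..n}. mon_deg u = d}" using U_D by blast
qed (simp add: finite_mons_deg)

sublocale ord: finite_variable_order U before
proof
  show "finite U" by (rule U_finite)
  show "\<not> before u u" for u by (auto simp: before GN lex_earlier_irrefl)
  show "before u w" if "before u v" "before v w" for u v w
    using that lex_earlier_trans unfolding before by (auto simp: GN)
  show "u = v \<or> before u v \<or> before v u" if "u \<in> U" "v \<in> U" for u v
    using that lex_earlier_total[of u v] unfolding before U by blast
qed

lemma rk_gr: "Z \<in> mons U \<Longrightarrow> Z' \<in> mons U \<Longrightarrow> grevlex U before Z Z' \<longleftrightarrow> rk Z' < rk Z"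
  unfolding rk by (rule ord.gr_rank_less)

sublocale to: toric_order U monval rk
proof
  show "mon_deg Z = mon_deg Z'" if "Z \<in> mons U" "Z' \<in> mons U" "monval Z = monval Z'" for Z Z'
    using mon_deg_monval[OF U_D(2) that(1)] mon_deg_monval[OF U_D(2) that(2)] that(3) MN by simp
  show "inj_on rk (mons U)" unfolding rk by (rule ord.gr_rank_inj)
  show "rk (Z + W) < rk (Z' + W)" if "Z \<in> mons U" "Z' \<in> mons U" "W \<in> mons U" "rk Z < rk Z'" for Z Z' W
    using that ord.gr_add[of Z' Z W] by (simp add: mons_add_iff flip: rk_gr)
qed (simp_all add: U_finite monval_add)

text \<open>A variable of the new pair that comes after both variables of the old pair decides the
  reverse lexicographic comparison, and the new pair is smaller.\<close>

lemma pair_not_std: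
  assumes "a \<in> U" "b \<in> U" "a' \<in> U" "b' \<in> U" "a + b = a' + b'"
    and w: "w = a' \<or> w = b'" and last: "before a w" "before b w"
  shows "\<not> to.std (Y a + Y b)"
proof
  assume s: "to.std (Y a + Y b)"
  have "grevlex U before (Y a + Y b) (Y a' + Y b')"
    by (rule ord.grevlex_lastI[of _ _ w])
      (use assms in \<open>auto simp: mon_deg_add mons_add_iff keys_add_monom\<close>)
  then have "rk (Y a' + Y b') < rk (Y a + Y b)"
    using assms by (subst (asm) rk_gr) (auto simp: mons_add_iff)
  moreover have "rk (Y a + Y b) \<le> rk (Y a' + Y b')"
    using s assms by (auto simp: min_fiber_def mons_add_iff monval_add)
  ultimately show False by simp
qed

text \<open>Otherwise \<open>borel_exchange\<close> gives \<open>a'\<close> in \<open>GM\<close>,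
  lex-later than \<open>a\<close>. Lex-later means later in \<open>GM\<close>, and \<open>GN\<close>
  precedes \<open>GM\<close>, so \<open>a'\<close> comes after \<open>a\<close> and
  \<open>b\<close>. The other new factor stays in \<open>U\<close> because its prefix sums only
  grow.\<close>

lemma std_pair_M:
  assumes a: "a \<in> GM" and b: "b \<in> U" and lex: "b \<in> GM \<Longrightarrow> b = a \<or> lex_earlier b a"
    and s: "to.std (Y a + Y b)" and k: "lookup b k > 0"
  shows "pre a (k - 1) = pre M (k - 1)"
proof (rule ccontr)
  assume "pre a (k - 1) \<noteq> pre M (k - 1)"
  then obtain a' b' where ab: "a' \<in> borel_up n M" "b' \<in> mons {1..n}" "mon_deg b' = mon_deg b"
    "\<And>j. pre b j \<le> pre b' j" "a + b = a' + b'" "lex_earlier a a'" "lex_earlier b' b"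
    using borel_exchange[of a n M b k] a b k U_D by (metis GM)
  have a': "a' \<in> GM" using ab by (simp add: GM)
  have b': "b' \<in> U"
    using b borel_up_mono[of b n _ b'] ab(2,3,4) unfolding U_eq by blast
  have "before a a'" using a a' ab(6) by (simp add: before)
  moreover have "before b a'"
  proof (cases "b \<in> GM")
    case True
    with lex ab(6) lex_earlier_trans have "lex_earlier b a'" by blast
    with True a' show ?thesis by (simp add: before)
  next
    case False
    with b a' show ?thesis by (simp add: before U)
  qed
  ultimately have "\<not> to.std (Y a + Y b)"
    using a a' b b' ab(5) by (intro pair_not_std[of a b a' b' a']) (auto simp: U)
  with s show False by simp
qed

text \<open>Now the other new factor decides: \<open>b'\<close> is lex-earlier than both
  \<open>a\<close> and \<open>b\<close>, which inside \<open>GN\<close> means later; if the exchange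
  moves it into \<open>GM\<close>, it comes after both anyway.\<close>

lemma std_pair_N:
  assumes a: "a \<in> GN" and b: "b \<in> GN" and lex: "b = a \<or> lex_earlier b a"
    and s: "to.std (Y a + Y b)" and k: "lookup b k > 0"
  shows "pre a (k - 1) = pre N (k - 1)"
proof (rule ccontr)
  assume "pre a (k - 1) \<noteq> pre N (k - 1)"
  moreover have "a \<in> borel_up n N" "b \<in> U" "a \<in> U" using a b by (auto simp: GN U)
  ultimately obtain a' b' where ab: "a' \<in> borel_up n N" "b' \<in> mons {1..n}" "mon_deg b' = mon_deg b"
    "\<And>j. pre b j \<le> pre b' j" "a + b = a' + b'" "lex_earlier a a'" "lex_earlier b' b"
    using borel_exchange[of a n N b k] k U_D by metis
  have a': "a' \<in> U" using ab by (simp add: U_eq)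
  have "b' \<in> borel_up n N" using b ab(2,3,4) by (intro borel_up_mono[of b n N b']) (auto simp: GN)
  then have b': "b' \<in> U" by (simp add: U_eq)
  have "lex_earlier b' a" using lex ab(7) lex_earlier_trans by blast
  then have "before a b'" "before b b'" using a b b' ab(7) by (auto simp: before U)
  then have "\<not> to.std (Y a + Y b)"
    using a a' b b' ab(5) by (intro pair_not_std[of a b a' b' b']) (auto simp: U)
  with s show False by simp
qed

section \<open>Uniqueness of pairwise standard factorizations\<close>

definition pairwise_std :: "nat monom monom \<Rightarrow> bool" where
  "pairwise_std Z \<longleftrightarrow> Z \<in> mons U \<and> (\<forall>a b W. Z = W + (Y a + Y b) \<longrightarrow> to.std (Y a + Y b))"

lemma pairwise_std_factor: "pairwise_std (Z + W) \<Longrightarrow> pairwise_std Z"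
proof -
  assume ZW: "pairwise_std (Z + W)"
  have "to.std (Y a + Y b)" if "Z = V + (Y a + Y b)" for a b V
  proof -
    have "Z + W = (V + W) + (Y a + Y b)" using that by (simp add: ac_simps)
    with ZW show ?thesis unfolding pairwise_std_def by blast
  qed
  with ZW show ?thesis by (auto simp: pairwise_std_def mons_add_iff)
qed

lemma pairwise_std_pair:
  assumes "pairwise_std (Z + W)" "a \<in> keys Z" "b \<in> keys W" shows "to.std (Y a + Y b)"
proof -
  from assms(2) obtain Z' where "Z = Z' + Y a" by (rule monom_split)
  moreover from assms(3) obtain W' where "W = W' + Y b" by (rule monom_split)
  ultimately have "Z + W = (Z' + W') + (Y a + Y b)" by (simp add: ac_simps)
  with assms(1) show ?thesis by (auto simp: pairwise_std_def)
qed

lemma pairwise_stdD: "pairwise_std Z \<Longrightarrow> Z \<in> mons U"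
  by (simp add: pairwise_std_def)

lemma monval_mons_U: "Z \<in> mons U \<Longrightarrow> monval Z \<in> mons {1..n}"
  using U_D by (intro monval_mons[of U]) auto

text \<open>The case of \<open>pre_minimal\<close> in which one factor is split off: tightness of
  \<open>a\<close> before each variable of the remaining factors makes its prefix sums the least
  possible among divisors above \<open>L\<close>.\<close>

lemma peel_pre_le:
  assumes "a \<in> U" "a' \<in> U" "a' \<in> borel_up n L" and eq: "monval (W + Y a) = monval (W' + Y a')"
    and tight: "\<And>b k. b \<in> keys W \<Longrightarrow> lookup b k > 0 \<Longrightarrow> pre a (k - 1) = pre L (k - 1)"
  shows "pre a i \<le> pre a' i"
proof (rule pre_minimal[of a n a' "monval W" "monval W'" "pre L"])
  show "a + monval W = a' + monval W'" using eq by (simp add: monval_add add.commute)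
  show "pre a (k - 1) = pre L (k - 1)" if "lookup (monval W) k > 0" for k
    using lookup_monval_pos[OF that] tight by blast
qed (use assms U_D in \<open>auto simp: borel_up_def\<close>)

text \<open>The remaining factors may lie in \<open>GN\<close> or be copies of \<open>a\<close>;
  \<open>std_pair_M\<close> covers them, since it compares in the lex order only within
  \<open>GM\<close>.\<close>

lemma latest_M:
  assumes Z: "pairwise_std Z" and ne: "keys Z \<inter> GM \<noteq> {}"
  obtains a W where "a \<in> GM" "Z = W + Y a"
    "\<And>b k. b \<in> keys W \<Longrightarrow> lookup b k > 0 \<Longrightarrow> pre a (k - 1) = pre M (k - 1)"
proof -
  obtain a where a: "a \<in> keys Z \<inter> GM" "\<And>b. b \<in> keys Z \<inter> GM \<Longrightarrow> b = a \<or> lex_earlier b a"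
    using lex_latest_exists[of "keys Z \<inter> GM"] ne by auto
  from a(1) have "a \<in> keys Z" by simp
  then obtain W where W: "Z = W + Y a" by (rule monom_split)
  have "pre a (k - 1) = pre M (k - 1)" if b: "b \<in> keys W" "lookup b k > 0" for b k
  proof (rule std_pair_M[of a b k])
    show "b \<in> U" using b(1) pairwise_stdD[OF Z] by (auto simp: W keys_add_monom mons_def)
    show "to.std (Y a + Y b)"
      using pairwise_std_pair[of "Y a" W a b] Z b(1) by (simp add: W add.commute)
    show "b = a \<or> lex_earlier b a" if "b \<in> GM" using a(2)[of b] that b(1) by (auto simp: W keys_add_monom)
  qed (use a b in auto)
  with that a W show thesis by blast
qed

lemma latest_N:
  assumes Z: "pairwise_std Z" and ne: "Z \<noteq> 0" and sub: "keys Z \<subseteq> GN"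
  obtains a W where "a \<in> GN" "Z = W + Y a"
    "\<And>b k. b \<in> keys W \<Longrightarrow> lookup b k > 0 \<Longrightarrow> pre a (k - 1) = pre N (k - 1)"
proof -
  obtain a where a: "a \<in> keys Z" "\<And>b. b \<in> keys Z \<Longrightarrow> b = a \<or> lex_earlier b a"
    using lex_latest_exists[of "keys Z"] ne by auto
  from a(1) obtain W where W: "Z = W + Y a" by (rule monom_split)
  have "pre a (k - 1) = pre N (k - 1)" if b: "b \<in> keys W" "lookup b k > 0" for b k
  proof (rule std_pair_N[of a b k])
    show "to.std (Y a + Y b)"
      using pairwise_std_pair[of "Y a" W a b] Z b(1) by (simp add: W add.commute)
    show "b = a \<or> lex_earlier b a" using a(2)[of b] b(1) by (auto simp: W keys_add_monom)
  qed (use a b sub in \<open>auto simp: W keys_add_monom\<close>)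
  with that a W sub show thesis by blast
qed

text \<open>Either factor can be split off the product of the pair, so \<open>peel_pre_le\<close>
  applies with the two interchanged. Factors in \<open>GN\<close> of a pairwise standard product
  thus form a chain for prefix sums.\<close>

lemma N_pair_pre_le:
  assumes "a \<in> GN" "b \<in> GN" "b = a \<or> lex_earlier b a" "to.std (Y a + Y b)"
  shows "pre a i \<le> pre b i"
proof (rule peel_pre_le[of a b N "Y b" "Y a"])
  show "pre a (k - 1) = pre N (k - 1)" if "c \<in> keys (Y b)" "lookup c k > 0" for c k
    using std_pair_N[OF assms] that by simp
qed (use assms in \<open>auto simp: U GN monval_add add.commute\<close>)

text \<open>
  The lex-latest \<open>t - s\<close> factors of a fibre element with all \<open>t\<close> factors in \<open>GN\<close> have the smallest
  prefix sums among all products of \<open>t - s\<close> elements above \<open>N\<close>; so if \<open>s\<close> elements of \<open>GM\<close> could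
  be split off, the other \<open>s\<close> factors would be above \<open>M\<^sup>s\<close>, which fails at an index where the
  lex-earliest factor is not above \<open>M\<close>.
\<close>

lemma no_M_factor:
  assumes Z: "pairwise_std Z" "keys Z \<subseteq> GN" and Z': "Z' \<in> mons U" and eq: "monval Z = monval Z'"
  shows "keys Z' \<inter> GM = {}"
proof (rule ccontr)
  assume ne: "keys Z' \<inter> GM \<noteq> {}"
  obtain ZM ZN where Z'_eq: "Z' = ZM + ZN" and ZM: "keys ZM \<subseteq> GM" and ZN: "keys ZN \<inter> GM = {}"
    using monom_partition[of Z' GM] by blast
  have ZM0: "ZM \<noteq> 0" using ne ZN by (auto simp: Z'_eq keys_add_monom)
  have U': "ZM \<in> mons U" "ZN \<in> mons U" using Z' by (auto simp: Z'_eq mons_add_iff)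
  have degZ: "mon_deg Z = mon_deg ZM + mon_deg ZN"
    using to.val_deg[OF pairwise_stdD[OF Z(1)] Z' eq] by (simp add: Z'_eq mon_deg_add)
  obtain Zl Zh where Zlh: "Z = Zl + Zh" "mon_deg Zl = mon_deg ZN"
    and lh: "\<And>a b. a \<in> keys Zl \<Longrightarrow> b \<in> keys Zh \<Longrightarrow> b = a \<or> lex_earlier b a"
    using lex_split[of "mon_deg ZN" Z] degZ by auto
  have degh: "mon_deg Zh = mon_deg ZM" using degZ Zlh by (simp add: mon_deg_add)
  then have Zh0: "Zh \<noteq> 0" using ZM0 by (metis mon_deg_0_iff)
  have U2: "Zl \<in> mons U" "Zh \<in> mons U" using pairwise_stdD[OF Z(1)] by (auto simp: Zlh mons_add_iff)
  have GNl: "keys Zl \<subseteq> GN" "keys Zh \<subseteq> GN" using Z(2) by (auto simp: Zlh keys_add_monom)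
  have ZNN: "keys ZN \<subseteq> borel_up n N"
    using U' ZN by (auto simp: mons_def U GN)
  have le: "pre (monval Zl) i \<le> pre (monval ZN) i" for i
  proof (rule pre_minimal[of _ n _ "monval Zh" "monval ZM" "\<lambda>i. mon_deg ZN * pre N i"])
    show "mon_deg (monval Zl) = mon_deg (monval ZN)"
      using mon_deg_monval[OF U_D(2)] U2 U' Zlh(2) by simp
    show "monval Zl + monval Zh = monval ZN + monval ZM"
      using eq by (simp add: Zlh Z'_eq monval_add add.commute)
    show "pre (monval Zl) (k - 1) = mon_deg ZN * pre N (k - 1)" if k: "lookup (monval Zh) k > 0" for k
    proof -
      obtain b where b: "b \<in> keys Zh" "lookup b k > 0" using lookup_monval_pos[OF k] by blast
      have "pre a (k - 1) = pre N (k - 1)" if a: "a \<in> keys Zl" for a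
      proof (rule std_pair_N[of a b k])
        show "to.std (Y a + Y b)" using pairwise_std_pair[of Zl Zh a b] Z(1) a b by (simp add: Zlh)
      qed (use a b GNl lh in auto)
      then show ?thesis by (simp add: pre_monval_eq Zlh(2))
    qed
    show "mon_deg ZN * pre N i \<le> pre (monval ZN) i" for i
      using ZNN by (intro pre_monval_ge) (auto simp: borel_up_def)
  qed (use U2 U' monval_mons_U in auto)
  \<comment> \<open>By \<open>N_pair_pre_le\<close> the lex-earliest factor has the largest prefix
    sums, so wherever \<open>c\<close> falls below \<open>M\<close>, every factor of
    \<open>Zh\<close> does.\<close>
  obtain c where c: "c \<in> keys Zh" and c_first: "\<And>a. a \<in> keys Zh \<Longrightarrow> c = a \<or> lex_earlier c a"
    using lex_first_exists[of "keys Zh"] Zh0 by auto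
  have cN: "c \<in> GN" using c GNl by blast
  have "\<exists>i. \<not> pre M i \<le> pre c i"
    using cN MN by (auto simp: GN GM borel_up_def)
  then obtain i where i: "pre c i < pre M i" by (auto simp: not_le)
  have "pre a i < pre M i" if a: "a \<in> keys Zh" for a
  proof (cases "a = c")
    case False
    from c obtain Z0 where Z0: "Zh = Z0 + Y c" by (rule monom_split)
    with a False have "a \<in> keys Z0" by (auto simp: keys_add_monom)
    moreover have "pairwise_std (Z0 + Y c)"
      using pairwise_std_factor[of Zh Zl] Z(1) by (simp add: Zlh Z0 add.commute)
    ultimately have "to.std (Y a + Y c)" using pairwise_std_pair[of Z0 "Y c" a c] by simp
    then have "pre a i \<le> pre c i" using N_pair_pre_le[of a c] a cN GNl c_first by blast
    with i show ?thesis by simp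
  qed (use i in simp)
  then have "pre (monval Zh) i < mon_deg ZM * pre M i"
    using pre_monval_less[of Zh i "pre M i"] Zh0 by (simp add: degh)
  moreover have "mon_deg ZM * pre M i \<le> pre (monval ZM) i"
    using ZM by (intro pre_monval_ge) (auto simp: GM borel_up_def)
  moreover have "pre (monval Zl) i + pre (monval Zh) i = pre (monval ZM) i + pre (monval ZN) i"
    using eq by (simp add: Zlh Z'_eq monval_add flip: pre_add)
  ultimately show False using le[of i] by linarith
qed

text \<open>By \<open>no_M_factor\<close> both factorizations contain a factor in \<open>GM\<close>
  or neither does. The lex-latest factor in \<open>GM\<close>, or the lex-latest of all if there is
  none, has minimal prefix sums on either side; so the two agree, and cancelling them reduces the
  degree.\<close>

lemma pairwise_std_unique:
  assumes "pairwise_std Z" "pairwise_std Z'" "monval Z = monval Z'"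
  shows "Z = Z'"
  using assms
proof (induction "mon_deg Z" arbitrary: Z Z')
  case 0
  then show ?case using to.val_deg[of Z Z'] pairwise_stdD by (metis mon_deg_0_iff)
next
  case (Suc m)
  have deg: "mon_deg Z = mon_deg Z'" using to.val_deg[of Z Z'] pairwise_stdD Suc.prems by blast
  then have ne: "Z \<noteq> 0" "Z' \<noteq> 0" using Suc.hyps(2) by auto
  have cancel: "Z = Z'" if eqs: "Z = W + Y a" "Z' = W' + Y a'"
    and le: "\<And>i. pre a i \<le> pre a' i" "\<And>i. pre a' i \<le> pre a i" for W W' a a'
  proof -
    have aa: "a = a'" by (rule pre_eqD) (simp add: le antisym)
    have "W = W'"
    proof (rule Suc.hyps(1))
      show "m = mon_deg W" using Suc.hyps(2) by (simp add: eqs mon_deg_add)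
      show "pairwise_std W" "pairwise_std W'"
        using Suc.prems pairwise_std_factor by (auto simp: eqs)
      show "monval W = monval W'" using Suc.prems(3) by (simp add: eqs aa monval_add)
    qed
    with aa eqs show ?thesis by simp
  qed
  have GN_sub: "keys V \<subseteq> GN" if "pairwise_std V" "keys V \<inter> GM = {}" for V
    using that pairwise_stdD[of V] by (auto simp: mons_def U)
  show ?case
  proof (cases "keys Z \<inter> GM = {}")
    case True
    then have ZN: "keys Z \<subseteq> GN" using GN_sub Suc.prems by blast
    have "keys Z' \<inter> GM = {}"
      using no_M_factor[OF Suc.prems(1) ZN pairwise_stdD] Suc.prems by blast
    then have ZN': "keys Z' \<subseteq> GN" using GN_sub Suc.prems by blast
    obtain a W where a: "a \<in> GN" "Z = W + Y a"
      "\<And>b k. b \<in> keys W \<Longrightarrow> lookup b k > 0 \<Longrightarrow> pre a (k - 1) = pre N (k - 1)"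
      using latest_N[OF Suc.prems(1) ne(1) ZN] by blast
    obtain a' W' where a': "a' \<in> GN" "Z' = W' + Y a'"
      "\<And>b k. b \<in> keys W' \<Longrightarrow> lookup b k > 0 \<Longrightarrow> pre a' (k - 1) = pre N (k - 1)"
      using latest_N[OF Suc.prems(2) ne(2) ZN'] by blast
    have mem: "a \<in> U" "a' \<in> U" "a \<in> borel_up n N" "a' \<in> borel_up n N"
      using a(1) a'(1) by (auto simp: U GN)
    show ?thesis
    proof (rule cancel[OF a(2) a'(2)])
      show "pre a i \<le> pre a' i" for i
        by (rule peel_pre_le[of a a' N W W']) (use mem a a' Suc.prems in auto)
      show "pre a' i \<le> pre a i" for i
        by (rule peel_pre_le[of a' a N W' W]) (use mem a a' Suc.prems in auto)
    qed
  next
    case False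
    have "keys Z' \<inter> GM \<noteq> {}"
    proof
      assume "keys Z' \<inter> GM = {}"
      then have "keys Z' \<subseteq> GN" using GN_sub Suc.prems by blast
      then have "keys Z \<inter> GM = {}"
        using no_M_factor[OF Suc.prems(2) _ pairwise_stdD[OF Suc.prems(1)]] Suc.prems(3) by simp
      with False show False by simp
    qed
    then obtain a' W' where a': "a' \<in> GM" "Z' = W' + Y a'"
      "\<And>b k. b \<in> keys W' \<Longrightarrow> lookup b k > 0 \<Longrightarrow> pre a' (k - 1) = pre M (k - 1)"
      using latest_M[OF Suc.prems(2)] by blast
    obtain a W where a: "a \<in> GM" "Z = W + Y a"
      "\<And>b k. b \<in> keys W \<Longrightarrow> lookup b k > 0 \<Longrightarrow> pre a (k - 1) = pre M (k - 1)"
      using latest_M[OF Suc.prems(1) False] by blast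
    have mem: "a \<in> U" "a' \<in> U" "a \<in> borel_up n M" "a' \<in> borel_up n M"
      using a(1) a'(1) by (auto simp: U GM)
    show ?thesis
    proof (rule cancel[OF a(2) a'(2)])
      show "pre a i \<le> pre a' i" for i
        by (rule peel_pre_le[of a a' M W W']) (use mem a a' Suc.prems in auto)
      show "pre a' i \<le> pre a i" for i
        by (rule peel_pre_le[of a' a M W' W]) (use mem a a' Suc.prems in auto)
    qed
  qed
qed

text \<open>The minimal element of the fibre is pairwise standard by \<open>to.std_factor\<close>,
  so uniqueness identifies it with \<open>Z\<close>.\<close>

sublocale tq: toric_quadratic U monval rk
proof
  fix Z assume Z: "Z \<in> mons U" "\<And>a b W. Z = W + (Y a + Y b) \<Longrightarrow> to.std (Y a + Y b)"
  then have pZ: "pairwise_std Z" by (simp add: pairwise_std_def)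
  obtain Z0 where Z0: "to.std Z0" "monval Z0 = monval Z"
    using to.std_exists[OF to.val_H[OF Z(1)]] by blast
  have "to.std (Y a + Y b)" if "Z0 = W + (Y a + Y b)" for a b W
    using Z0(1) to.std_factor[of "Y a + Y b" W] by (simp add: that add.commute)
  then have "pairwise_std Z0"
    using to.std_mons[OF Z0(1)] by (simp add: pairwise_std_def)
  from pairwise_std_unique[OF pZ this] Z0 show "to.std Z" by simp
qed

end

section \<open>Generators of Borel ideals\<close>

text \<open>For \<open>V\<close> inside \<open>mons {1..n}\<close> this is the ideal generated by
  \<open>V\<close>, described by supports so that membership is decided term by term.\<close>

definition monomial_span :: "nat \<Rightarrow> nat monom set \<Rightarrow> (nat, 'k::field) mpoly set" where
  "monomial_span n V = {f. keys f \<subseteq> mons {1..n} \<and> (\<forall>m\<in>keys f. \<exists>u\<in>V. mon_dvd u m)}"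

lemma mon_dvd_add: "mon_dvd u m \<Longrightarrow> mon_dvd u (m + v)"
  by (auto simp: mon_dvd_def add.assoc)

lemma mon_dvd_refl [simp]: "mon_dvd u u"
  unfolding mon_dvd_def by (rule exI[of _ 0]) simp

lemma mon_dvd_trans: "mon_dvd u v \<Longrightarrow> mon_dvd v w \<Longrightarrow> mon_dvd u w"
  by (auto simp: mon_dvd_def add.assoc)

lemma mon_dvd_eq: "mon_dvd u v \<Longrightarrow> mon_deg u = mon_deg v \<Longrightarrow> u = v"
  by (auto simp: mon_dvd_def mon_deg_add)

lemma monomial_span_ideal: "ideal (monomial_span n V :: (nat, 'k::field) mpoly set) (poly_ring {1..n})"
proof -
  interpret R: cring "poly_ring {1..n} :: (nat, 'k) mpoly ring" by (rule poly_ring_cring)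
  have closed: "x * a \<in> monomial_span n V"
    if a: "a \<in> monomial_span n V" and x: "keys x \<subseteq> mons {1..n}" for a x :: "(nat, 'k) mpoly"
  proof -
    have "m \<in> mons {1..n} \<and> (\<exists>u\<in>V. mon_dvd u m)" if m: "m \<in> keys (x * a)" for m
    proof -
      from m obtain v w where vw: "m = v + w" "v \<in> keys x" "w \<in> keys a" by (rule keys_mult_E)
      with a obtain u where u: "u \<in> V" "mon_dvd u w" by (auto simp: monomial_span_def)
      have "w \<in> mons {1..n}" "v \<in> mons {1..n}" using vw a x by (auto simp: monomial_span_def)
      with u vw mon_dvd_add[of u w v] show ?thesis by (auto simp: mons_add_iff add.commute)
    qed
    then show ?thesis by (auto simp: monomial_span_def)
  qed
  have inv: "\<ominus>\<^bsub>poly_ring {1..n}\<^esub> f = - f" if "keys f \<subseteq> mons {1..n}" for f :: "(nat, 'k) mpoly"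
    using that by (intro R.minus_equality) (auto simp: keys_uminus)
  have sub: "f + g \<in> monomial_span n V"
    if "f \<in> monomial_span n V" "g \<in> monomial_span n V" for f g :: "(nat, 'k) mpoly"
    using that Poly_Mapping.keys_add[of f g] by (fastforce simp: monomial_span_def)
  have "subgroup (monomial_span n V :: (nat, 'k) mpoly set) (add_monoid (poly_ring {1..n}))"
  proof (rule R.add.subgroupI)
    show "monomial_span n V \<subseteq> carrier (poly_ring {1..n} :: (nat, 'k) mpoly ring)"
      by (auto simp: monomial_span_def)
    have "0 \<in> (monomial_span n V :: (nat, 'k) mpoly set)" by (simp add: monomial_span_def)
    then show "(monomial_span n V :: (nat, 'k) mpoly set) \<noteq> {}" by blast
    show "\<ominus>\<^bsub>poly_ring {1..n}\<^esub> f \<in> monomial_span n V" if "f \<in> monomial_span n V" for f :: "(nat, 'k) mpoly"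
      using that inv[of f] by (simp add: monomial_span_def keys_uminus)
  qed (simp add: sub)
  then show ?thesis
    by (rule idealI[OF R.ring_axioms]) (use closed in \<open>auto simp: mult.commute\<close>)
qed

lemma monomial_span_eq_Idl:
  assumes V: "V \<subseteq> mons {1..n}"
  shows "(monomial_span n V :: (nat, 'k::field) mpoly set) = Idl\<^bsub>poly_ring {1..n}\<^esub> (mon ` V)"
proof -
  interpret R: cring "poly_ring {1..n} :: (nat, 'k) mpoly ring" by (rule poly_ring_cring)
  have carr: "mon ` V \<subseteq> carrier (poly_ring {1..n} :: (nat, 'k) mpoly ring)" using V by auto
  interpret J: ideal "Idl\<^bsub>poly_ring {1..n}\<^esub> (mon ` V :: (nat, 'k) mpoly set)" "poly_ring {1..n}"
    by (rule R.genideal_ideal[OF carr])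
  let ?J = "Idl\<^bsub>poly_ring {1..n}\<^esub> (mon ` V :: (nat, 'k) mpoly set)"
  show ?thesis
  proof
    show "?J \<subseteq> monomial_span n V"
      by (rule R.genideal_minimal[OF monomial_span_ideal])
        (use V mon_dvd_refl in \<open>auto simp: monomial_span_def subset_iff intro!: bexI\<close>)
    show "monomial_span n V \<subseteq> ?J"
    proof
      fix f :: "(nat, 'k) mpoly" assume f: "f \<in> monomial_span n V"
      have singles: "Poly_Mapping.single m c \<in> ?J" if m: "m \<in> keys f" for m c
      proof -
        from f m obtain u v where u: "u \<in> V" "m = u + v" by (auto simp: monomial_span_def mon_dvd_def)
        have "u + v \<in> mons {1..n}" using f m u by (auto simp: monomial_span_def)
        then have "v \<in> mons {1..n}" by (simp only: mons_add_iff)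
        moreover have "mon u \<in> ?J" using R.genideal_self[OF carr] u by blast
        ultimately have "Poly_Mapping.single v c \<otimes>\<^bsub>poly_ring {1..n}\<^esub> mon u \<in> ?J"
          by (intro J.I_l_closed) auto
        then show ?thesis by (simp add: u mon_def mult_single add.commute)
      qed
      have "(\<Sum>m\<in>F. Poly_Mapping.single m (lookup f m)) \<in> ?J" if "finite F" "F \<subseteq> keys f" for F
        using that
      proof (induction F rule: finite_induct)
        case empty
        show ?case using J.zero_closed by simp
      next
        case (insert m F)
        then have "Poly_Mapping.single m (lookup f m) \<oplus>\<^bsub>poly_ring {1..n}\<^esub>
            (\<Sum>m\<in>F. Poly_Mapping.single m (lookup f m)) \<in> ?J"
          by (intro J.a_closed singles) auto
        with insert show ?case by simp
      qed
      from this[of "keys f"] show "f \<in> ?J" by (simp add: poly_sum_singles)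
    qed
  qed
qed

lemma mon_in_monomial_span:
  "mon m \<in> monomial_span n V \<longleftrightarrow> m \<in> mons {1..n} \<and> (\<exists>u\<in>V. mon_dvd u m)"
  by (simp add: monomial_span_def)

lemma borel_up_move:
  assumes "w + Poly_Mapping.single j (Suc 0) \<in> borel_up n L" "i < j" "i \<in> {1..n}"
  shows "w + Poly_Mapping.single i (Suc 0) \<in> borel_up n L"
  using assms pre_swap[OF assms(2), of w]
  by (intro borel_up_mono[OF assms(1)]) (auto simp: borel_up_def mons_add_iff mon_deg_add)

lemma borel_up_refl: "L \<in> mons {1..n} \<Longrightarrow> L \<in> borel_up n L"
  by (simp add: borel_up_def)

lemma borel_up_mons: "borel_up n L \<subseteq> mons {1..n}"
  by (auto simp: borel_up_def)

lemma borel_ideal_monomial_span: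
  "borel_ideal n (monomial_span n (\<Union>L\<in>B. borel_up n L) :: (nat, 'k::field) mpoly set)"
proof -
  let ?V = "\<Union>L\<in>B. borel_up n L"
  have V: "?V \<subseteq> mons {1..n}" using borel_up_mons by blast
  have "\<exists>u\<in>?V. mon_dvd u (f + Poly_Mapping.single i (Suc 0))"
    if ij: "i \<in> {1..n}" "i < j" and u: "u \<in> ?V" "mon_dvd u (f + Poly_Mapping.single j (Suc 0))" for f i j u
  proof -
    from u(2) obtain v where v: "f + Poly_Mapping.single j (Suc 0) = u + v" by (auto simp: mon_dvd_def)
    show ?thesis
    \<comment> \<open>If \<open>x_j\<close> divides the cofactor, then \<open>u\<close> already
      divides \<open>f\<close>; otherwise it divides \<open>u\<close>, and the move takes place
      inside \<open>u\<close>.\<close>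
    proof (cases "j \<in> keys v")
      case True
      then obtain v' where "v = v' + Poly_Mapping.single j (Suc 0)" by (rule monom_split)
      with v have "f + Poly_Mapping.single j (Suc 0) = (u + v') + Poly_Mapping.single j (Suc 0)"
        by (simp add: ac_simps)
      then have "f = u + v'" by (simp only: add_right_cancel)
      then have "mon_dvd u f" by (auto simp: mon_dvd_def)
      with u(1) mon_dvd_add show ?thesis by blast
    next
      case False
      have "j \<in> keys (u + v)" by (simp flip: v add: keys_add_monom)
      with False have "j \<in> keys u" by (simp add: keys_add_monom)
      then obtain w where w: "u = w + Poly_Mapping.single j (Suc 0)" by (rule monom_split)
      with v have "f + Poly_Mapping.single j (Suc 0) = (w + v) + Poly_Mapping.single j (Suc 0)"
        by (simp add: ac_simps)
      then have "f = w + v" by (simp only: add_right_cancel)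
      then have "mon_dvd (w + Poly_Mapping.single i (Suc 0)) (f + Poly_Mapping.single i (Suc 0))"
        by (auto simp: mon_dvd_def ac_simps)
      moreover have "w + Poly_Mapping.single i (Suc 0) \<in> ?V"
        using u(1) w ij borel_up_move by blast
      ultimately show ?thesis by blast
    qed
  qed
  note move = this
  have "\<forall>f\<in>mons {1..n}. \<forall>i\<in>{1..n}. \<forall>j\<in>{1..n}. i < j \<longrightarrow>
      mon (f + Poly_Mapping.single j 1) \<in> (monomial_span n ?V :: (nat, 'k) mpoly set) \<longrightarrow>
      mon (f + Poly_Mapping.single i 1) \<in> (monomial_span n ?V :: (nat, 'k) mpoly set)"
  proof (intro ballI impI)
    fix f i j assume f: "f \<in> mons {1..n}" "i \<in> {1..n}" "j \<in> {1..n}" "i < j"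
      and "mon (f + Poly_Mapping.single j 1) \<in> (monomial_span n ?V :: (nat, 'k) mpoly set)"
    then obtain u where "u \<in> ?V" "mon_dvd u (f + Poly_Mapping.single j (Suc 0))"
      unfolding mon_in_monomial_span One_nat_def by blast
    from move[OF f(2,4) this] f(1,2)
    show "mon (f + Poly_Mapping.single i 1) \<in> (monomial_span n ?V :: (nat, 'k) mpoly set)"
      unfolding mon_in_monomial_span by (simp add: mons_add_iff)
  qed
  moreover have "monomial_ideal n (monomial_span n ?V :: (nat, 'k) mpoly set)"
    unfolding monomial_ideal_def using V monomial_span_eq_Idl[OF V] by blast
  ultimately show ?thesis by (simp add: borel_ideal_def)
qed

text \<open>Induction on the total of the prefix sums. At the first index \<open>i\<close> where
  \<open>u\<close> exceeds \<open>L\<close>, replacing one \<open>x_i\<close> by the next variable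
  lowers only the prefix sum at \<open>i\<close>. The result lies in \<open>J\<close> by induction,
  and the Borel property moves the variable back.\<close>

lemma borel_up_in_borel_ideal:
  assumes J: "borel_ideal n (J :: (nat, 'k::field) mpoly set)" and L: "mon L \<in> J" "L \<in> mons {1..n}"
    and u: "u \<in> borel_up n L"
  shows "mon u \<in> J"
  using u
proof (induction "\<Sum>i\<le>n. pre u i" arbitrary: u rule: less_induct)
  case less
  have um: "u \<in> mons {1..n}" and ge: "\<And>i. pre L i \<le> pre u i" and du: "mon_deg u = mon_deg L"
    using less.prems by (auto simp: borel_up_def)
  show ?case
  proof (cases "u = L")
    case False
    then have ex: "\<exists>i. pre L i < pre u i" using pre_eqD[of u L] ge by (metis le_neq_implies_less)
    define i where "i = (LEAST i. pre L i < pre u i)"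
    have i: "pre L i < pre u i" unfolding i_def using ex by (rule LeastI_ex)
    have i_min: "pre u j = pre L j" if "j < i" for j
      using not_less_Least[of j "\<lambda>i. pre L i < pre u i"] that ge[of j] by (simp add: i_def)
    have "i < n" using i pre_top[of u n i] pre_top[of L n i] um L du by (cases "i < n") auto
    \<comment> \<open>The prefix sums agree before \<open>i\<close> and those of \<open>u\<close>
      are larger at \<open>i\<close>, so \<open>x_i\<close> occurs in \<open>u\<close>.\<close>
    have "lookup u i > 0"
    proof (cases i)
      case 0
      with i show ?thesis by (simp add: pre_def)
    next
      case (Suc j)
      with i i_min[of j] show ?thesis by (simp add: pre_Suc) 
    qed
    then have iu: "i \<in> keys u" by (simp add: in_keys_iff)
    then have in': "i \<in> {1..n}" using um by (auto simp: mons_def)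
    from iu obtain w where w: "u = w + Poly_Mapping.single i (Suc 0)" by (rule monom_split)
    let ?v = "w + Poly_Mapping.single (Suc i) (Suc 0)"
    have wm: "w \<in> mons {1..n}" using um by (simp add: w mons_add_iff)
    have pv: "pre ?v j = (if j = i then pre u j - 1 else pre u j)" for j
      by (auto simp: w pre_add pre_single)
    have v: "?v \<in> borel_up n L"
      unfolding borel_up_def using \<open>i < n\<close> wm du i ge by (auto simp: mons_add_iff mon_deg_add pv w)
    have "(\<Sum>j\<le>n. pre ?v j) < (\<Sum>j\<le>n. pre u j)"
      by (rule sum_strict_mono_ex1) (use i \<open>i < n\<close> in \<open>auto simp: pv intro!: bexI[of _ i]\<close>)
    from less.hyps[OF this v] have "mon (w + Poly_Mapping.single (Suc i) 1) \<in> J" by simp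
    then have "mon (w + Poly_Mapping.single i 1) \<in> J"
      using J wm in' \<open>i < n\<close> unfolding borel_ideal_def by (meson Suc_leI atLeastAtMost_iff le_SucI lessI)
    then show ?thesis by (simp add: w)
  qed (use L in simp)
qed

text \<open>The Borel ideal lies inside the monomial span of the union, and contains the union by
  \<open>borel_up_in_borel_ideal\<close>. All elements of the union have degree \<open>d\<close>, so
  none properly divides another and all are minimal.\<close>

lemma gens_Borel:
  assumes B: "B \<subseteq> mons {1..n}" "\<And>L. L \<in> B \<Longrightarrow> mon_deg L = d"
  shows "gens (Borel n B :: (nat, 'k::field) mpoly set) = (\<Union>L\<in>B. borel_up n L)" (is "gens ?I = ?V")
proof -
  have deg: "mon_deg u = d" if "u \<in> ?V" for u using that B by (auto simp: borel_up_def)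
  have "mon L \<in> (monomial_span n ?V :: (nat, 'k) mpoly set)" if "L \<in> B" for L
  proof -
    have L: "L \<in> mons {1..n}" using B that by blast
    from borel_up_refl[OF L] that have "L \<in> ?V" by blast
    with L show ?thesis unfolding mon_in_monomial_span using mon_dvd_refl by blast
  qed
  then have "?I \<subseteq> monomial_span n ?V"
    unfolding Borel_def using borel_ideal_monomial_span[of n B] by (intro Inter_lower) blast
  then have dvd: "\<exists>u\<in>?V. mon_dvd u m" if "mon m \<in> ?I" for m
    using that by (auto simp: mon_in_monomial_span subset_iff)
  have V_I: "mon u \<in> ?I" if "u \<in> ?V" for u
    using that borel_up_in_borel_ideal B unfolding Borel_def by blast
  show ?thesis
  proof (intro equalityI subsetI)
    fix m assume m: "m \<in> gens ?I"
    then obtain u where "u \<in> ?V" "mon_dvd u m" using dvd[of m] by (auto simp: gens_def)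
    with m V_I show "m \<in> ?V" by (auto simp: gens_def)
  next
    fix m assume m: "m \<in> ?V"
    have "u = m" if u: "mon u \<in> ?I" "mon_dvd u m" for u
    proof -
      obtain v where v: "v \<in> ?V" "mon_dvd v u" using dvd[OF u(1)] by blast
      with u have "v = m" using mon_dvd_trans mon_dvd_eq deg m by metis
      moreover have "mon_deg v \<le> mon_deg u" "mon_deg u \<le> mon_deg m"
        using v(2) u(2) by (auto simp: mon_dvd_def mon_deg_add)
      ultimately have "mon_deg u = mon_deg m" by simp
      with u(2) show ?thesis by (rule mon_dvd_eq)
    qed
    then show "m \<in> gens ?I" using V_I m by (auto simp: gens_def)
  qed
qed

theorem theorem5p12:
  fixes n d :: nat
    and M N :: "nat monom"
    and I :: "(nat, 'k::field) mpoly set"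
  assumes "two_borel n d M N I"
    and "lex_earlier M N"
  shows "(\<exists>G. groebner_basis (toric_poly_ring I) (fiber_sink_order n M I) (toric_ideal n I) G \<and>
              (\<forall>g\<in>G. homogeneous 2 g)) \<and>
         koszul (toric_ring n I) (toric_grading n I)"
proof -
  have MN: "M \<in> mons {1..n}" "N \<in> mons {1..n}" "mon_deg M = d" "mon_deg N = d" "M \<noteq> N"
    and I: "I = Borel n {M, N}"
    using assms(1) by (auto simp: two_borel_def borel_generators_def)
  \<comment> \<open>In degree zero \<open>M\<close> and \<open>N\<close> would both be the monomial
    1.\<close>
  have "d > 0" using MN by (metis gr0I mon_deg_0_iff)
  define GM where "GM = borel_up n M"
  define U where "U = gens I"
  define before where "before = fiber_sink_before n M I"
  have U: "U = borel_up n M \<union> borel_up n N"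
    unfolding U_def I using MN gens_Borel[of "{M, N}" n d, where ?'k = 'k] by auto
  have GM: "gens (Borel n {M} :: (nat, 'k) mpoly set) = GM"
    unfolding GM_def using MN gens_Borel[of "{M}" n d, where ?'k = 'k] by auto
  define rk where "rk = finite_variable_order.gr_rank U before"
  interpret two_borel_monomials n d M N U GM "U - GM" rk before
  proof
    show "before v w \<longleftrightarrow> (v \<in> U - GM \<and> w \<in> U - GM \<and> lex_earlier w v) \<or> (v \<in> U - GM \<and> w \<in> GM) \<or>
        (v \<in> GM \<and> w \<in> GM \<and> lex_earlier v w)" for v w
      by (simp add: before_def fiber_sink_before_def GM U_def[symmetric] Let_def)
  qed (use MN \<open>d > 0\<close> in \<open>auto simp: GM_def U rk_def\<close>)
  interpret toric_setup U rk n I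
    by unfold_locales (use U_D in \<open>auto simp: U_def\<close>)
  have "fiber_sink_order n M I Z Z' \<longleftrightarrow> rk Z' < rk Z" if "Z \<in> mons U" "Z' \<in> mons U" for Z Z'
    using rk_gr[OF that] by (simp add: fiber_sink_order_def before_def U_def)
  from quadratic_groebner_basis[OF this] toric_ring_koszul show ?thesis by blast
qed

end
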